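(* Let $\{X_t\}_{t\ge0}$ be the stationary Ornstein-Uhlenbeck process with parameters $\alpha,\tau>0$, considered at the times $0,1,\dots,n$. Set $g(x):=-\ln[\sin(2\pi(x-1/4))]$ for $x\in(1/4,1/2)$. Let $$\hat p_k^0:=\frac{1}{n-k}\sum_{j=0}^{n-k}\mathbf{1}(X_j>0,\,X_{j+k}>0)$$ be an empirical estimate of $p_k:=\mathbb{P}(X_0>0,X_k>0)$. Then $$\hat\alpha_k^0:=\frac{g(\hat p_k^0)}{k},\qquad k=1,2,\ldots,$$ are strongly consistent and asymptotically normal (as $n\to\infty$) estimators of $\alpha$ with $${\rm Var}(\hat\alpha_k^0)\sim\frac{v_k^2\,(g'(p_k))^2}{nk^2},$$ where $$v_k^2:=p_k(1-p_k)+2\sum_{l=1}^\infty\Bigl(\mathbb{P}(X_{k+l}>0,X_l>0,X_k>0,X_0>0)-p_k^2\Bigr).$$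
   Context: The stationary Ornstein-Uhlenbeck process with parameters $\alpha,\tau>0$ is the stationary solution of $dX_t=-\alpha X_t\,dt+\tau\,dW_t$, $t\ge0$, where $W_t$ is a standard Wiener process; it is a centered Gaussian Markov process with variance $\tau^2/(2\alpha)$ and correlation function $\rho(X_s,X_t)=e^{-\alpha|t-s|}$. $\mathbf{1}(\cdot)$ denotes the indicator function, $g'$ is the derivative of $g$, and ${\rm Var}$ denotes variance. The relation $\sim$ means that the ratio of the two sides tends to $1$ as $n\to\infty$ (with $k$ fixed).
   Formalization: Since the estimate of p_k falls outside (1/4,1/2) with positive probability, where g is undefined, g is extended there by an arbitrary bounded function, and the claims are proved for every such extension. *)

theory Defs
  imports "HOL-Probability.Probability" "HOL-Library.Landau_Symbols"
begin

definition standard_Wiener :: "'a measure \<Rightarrow> (real \<Rightarrow> 'a \<Rightarrow> real) \<Rightarrow> bool" where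
  "standard_Wiener M W \<longleftrightarrow>
     (\<forall>t\<ge>0. W t \<in> borel_measurable M) \<and>
     (AE \<omega> in M. W 0 \<omega> = 0) \<and>
     (\<forall>s t. 0 \<le> s \<and> s < t \<longrightarrow>
        distributed M lborel (\<lambda>\<omega>. W t \<omega> - W s \<omega>) (normal_density 0 (sqrt (t - s)))) \<and>
     (\<forall>t :: nat \<Rightarrow> real. 0 \<le> t 0 \<and> mono t \<longrightarrow>
        prob_space.indep_vars M (\<lambda>_. borel) (\<lambda>i \<omega>. W (t (Suc i)) \<omega> - W (t i) \<omega>) UNIV) \<and>
     (AE \<omega> in M. continuous_on {0..} (\<lambda>t. W t \<omega>))"

definition stationary_process :: "'a measure \<Rightarrow> (real \<Rightarrow> 'a \<Rightarrow> real) \<Rightarrow> bool" where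
  "stationary_process M X \<longleftrightarrow>
     (\<forall>t\<ge>0. X t \<in> borel_measurable M) \<and>
     (\<forall>J h. finite J \<and> J \<subseteq> {0..} \<and> 0 \<le> h \<longrightarrow>
        distr M (PiM J (\<lambda>_. borel)) (\<lambda>\<omega>. \<lambda>t\<in>J. X (t + h) \<omega>) =
        distr M (PiM J (\<lambda>_. borel)) (\<lambda>\<omega>. \<lambda>t\<in>J. X t \<omega>))"

(* The noise is additive, so the SDE dX = -a X dt + b dW is, in integrated form, a pathwise
   identity without stochastic integrals.  As usual, the initial value is independent of the
   driving Wiener process. *)
definition OU_solution ::
    "'a measure \<Rightarrow> real \<Rightarrow> real \<Rightarrow> (real \<Rightarrow> 'a \<Rightarrow> real) \<Rightarrow> (real \<Rightarrow> 'a \<Rightarrow> real) \<Rightarrow> bool" where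
  "OU_solution M a b W X \<longleftrightarrow>
     (\<forall>t\<ge>0. X t \<in> borel_measurable M) \<and>
     (AE \<omega> in M. continuous_on {0..} (\<lambda>t. X t \<omega>)) \<and>
     (AE \<omega> in M. \<forall>t\<ge>0. X t \<omega> = X 0 \<omega> - a * integral {0..t} (\<lambda>s. X s \<omega>) + b * W t \<omega>) \<and>
     prob_space.indep_set M
       (sets (vimage_algebra (space M) (X 0) borel))
       (sets (vimage_algebra (space M) (\<lambda>\<omega>. \<lambda>t\<in>{0..}. W t \<omega>) (PiM {0..} (\<lambda>_. borel))))"

definition stationary_OU ::
    "'a measure \<Rightarrow> real \<Rightarrow> real \<Rightarrow> (real \<Rightarrow> 'a \<Rightarrow> real) \<Rightarrow> bool" where
  "stationary_OU M a b X \<longleftrightarrow>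
     prob_space M \<and> stationary_process M X \<and>
     (\<exists>W. standard_Wiener M W \<and> OU_solution M a b W X)"

(* The estimate of p_k can leave (1/4, 1/2) with positive probability, where the formula for g
   is not defined; h supplies arbitrary values there. *)
definition g_ext :: "(real \<Rightarrow> real) \<Rightarrow> real \<Rightarrow> real" where
  "g_ext h x = (if 1/4 < x \<and> x < 1/2 then - ln (sin (2 * pi * (x - 1/4))) else h x)"

definition p_prob :: "'a measure \<Rightarrow> (real \<Rightarrow> 'a \<Rightarrow> real) \<Rightarrow> nat \<Rightarrow> real" where
  "p_prob M X k = measure M {\<omega> \<in> space M. X 0 \<omega> > 0 \<and> X (real k) \<omega> > 0}"

(* There are n - k + 1 summands but the normalisation is by n - k. *)
definition p_hat :: "(real \<Rightarrow> 'a \<Rightarrow> real) \<Rightarrow> nat \<Rightarrow> nat \<Rightarrow> 'a \<Rightarrow> real" where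
  "p_hat X k n \<omega> = 1 / (real n - real k) *
     (\<Sum>j=0..n-k. of_bool (X (real j) \<omega> > 0 \<and> X (real (j + k)) \<omega> > 0))"

definition alpha_hat ::
    "(real \<Rightarrow> real) \<Rightarrow> (real \<Rightarrow> 'a \<Rightarrow> real) \<Rightarrow> nat \<Rightarrow> nat \<Rightarrow> 'a \<Rightarrow> real" where
  "alpha_hat h X k n \<omega> = g_ext h (p_hat X k n \<omega>) / real k"

definition orthant_cov :: "'a measure \<Rightarrow> (real \<Rightarrow> 'a \<Rightarrow> real) \<Rightarrow> nat \<Rightarrow> nat \<Rightarrow> real" where
  "orthant_cov M X k l =
     measure M {\<omega> \<in> space M. X (real (k + l)) \<omega> > 0 \<and> X (real l) \<omega> > 0 \<and>
                             X (real k) \<omega> > 0 \<and> X 0 \<omega> > 0} - (p_prob M X k)\<^sup>2"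

definition v_sq :: "'a measure \<Rightarrow> (real \<Rightarrow> 'a \<Rightarrow> real) \<Rightarrow> nat \<Rightarrow> real" where
  "v_sq M X k = p_prob M X k * (1 - p_prob M X k) + 2 * (\<Sum>l. orthant_cov M X k (Suc l))"

definition strongly_consistent :: "'a measure \<Rightarrow> (nat \<Rightarrow> 'a \<Rightarrow> real) \<Rightarrow> real \<Rightarrow> bool" where
  "strongly_consistent M T \<theta> \<longleftrightarrow> (AE \<omega> in M. (\<lambda>n. T n \<omega>) \<longlonglongrightarrow> \<theta>)"

definition asymptotically_normal ::
    "'a measure \<Rightarrow> (nat \<Rightarrow> 'a \<Rightarrow> real) \<Rightarrow> real \<Rightarrow> real \<Rightarrow> bool" where
  "asymptotically_normal M T \<theta> s2 \<longleftrightarrow>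
     0 < s2 \<and> (\<forall>n. T n \<in> borel_measurable M) \<and>
     weak_conv_m (\<lambda>n. distr M borel (\<lambda>\<omega>. sqrt (real n) * (T n \<omega> - \<theta>)))
                 (density lborel (normal_density 0 (sqrt s2)))"

end

theory Submission
  imports Defs "HOL-Real_Asymp.Real_Asymp"
begin

text \<open>
  Integrating the SDE against \<open>e\<^sup>\<alpha>\<^sup>t\<close> shows that \<open>X\<close> at integer times is an AR(1) sequence with coefficient
  \<open>\<rho> = e\<^sup>-\<^sup>\<alpha>\<close>: the innovation \<open>X\<^sub>j\<^sub>+\<^sub>1 - \<rho> X\<^sub>j\<close> is an almost sure limit of weighted sums of Wiener
  increments, hence Gaussian, and the innovations and \<open>X\<^sub>0\<close> are independent. The law of \<open>X\<^sub>0\<close> follows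
  from stationarity.

  Replacing \<open>X\<^sub>j\<close> by \<open>X\<^sub>j - \<rho>\<^sup>j\<^sup>-\<^sup>i X\<^sub>i\<close>, which is independent of the past up to \<open>i\<close>, changes the sign of
  \<open>X\<^sub>j\<close> only with exponentially small probability, so the centred indicators are exponentially weakly
  dependent on the past. For bounded sequences with this property, telescoping over time
  with a gap of length \<open>O(log n)\<close> between past and present bounds the fourth moment of the partial
  sums (hence the strong law) and yields an approximate recursion for their characteristic function (hence the
  central limit theorem). The limiting variance is positive because the covariances are
  nonnegative by Harris' inequality.

  Since \<open>P(X\<^sub>0 > 0, X\<^sub>k > 0) = 1/4 + arcsin(\<rho>\<^sup>k)/(2\<pi>)\<close>, \<open>g\<close> maps \<open>p\<^sub>k\<close> to \<open>\<alpha> k\<close>, and the delta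
  method applies. For the variance, note that the estimate of \<open>p\<^sub>k\<close> is a fraction with denominator \<open>n - k\<close>, so
  \<open>g\<close> of it is at most logarithmic in \<open>n\<close>, which the fourth moment bound compensates.
\<close>

section \<open>Independence and characteristic functions\<close>

text \<open>Convergence in law does not control variances, so the delta method is carried out in
  mean square: the Taylor remainder of \<open>g\<close> must be \<open>o(1/n)\<close> in second
  moment, although \<open>g\<close> has a logarithmic singularity at 1/4 and is continued
  arbitrarily outside (1/4, 1/2). On the event that the estimate is far from \<open>p_k\<close>, a
  second moment bound would leave a divergent \<open>ln(n)^2\<close>. The fourth moment bound of
  order \<open>n^(5/2)\<close>, weaker than the optimal \<open>n^2\<close>, already gives
  \<open>ln(n)^2 / sqrt n\<close> there and a summable \<open>n^(-3/2)\<close> in the strong law.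

  Decoupling is stated for expectations against complex functions of the past of modulus at most 1.
  One inequality then serves both moments and characteristic functions, and no conditional
  expectations occur. Likewise no stochastic integral occurs: the factor multiplying the noise is
  deterministic, so Riemann sums of Wiener increments converge path by path.\<close>

lemma (in prob_space) indep_vars_lebesgue_integral_finite:
  fixes Y :: "'i \<Rightarrow> 'a \<Rightarrow> real" and f :: "'i \<Rightarrow> real \<Rightarrow> real"
  assumes "indep_vars (\<lambda>_. borel) Y I" "J \<subseteq> I" "finite J"
    and f: "\<And>i. f i \<in> borel_measurable borel" "\<And>i y. \<bar>f i y\<bar> \<le> 1"
  shows "(\<integral>x. (\<Prod>j\<in>J. f j (Y j x)) \<partial>M) = (\<Prod>j\<in>J. \<integral>x. f j (Y j x) \<partial>M)"
proof -
  have iv: "indep_vars (\<lambda>_. borel) (\<lambda>j x. f j (Y j x)) J"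
    by (rule indep_vars_compose2[OF indep_vars_subset[OF assms(1,2)] f(1)])
  show ?thesis
  proof (rule indep_vars_lebesgue_integral[OF \<open>finite J\<close> iv])
    fix j assume "j \<in> J"
    then have [measurable]: "Y j \<in> borel_measurable M" "f j \<in> borel_measurable borel"
      using assms(1,2) f by (auto simp: indep_vars_def)
    show "integrable M (\<lambda>x. f j (Y j x))"
      by (rule integrable_const_bound[where B=1]) (auto simp: f)
  qed
qed

lemma (in prob_space) expectation_prod_tendsto:
  fixes f :: "nat \<Rightarrow> 'i \<Rightarrow> 'a \<Rightarrow> real"
  assumes "finite J" and [measurable]: "\<And>n j. j \<in> J \<Longrightarrow> f n j \<in> borel_measurable M" "\<And>j. j \<in> J \<Longrightarrow> g j \<in> borel_measurable M"
    and bound: "\<And>n j x. \<bar>f n j x\<bar> \<le> 1"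
    and lim: "\<And>j. j \<in> J \<Longrightarrow> AE x in M. (\<lambda>n. f n j x) \<longlonglongrightarrow> g j x"
  shows "(\<lambda>n. \<integral>x. (\<Prod>j\<in>J. f n j x) \<partial>M) \<longlonglongrightarrow> (\<integral>x. (\<Prod>j\<in>J. g j x) \<partial>M)"
    and "(\<lambda>n. \<Prod>j\<in>J. \<integral>x. f n j x \<partial>M) \<longlonglongrightarrow> (\<Prod>j\<in>J. \<integral>x. g j x \<partial>M)"
proof -
  have "AE x in M. \<forall>j\<in>J. (\<lambda>n. f n j x) \<longlonglongrightarrow> g j x"
    using assms(1) lim by (subst AE_finite_all) auto
  then have "AE x in M. (\<lambda>n. \<Prod>j\<in>J. f n j x) \<longlonglongrightarrow> (\<Prod>j\<in>J. g j x)"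
    by eventually_elim (intro tendsto_prod, auto)
  moreover have "norm (\<Prod>j\<in>J. f n j x) \<le> 1" for n x
    using bound by (auto simp: abs_prod intro!: prod_le_1)
  ultimately show "(\<lambda>n. \<integral>x. (\<Prod>j\<in>J. f n j x) \<partial>M) \<longlonglongrightarrow> (\<integral>x. (\<Prod>j\<in>J. g j x) \<partial>M)"
    by (intro integral_dominated_convergence[where w="\<lambda>_. 1"]) auto
  show "(\<lambda>n. \<Prod>j\<in>J. \<integral>x. f n j x \<partial>M) \<longlonglongrightarrow> (\<Prod>j\<in>J. \<integral>x. g j x \<partial>M)"
  proof (rule tendsto_prod)
    fix j assume "j \<in> J"
    then show "(\<lambda>n. \<integral>x. f n j x \<partial>M) \<longlonglongrightarrow> (\<integral>x. g j x \<partial>M)"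
      using bound lim by (intro integral_dominated_convergence[where w="\<lambda>_. 1"]) auto
  qed
qed

text \<open>Dominated convergence preserves the product rule for bounded continuous functions. The
  ramps \<open>\<psi> c m\<close> increase to the indicator of \<open>{..<c}\<close> as
  \<open>m\<close> grows, and these half-lines form an intersection-stable generator of the Borel
  sets, which turns the product rule back into independence.\<close>

lemma (in prob_space) indep_vars_limit:
  fixes Y :: "nat \<Rightarrow> 'i \<Rightarrow> 'a \<Rightarrow> real"
  assumes indep: "\<And>n. indep_vars (\<lambda>_. borel) (Y n) I"
    and Z[measurable]: "\<And>i. i \<in> I \<Longrightarrow> Z i \<in> borel_measurable M"
    and lim: "\<And>i. i \<in> I \<Longrightarrow> AE x in M. (\<lambda>n. Y n i x) \<longlonglongrightarrow> Z i x"
  shows "indep_vars (\<lambda>_. borel) Z I"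
proof -
  define F where "F i = {Z i -` {..<c} \<inter> space M | c. True}" for i
  define \<psi> :: "real \<Rightarrow> nat \<Rightarrow> real \<Rightarrow> real" where "\<psi> c m y = max 0 (min 1 (real m * (c - y)))" for c m y
  have \<psi>_cont: "continuous_on UNIV (\<psi> c m)" for c m
    unfolding \<psi>_def by (intro continuous_intros)
  have \<psi>_bd: "\<bar>\<psi> c m y\<bar> \<le> 1" for c m y unfolding \<psi>_def by auto
  have \<psi>_meas[measurable]: "\<psi> c m \<in> borel_measurable borel" for c m
    by (rule borel_measurable_continuous_onI[OF \<psi>_cont])
  have \<psi>_lim: "(\<lambda>m. \<psi> c m y) \<longlonglongrightarrow> indicator {..<c} y" for c y
  proof (cases "y < c")
    case True
    have "eventually (\<lambda>m. real m * (c - y) \<ge> 1) sequentially"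
      using True by real_asymp
    then have "eventually (\<lambda>m. \<psi> c m y = 1) sequentially"
      by eventually_elim (auto simp: \<psi>_def)
    then show ?thesis using True by (simp add: tendsto_eventually)
  next
    case False
    then have "\<psi> c m y = 0" for m
      using mult_nonneg_nonpos[of "real m" "c - y"] by (auto simp: \<psi>_def)
    then show ?thesis using False by simp
  qed
  have Ymeas: "Y n i \<in> borel_measurable M" if "i \<in> I" for n i
    using indep[of n] that by (auto simp: indep_vars_def)
  have step1: "(\<integral>x. (\<Prod>j\<in>J. \<psi> (c j) m (Z j x)) \<partial>M) = (\<Prod>j\<in>J. \<integral>x. \<psi> (c j) m (Z j x) \<partial>M)"
    if J: "J \<subseteq> I" "finite J" for J c m
  proof -
    have [measurable]: "Y n j \<in> borel_measurable M" "Z j \<in> borel_measurable M" if "j \<in> J" for n j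
      using J that Ymeas Z by auto
    have mY: "(\<lambda>x. \<psi> (c j) m (Y n j x)) \<in> borel_measurable M" and mZ: "(\<lambda>x. \<psi> (c j) m (Z j x)) \<in> borel_measurable M"
      if "j \<in> J" for n j using that by simp_all
    have l: "AE x in M. (\<lambda>n. \<psi> (c j) m (Y n j x)) \<longlonglongrightarrow> \<psi> (c j) m (Z j x)" if "j \<in> J" for j
      using lim[OF subsetD[OF J(1) that]] by eventually_elim (rule continuous_on_tendsto_compose[OF \<psi>_cont], auto)
    have "(\<integral>x. (\<Prod>j\<in>J. \<psi> (c j) m (Y n j x)) \<partial>M) = (\<Prod>j\<in>J. \<integral>x. \<psi> (c j) m (Y n j x) \<partial>M)" for n
      by (rule indep_vars_lebesgue_integral_finite[OF indep J, where f="\<lambda>j. \<psi> (c j) m"]) (auto simp: \<psi>_bd)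
    then show ?thesis
      using expectation_prod_tendsto[where f="\<lambda>n j x. \<psi> (c j) m (Y n j x)" and g="\<lambda>j x. \<psi> (c j) m (Z j x)", OF J(2) mY mZ \<psi>_bd l]
        LIMSEQ_unique by simp
  qed
  have step2: "prob (\<Inter>j\<in>J. Z j -` {..<c j} \<inter> space M) = (\<Prod>j\<in>J. prob (Z j -` {..<c j} \<inter> space M))"
    if J: "J \<subseteq> I" "finite J" "J \<noteq> {}" for J c
  proof -
    have [measurable]: "Z j \<in> borel_measurable M" if "j \<in> J" for j
      using J that Z by auto
    have mZ: "(\<lambda>x. \<psi> (c j) m (Z j x)) \<in> borel_measurable M" and mI: "(\<lambda>x. indicator {..<c j} (Z j x)) \<in> borel_measurable M"
      if "j \<in> J" for m j using that by simp_all
    have eq: "(\<integral>x. (\<Prod>j\<in>J. indicator {..<c j} (Z j x)) \<partial>M) = (\<Prod>j\<in>J. \<integral>x. indicator {..<c j} (Z j x) \<partial>M :: real)"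
      using expectation_prod_tendsto[where f="\<lambda>m j x. \<psi> (c j) m (Z j x)" and g="\<lambda>j x. indicator {..<c j} (Z j x)", OF J(2) mZ mI \<psi>_bd AE_I2[OF \<psi>_lim]]
        step1[OF J(1,2)] LIMSEQ_unique by simp
    have 1: "(\<integral>x. indicator {..<c j} (Z j x) \<partial>M) = prob (Z j -` {..<c j} \<inter> space M)" if "j \<in> J" for j
    proof -
      have "(\<integral>x. indicator {..<c j} (Z j x) \<partial>M) = (\<integral>x. indicator (Z j -` {..<c j} \<inter> space M) x \<partial>M :: real)"
        by (rule Bochner_Integration.integral_cong) (auto simp: indicator_def)
      then show ?thesis using that by simp
    qed
    have "(\<integral>x. (\<Prod>j\<in>J. indicator {..<c j} (Z j x)) \<partial>M)
       = (\<integral>x. indicator (\<Inter>j\<in>J. Z j -` {..<c j} \<inter> space M) x \<partial>M :: real)"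
    proof (rule Bochner_Integration.integral_cong)
      fix x assume "x \<in> space M"
      then show "(\<Prod>j\<in>J. indicator {..<c j} (Z j x)) = (indicator (\<Inter>j\<in>J. Z j -` {..<c j} \<inter> space M) x :: real)"
        using J by (cases "\<forall>j\<in>J. Z j x < c j") (auto simp: indicator_def intro!: prod_zero)
    qed simp
    also have "\<dots> = prob (\<Inter>j\<in>J. Z j -` {..<c j} \<inter> space M)"
      using J sets.finite_INT[of J "\<lambda>j. Z j -` {..<c j} \<inter> space M" M]
      by (simp add: Int_absorb2 sets.sets_into_space)
    finally show ?thesis using eq 1 by simp
  qed
  have "indep_sets F I"
  proof (rule indep_setsI)
    fix A J assume J: "J \<noteq> {}" "J \<subseteq> I" "finite J" "\<forall>j\<in>J. A j \<in> F j"
    then have "\<forall>j\<in>J. \<exists>c. A j = Z j -` {..<c} \<inter> space M" by (auto simp: F_def)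
    then obtain c where "\<And>j. j \<in> J \<Longrightarrow> A j = Z j -` {..<c j} \<inter> space M" by metis
    then show "prob (\<Inter>j\<in>J. A j) = (\<Prod>j\<in>J. prob (A j))"
      using step2[OF J(2,3,1), of c] by (metis (no_types, lifting) INF_cong prod.cong)
  qed (auto simp: F_def)
  moreover have "Int_stable (F i)" for i
  proof (rule Int_stableI)
    fix A B assume "A \<in> F i" "B \<in> F i"
    then obtain c d where "A = Z i -` {..<c} \<inter> space M" "B = Z i -` {..<d} \<inter> space M" by (auto simp: F_def)
    then have "A \<inter> B = Z i -` {..<min c d} \<inter> space M" by auto
    then show "A \<inter> B \<in> F i" by (auto simp: F_def)
  qed
  ultimately have "indep_sets (\<lambda>i. sigma_sets (space M) (F i)) I"
    by (rule indep_sets_sigma)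
  moreover have "{Z i -` A \<inter> space M |A. A \<in> sets borel} = sigma_sets (space M) (F i)" for i
  proof -
    have "F i = (\<lambda>A. Z i -` A \<inter> space M) ` range lessThan"
      unfolding F_def by auto
    moreover have "sets borel = sigma_sets UNIV (range (lessThan :: real \<Rightarrow> _))"
      by (subst borel_Iio) (simp add: sets_measure_of)
    ultimately show ?thesis
      using sigma_sets_vimage_commute[of "Z i" "space M" UNIV "range lessThan"]
      by (auto simp: Setcompr_eq_image image_image)
  qed
  ultimately show ?thesis
    unfolding indep_vars_def2 using Z by auto
qed

text \<open>Adjoins the initial value to the noise sequence. Independence of \<open>X\<close> from
  each \<open>Y i\<close> separately would not do: a finite intersection involving index 0 splits
  into an event of \<open>X\<close> and a cylinder event \<open>C\<close> of the sequence
  \<open>Y\<close>, so \<open>XY\<close> is about the whole sequence.\<close>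

lemma (in prob_space) indep_vars_case_nat:
  assumes Y: "indep_vars (\<lambda>_. N) Y UNIV"
    and X: "X \<in> measurable M N"
    and XY: "indep_set {X -` A \<inter> space M |A. A \<in> sets N}
      {(\<lambda>x. \<lambda>i\<in>UNIV. Y i x) -` A \<inter> space M |A. A \<in> sets (PiM UNIV (\<lambda>_. N))}"
  shows "indep_vars (\<lambda>_. N) (case_nat X Y) UNIV"
  unfolding indep_vars_def2
proof safe
  note X[measurable]
  have [measurable]: "Y i \<in> measurable M N" for i using Y by (auto simp: indep_vars_def)
  fix i show rv: "case_nat X Y i \<in> measurable M N" by (cases i) auto
next
  note X[measurable]
  have [measurable]: "Y i \<in> measurable M N" for i using Y by (auto simp: indep_vars_def)
  show "indep_sets (\<lambda>i. {case_nat X Y i -` A \<inter> space M |A. A \<in> sets N}) UNIV"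
  proof (rule indep_setsI)
    fix i show "{case_nat X Y i -` A \<inter> space M |A. A \<in> sets N} \<subseteq> events" by (cases i) auto
  next
    fix A and J :: "nat set" assume J: "J \<noteq> {}" "finite J"
      and A: "\<forall>j\<in>J. A j \<in> {case_nat X Y j -` A \<inter> space M |A. A \<in> sets N}"
    then obtain B where B: "\<And>j. j \<in> J \<Longrightarrow> A j = case_nat X Y j -` B j \<inter> space M" "\<And>j. j \<in> J \<Longrightarrow> B j \<in> sets N"
      by (simp add: image_iff) metis
    define K where "K = {j. Suc j \<in> J}"
    have K: "finite K" unfolding K_def using J finite_vimageI[of J Suc] by (auto simp: vimage_def)
    have JK: "J - {0} = Suc ` K" unfolding K_def by (auto simp: image_iff) (metis not0_implies_Suc)
    have Ysets: "A (Suc j) = Y j -` B (Suc j) \<inter> space M" "B (Suc j) \<in> sets N" if "j \<in> K" for j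
      using B[of "Suc j"] that by (auto simp: K_def)
    have Y': "prob (\<Inter>j\<in>K. A (Suc j)) = (\<Prod>j\<in>K. prob (A (Suc j)))" if "K \<noteq> {}"
    proof (rule indep_setsD[of "\<lambda>j. {Y j -` A \<inter> space M |A. A \<in> sets N}" UNIV])
      show "indep_sets (\<lambda>j. {Y j -` A \<inter> space M |A. A \<in> sets N}) UNIV"
        using Y by (simp add: indep_vars_def2)
    qed (use K that Ysets in auto)
    show "prob (\<Inter>j\<in>J. A j) = (\<Prod>j\<in>J. prob (A j))"
    proof (cases "0 \<in> J")
      case False
      then have "J = Suc ` K" using JK by auto
      then show ?thesis using Y' J by (auto simp: prod.reindex)
    next
      case True
      then have J': "J = insert 0 (Suc ` K)" using JK by auto
      have A0: "A 0 = X -` B 0 \<inter> space M" "B 0 \<in> sets N" using B[OF True] by auto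
      show ?thesis
      proof (cases "K = {}")
        case True then show ?thesis using J' by simp
      next
        case False
        define C where "C = {f \<in> space (PiM UNIV (\<lambda>_. N)). \<forall>j\<in>K. f j \<in> B (Suc j)}"
        have C: "C \<in> sets (PiM UNIV (\<lambda>_. N))"
          unfolding C_def using K Ysets by measurable
        have e: "(\<Inter>j\<in>K. A (Suc j)) = (\<lambda>x. \<lambda>i\<in>UNIV. Y i x) -` C \<inter> space M"
          using False Ysets by (auto simp: C_def space_PiM measurable_space[of "Y _" M N])
        have "prob ((X -` B 0 \<inter> space M) \<inter> (\<Inter>j\<in>K. A (Suc j))) = prob (X -` B 0 \<inter> space M) * prob (\<Inter>j\<in>K. A (Suc j))"
          by (rule indep_setD[OF XY]) (use A0 C e in auto)
        then show ?thesis using J' Y'[OF False] K A0 by (simp add: prod.reindex)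
      qed
    qed
  qed
qed

section \<open>Characteristic functions of centred normal laws\<close>

lemma char_distr: "f \<in> borel_measurable M \<Longrightarrow> char (distr M borel f) t = (\<integral>x. iexp (t * f x) \<partial>M)"
  unfolding char_def by (subst integral_distr) auto

lemma char_normal:
  assumes "0 < \<sigma>"
  shows "char (density lborel (normal_density 0 \<sigma>)) t = complex_of_real (exp (- (\<sigma>\<^sup>2 * t\<^sup>2) / 2))"
proof -
  interpret S: prob_space std_normal_distribution by (rule prob_space_normal_density) auto
  have "distributed std_normal_distribution lborel (\<lambda>x. x) std_normal_density"
    by (auto simp: distributed_def distr_id2)
  then have "distributed std_normal_distribution lborel (\<lambda>x. 0 + \<sigma> * x) (normal_density (0 + \<sigma> * 0) (\<bar>\<sigma>\<bar> * 1))"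
    by (rule S.normal_density_affine) (use assms in auto)
  then have d: "distr std_normal_distribution lborel (\<lambda>x. \<sigma> * x) = density lborel (normal_density 0 \<sigma>)"
    using assms by (auto simp: distributed_def)
  have "char (density lborel (normal_density 0 \<sigma>)) t = char std_normal_distribution (t * \<sigma>)"
    unfolding d[symmetric] char_def by (subst integral_distr) (auto simp: mult_ac)
  also have "\<dots> = exp (- (\<sigma>\<^sup>2 * t\<^sup>2) / 2)"
    by (simp add: char_std_normal_distribution power_mult_distrib mult_ac)
  finally show ?thesis .
qed

lemma real_distribution_normal: "0 < \<sigma> \<Longrightarrow> real_distribution (density lborel (normal_density \<mu> \<sigma>))"
  unfolding real_distribution_def real_distribution_axioms_def
  using prob_space_normal_density by auto

text \<open>Pathwise variation of constants, \<open>d(e^(a t) x) = b e^(a t) dw\<close>. The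
  integrated equation expresses each increment of \<open>w\<close> through \<open>x\<close>; the sum
  then differs from the telescoping sum of \<open>exp (a * u) * x (t0 + u)\<close> only by the
  second order Taylor term of the exponential and by the oscillation of \<open>x\<close> on a mesh
  of size \<open>1 / n\<close>.\<close>

lemma OU_pathwise_riemann:
  fixes x w :: "real \<Rightarrow> real"
  assumes a: "0 < a" and t0: "0 \<le> t0" and cont: "continuous_on {0..} x"
    and eq: "\<And>t. 0 \<le> t \<Longrightarrow> x t = x 0 - a * integral {0..t} x + b * w t"
  shows "(\<lambda>n. \<Sum>i<n. exp (a * (real i / real n)) * (b * (w (t0 + real (Suc i) / real n) - w (t0 + real i / real n))))
     \<longlonglongrightarrow> exp a * x (t0 + 1) - x t0"
proof -
  define T where "T n = (\<Sum>i<n. exp (a * (real i / real n)) * (b * (w (t0 + real (Suc i) / real n) - w (t0 + real i / real n))))" for n :: nat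
  have cont01: "continuous_on {t0..t0+1} x" by (rule continuous_on_subset[OF cont]) (use t0 in auto)
  obtain B where B: "\<And>t. t \<in> {t0..t0+1} \<Longrightarrow> \<bar>x t\<bar> \<le> B" "0 < B"
  proof -
    have "bounded (x ` {t0..t0+1})" by (intro compact_imp_bounded compact_continuous_image cont01) auto
    then show ?thesis using that unfolding bounded_pos by (metis atLeastAtMost_iff image_eqI real_norm_def)
  qed
  have incr: "b * (w t - w s) = x t - x s + a * integral {s..t} x" if "0 \<le> s" "s \<le> t" for s t
  proof -
    have "x integrable_on {0..t}" by (intro integrable_continuous_real continuous_on_subset[OF cont]) auto
    then have "integral {0..t} x = integral {0..s} x + integral {s..t} x"
      using that by (simp add: Henstock_Kurzweil_Integration.integral_combine)
    then show ?thesis using eq[of s] eq[of t] that by (simp add: algebra_simps)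
  qed
  \<comment> \<open>Summing \<open>n\<close> cells multiplies the Taylor remainder by
    \<open>n\<close>, and \<open>n * (exp (a / n) - 1 - a / n)\<close> still tends to 0;
    \<open>\<epsilon>\<close> is a modulus of continuity of \<open>x\<close> at scale
    \<open>1 / n\<close>.\<close>
  have bound: "\<bar>T n - (exp a * x (t0 + 1) - x t0)\<bar> \<le> exp a * (real n * (exp (a / n) - 1 - a / n) * B + a * \<epsilon>)"
    if n: "0 < n" and \<epsilon>: "\<And>s t. s \<in> {t0..t0+1} \<Longrightarrow> t \<in> {t0..t0+1} \<Longrightarrow> \<bar>s - t\<bar> \<le> 1 / n \<Longrightarrow> \<bar>x s - x t\<bar> \<le> \<epsilon>"
    for n :: nat and \<epsilon>
  proof -
    define s where "s i = t0 + real i / real n" for i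
    have s: "s i \<in> {t0..t0+1}" if "i \<le> n" for i using that n by (auto simp: s_def field_simps)
    have sd: "s (Suc i) = s i + 1 / n" for i by (simp add: s_def add_divide_distrib)
    define E where "E i = exp (a * (real i / real n))" for i
    have ES: "E (Suc i) = E i * exp (a / n)" for i
      unfolding E_def exp_add[symmetric] by (simp add: add_divide_distrib distrib_left)
    have "T n = (\<Sum>i<n. E i * (x (s (Suc i)) - x (s i) + a * integral {s i..s (Suc i)} x))"
      unfolding T_def s_def E_def
      by (intro sum.cong refl arg_cong2[where f="(*)"] incr) (use t0 n in \<open>auto simp: field_simps\<close>)
    moreover have "exp a * x (t0 + 1) - x t0 = (\<Sum>i<n. E (Suc i) * x (s (Suc i)) - E i * x (s i))"
      using n by (subst sum_lessThan_telescope) (simp add: E_def s_def)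
    ultimately have "\<bar>T n - (exp a * x (t0 + 1) - x t0)\<bar>
       = \<bar>\<Sum>i<n. E i * (x (s (Suc i)) - x (s i) + a * integral {s i..s (Suc i)} x) - (E (Suc i) * x (s (Suc i)) - E i * x (s i))\<bar>"
      by (simp add: sum_subtractf)
    also have "\<dots> \<le> (\<Sum>i<n. exp a * ((exp (a / n) - 1 - a / n) * B + a * \<epsilon> / n))"
    proof (rule order.trans[OF sum_abs sum_mono])
      fix i assume "i \<in> {..<n}"
      then have i: "i \<le> n" "Suc i \<le> n" by auto
      \<comment> \<open>The error of the right endpoint rule on one cell. With it and
        \<open>E (Suc i) = E i * exp (a / n)\<close>, the terms in \<open>x (s i)\<close>
        cancel.\<close>
      define R where "R = integral {s i..s (Suc i)} x - x (s (Suc i)) / n"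
      have xi: "x integrable_on {s i..s (Suc i)}"
        by (intro integrable_continuous_real continuous_on_subset[OF cont]) (use s[OF i(1)] t0 in auto)
      have "norm (integral (cbox (s i) (s (Suc i))) (\<lambda>u. x u - x (s (Suc i)))) \<le> \<epsilon> * measure lborel (cbox (s i) (s (Suc i)))"
      proof (rule has_integral_bound[OF _ integrable_integral])
        show "0 \<le> \<epsilon>" using \<epsilon>[of t0 t0] n by auto
        show "(\<lambda>u. x u - x (s (Suc i))) integrable_on cbox (s i) (s (Suc i))"
          using xi by (auto intro!: integrable_diff)
        fix u assume "u \<in> cbox (s i) (s (Suc i))"
        then show "norm (x u - x (s (Suc i))) \<le> \<epsilon>"
          using s[OF i(1)] s[OF i(2)] unfolding real_norm_def
          by (intro \<epsilon>) (auto simp: sd)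
      qed
      moreover have "integral (cbox (s i) (s (Suc i))) (\<lambda>u. x u - x (s (Suc i))) = R"
        unfolding R_def using xi
        by (subst Henstock_Kurzweil_Integration.integral_diff) (auto simp: sd intro: integrable_const_ivl)
      ultimately have R: "\<bar>R\<bar> \<le> \<epsilon> / n" by (simp add: sd field_simps)
      have "E i * (x (s (Suc i)) - x (s i) + a * integral {s i..s (Suc i)} x) - (E (Suc i) * x (s (Suc i)) - E i * x (s i))
        = E i * (a * R - (exp (a / n) - 1 - a / n) * x (s (Suc i)))"
        by (simp add: ES R_def algebra_simps)
      then have "\<bar>E i * (x (s (Suc i)) - x (s i) + a * integral {s i..s (Suc i)} x) - (E (Suc i) * x (s (Suc i)) - E i * x (s i))\<bar>
        = E i * \<bar>a * R - (exp (a / n) - 1 - a / n) * x (s (Suc i))\<bar>"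
        by (simp add: abs_mult E_def)
      also have "\<dots> \<le> exp a * (a * \<epsilon> / n + (exp (a / n) - 1 - a / n) * B)"
      proof (rule mult_mono)
        show "E i \<le> exp a" using i n a by (auto simp: E_def field_simps)
        have e: "0 \<le> exp (a / n) - 1 - a / n" using exp_ge_add_one_self[of "a / n"] by linarith
        have "\<bar>a * R - (exp (a / n) - 1 - a / n) * x (s (Suc i))\<bar> \<le> \<bar>a * R\<bar> + \<bar>(exp (a / n) - 1 - a / n) * x (s (Suc i))\<bar>"
          by linarith
        also have "\<dots> = a * \<bar>R\<bar> + (exp (a / n) - 1 - a / n) * \<bar>x (s (Suc i))\<bar>"
          using a e by (simp add: abs_mult)
        also have "\<dots> \<le> a * (\<epsilon> / n) + (exp (a / n) - 1 - a / n) * B"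
          using a e R B(1)[OF s[OF i(2)]] by (intro add_mono mult_left_mono) auto
        finally show "\<bar>a * R - (exp (a / n) - 1 - a / n) * x (s (Suc i))\<bar> \<le> a * \<epsilon> / n + (exp (a / n) - 1 - a / n) * B" by simp
      qed auto
      finally show "\<bar>E i * (x (s (Suc i)) - x (s i) + a * integral {s i..s (Suc i)} x) - (E (Suc i) * x (s (Suc i)) - E i * x (s i))\<bar>
        \<le> exp a * ((exp (a / n) - 1 - a / n) * B + a * \<epsilon> / n)" by (simp add: algebra_simps)
    qed
    also have "\<dots> = exp a * (real n * (exp (a / n) - 1 - a / n) * B + a * \<epsilon>)"
      using n by (simp add: field_simps)
    finally show ?thesis .
  qed
  have "T \<longlonglongrightarrow> exp a * x (t0 + 1) - x t0"
  proof (rule LIMSEQ_I)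
    fix e :: real assume e: "0 < e"
    define \<epsilon> where "\<epsilon> = e / (2 * exp a * a)"
    have \<epsilon>: "0 < \<epsilon>" using e a by (simp add: \<epsilon>_def)
    have "uniformly_continuous_on {t0..t0+1} x"
      by (intro compact_uniformly_continuous cont01) auto
    then obtain d where d: "0 < d" "\<And>s t. s \<in> {t0..t0+1} \<Longrightarrow> t \<in> {t0..t0+1} \<Longrightarrow> \<bar>s - t\<bar> < d \<Longrightarrow> \<bar>x s - x t\<bar> < \<epsilon>"
      using \<epsilon> unfolding uniformly_continuous_on_def dist_real_def by (metis abs_minus_commute)
    have "((\<lambda>n::nat. exp a * (real n * (exp (a / n) - 1 - a / n) * B)) \<longlongrightarrow> 0) sequentially"
      using a by real_asymp
    then have "eventually (\<lambda>n::nat. exp a * (real n * (exp (a / n) - 1 - a / n) * B) < e / 2) sequentially"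
      by (rule order_tendstoD) (use e in auto)
    moreover have "eventually (\<lambda>n::nat. 1 / real n < d) sequentially" using d(1) by real_asymp
    moreover have "eventually (\<lambda>n::nat. 0 < n) sequentially" by (rule eventually_gt_at_top)
    ultimately have "eventually (\<lambda>n. norm (T n - (exp a * x (t0 + 1) - x t0)) < e) sequentially"
    proof eventually_elim
      case (elim n)
      have "\<bar>T n - (exp a * x (t0 + 1) - x t0)\<bar> \<le> exp a * (real n * (exp (a / n) - 1 - a / n) * B + a * \<epsilon>)"
        using elim d(2) by (intro bound) (auto intro!: less_imp_le)
      also have "\<dots> = exp a * (real n * (exp (a / n) - 1 - a / n) * B) + e / 2"
        using a by (simp add: \<epsilon>_def field_simps)
      finally show ?case using elim(1) unfolding real_norm_def by linarith
    qed
    then show "\<exists>no. \<forall>n\<ge>no. norm (T n - (exp a * x (t0 + 1) - x t0)) < e"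
      unfolding eventually_sequentially .
  qed
  then show ?thesis unfolding T_def .
qed

section \<open>The Ornstein-Uhlenbeck process at integer times\<close>

lemma (in prob_space) stationary_process_distr:
  assumes X: "stationary_process M X" and J: "finite J" "J \<subseteq> {0..}" "0 \<le> h"
    and f[measurable]: "f \<in> measurable (PiM J (\<lambda>_. borel)) N"
  shows "distr M N (\<lambda>x. f (\<lambda>t\<in>J. X (t + h) x)) = distr M N (\<lambda>x. f (\<lambda>t\<in>J. X t x))"
proof -
  have [measurable]: "X t \<in> borel_measurable M" if "0 \<le> t" for t
    using X that by (auto simp: stationary_process_def)
  have [measurable]: "(\<lambda>x. \<lambda>t\<in>J. X (t + h) x) \<in> measurable M (PiM J (\<lambda>_. borel))"
    "(\<lambda>x. \<lambda>t\<in>J. X t x) \<in> measurable M (PiM J (\<lambda>_. borel))"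
    using J by (auto intro!: measurable_restrict)
  have "distr M (PiM J (\<lambda>_. borel)) (\<lambda>x. \<lambda>t\<in>J. X (t + h) x) = distr M (PiM J (\<lambda>_. borel)) (\<lambda>x. \<lambda>t\<in>J. X t x)"
    using X J by (auto simp: stationary_process_def)
  then have "distr (distr M (PiM J (\<lambda>_. borel)) (\<lambda>x. \<lambda>t\<in>J. X (t + h) x)) N f
    = distr (distr M (PiM J (\<lambda>_. borel)) (\<lambda>x. \<lambda>t\<in>J. X t x)) N f" by simp
  then show ?thesis by (simp add: distr_distr comp_def)
qed

lemma OU_AR1:
  fixes M :: "'a measure" and X :: "real \<Rightarrow> 'a \<Rightarrow> real"
  assumes a: "0 < a" and b: "0 < b" and OU: "stationary_OU M a b X"
  defines "\<zeta> \<equiv> case_nat (X 0) (\<lambda>i u. X (real i + 1) u - exp (- a) * X (real i) u)"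
  shows "prob_space.indep_vars M (\<lambda>_. borel) \<zeta> UNIV"
    and "\<And>j::nat. distr M borel (X (real j)) = density lborel (normal_density 0 (b / sqrt (2 * a)))"
proof -
  interpret prob_space M using OU by (simp add: stationary_OU_def)
  let ?N = "\<lambda>n. real (Suc n)"
  obtain W where stat: "stationary_process M X" and W: "standard_Wiener M W" and sol: "OU_solution M a b W X"
    using OU by (auto simp: stationary_OU_def)
  have X[measurable]: "X t \<in> borel_measurable M" if "0 \<le> t" for t
    using stat that by (auto simp: stationary_process_def)
  have Wm[measurable]: "W t \<in> borel_measurable M" if "0 \<le> t" for t
    using W that by (auto simp: standard_Wiener_def)
  define inc where "inc n i u = W (real (Suc i) / ?N n) u - W (real i / ?N n) u" for n i u
  \<comment> \<open>The factor \<open>exp (- a)\<close> turns the limit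
    \<open>exp a * X (j + 1) - X j\<close> of \<open>OU_pathwise_riemann\<close> into the innovation
    \<open>\<xi> j\<close>.\<close>
  define c where "c n i = exp (- a) * exp (a * (real i / ?N n)) * b" for n i
  define \<xi> where "\<xi> i u = X (real i + 1) u - exp (- a) * X (real i) u" for i :: nat and u
  \<comment> \<open>One grid of mesh \<open>1 / (n + 1)\<close> serves all unit intervals:
    \<open>K n j\<close> indexes the cells inside \<open>[j, j + 1]\<close>. These blocks are
    disjoint, so the sums \<open>\<eta> n j\<close> are exactly independent and normal before any
    limit is taken.\<close>
  define K where "K n j = {0 + j * Suc n ..< Suc n + j * Suc n}" for n j
  define \<eta> where "\<eta> n j u = (\<Sum>i\<in>K n j. c n (i - j * Suc n) * inc n i u)" for n j u
  have \<eta>_eq: "\<eta> n j u = (\<Sum>i<Suc n. c n i * inc n (i + j * Suc n) u)" for n j u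
    unfolding \<eta>_def K_def by (subst sum.shift_bounds_nat_ivl) (simp add: atLeast0LessThan)
  have inc_indep: "indep_vars (\<lambda>_. borel) (inc n) UNIV" for n
  proof -
    have "mono (\<lambda>i. real i / ?N n)" by (intro monoI divide_right_mono) auto
    then show ?thesis
      using W unfolding standard_Wiener_def inc_def by (elim conjE allE[of _ "\<lambda>i. real i / ?N n"]) auto
  qed
  have inc_normal: "distributed M lborel (inc n i) (normal_density 0 (sqrt (1 / ?N n)))" for n i
  proof -
    have "distributed M lborel (\<lambda>u. W (real (Suc i) / ?N n) u - W (real i / ?N n) u)
      (normal_density 0 (sqrt (real (Suc i) / ?N n - real i / ?N n)))"
      using W unfolding standard_Wiener_def by (auto simp: divide_strict_right_mono)
    also have "real (Suc i) / ?N n - real i / ?N n = 1 / ?N n"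
      by (simp add: diff_divide_distrib[symmetric])
    finally show ?thesis unfolding inc_def .
  qed
  have [measurable]: "inc n i \<in> borel_measurable M" for n i unfolding inc_def by simp
  have [measurable]: "\<eta> n j \<in> borel_measurable M" for n j unfolding \<eta>_def by simp
  have [measurable]: "\<xi> j \<in> borel_measurable M" for j unfolding \<xi>_def by simp
  have \<eta>_indep: "indep_vars (\<lambda>_. borel) (\<eta> n) UNIV" for n
  proof -
    have "disjoint_family_on (K n) UNIV"
    proof (unfold disjoint_family_on_def, safe)
      fix i j x assume "i \<noteq> j" "x \<in> K n i" "x \<in> K n j"
      then have "x div Suc n = i" "x div Suc n = j"
        unfolding K_def by (auto intro!: div_nat_eqI simp: mult.commute)
      then show "x \<in> {}" using \<open>i \<noteq> j\<close> by auto
    qed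
    then have "indep_vars (\<lambda>j. PiM (K n j) (\<lambda>_. borel)) (\<lambda>j u. restrict (\<lambda>i. inc n i u) (K n j)) UNIV"
      by (intro indep_vars_restrict[OF inc_indep]) auto
    then have "indep_vars (\<lambda>_. borel) (\<lambda>j u. (\<lambda>g. \<Sum>i\<in>K n j. c n (i - j * Suc n) * g i) (restrict (\<lambda>i. inc n i u) (K n j))) UNIV"
      by (rule indep_vars_compose2) auto
    then show ?thesis unfolding \<eta>_def by (simp cong: sum.cong)
  qed
  have \<zeta>_indep_n: "indep_vars (\<lambda>_. borel) (case_nat (X 0) (\<eta> n)) UNIV" for n
  proof (rule indep_vars_case_nat[OF \<eta>_indep X])
    \<comment> \<open>\<open>OU_solution\<close> makes \<open>X 0\<close> independent of the
      sigma-algebra \<open>?V\<close> of the whole Wiener path, and every \<open>\<eta> n j\<close>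
      is measurable with respect to it.\<close>
    let ?V = "vimage_algebra (space M) (\<lambda>u. \<lambda>t\<in>{0..}. W t u) (PiM {0..} (\<lambda>_. borel))"
    have Wv[measurable]: "W t \<in> borel_measurable ?V" if "0 \<le> t" for t
    proof -
      have "(\<lambda>u. (\<lambda>t\<in>{0..}. W t u) t) \<in> borel_measurable ?V"
        by (rule measurable_compose[OF measurable_vimage_algebra1 measurable_component_singleton])
           (use that in \<open>auto simp: space_PiM split: if_splits\<close>)
      then show ?thesis using that by simp
    qed
    have "(\<lambda>u. \<lambda>i\<in>UNIV. \<eta> n i u) \<in> measurable ?V (PiM UNIV (\<lambda>_. borel))"
      unfolding \<eta>_def inc_def by (intro measurable_restrict) simp
    from measurable_sets[OF this]
    have "{(\<lambda>u. \<lambda>i\<in>UNIV. \<eta> n i u) -` A \<inter> space M |A. A \<in> sets (PiM UNIV (\<lambda>_. borel))} \<subseteq> sets ?V"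
      by auto
    moreover have "indep_set (sets (vimage_algebra (space M) (X 0) borel)) (sets ?V)"
      using sol by (simp add: OU_solution_def)
    ultimately show "indep_set {X 0 -` A \<inter> space M |A. A \<in> sets borel}
      {(\<lambda>u. \<lambda>i\<in>UNIV. \<eta> n i u) -` A \<inter> space M |A. A \<in> sets (PiM UNIV (\<lambda>_. borel))}"
      unfolding indep_sets2_eq by (simp add: sets_vimage_algebra2) blast
  qed simp
  have lim: "AE u in M. \<forall>j. (\<lambda>n. \<eta> n j u) \<longlonglongrightarrow> \<xi> j u"
  proof -
    have "AE u in M. continuous_on {0..} (\<lambda>t. X t u)"
      "AE u in M. \<forall>t\<ge>0. X t u = X 0 u - a * integral {0..t} (\<lambda>s. X s u) + b * W t u"
      using sol by (auto simp: OU_solution_def)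
    then show ?thesis
    proof eventually_elim
      case (elim u)
      show ?case
      proof
        fix j
        let ?R = "\<lambda>n. \<Sum>i<n. exp (a * (real i / real n)) * (b * (W (real j + real (Suc i) / real n) u - W (real j + real i / real n) u))"
        let ?l = "exp a * X (real j + 1) u - X (real j) u"
        have "?R \<longlonglongrightarrow> ?l"
          by (rule OU_pathwise_riemann[where x="\<lambda>t. X t u" and w="\<lambda>t. W t u" and ?t0.0="real j" and b=b, OF a])
             (simp, rule elim(1), use elim(2) in blast)
        then have "(\<lambda>n. exp (- a) * ?R (Suc n))
          \<longlonglongrightarrow> exp (- a) * ?l"
          by (intro tendsto_mult_left) (rule LIMSEQ_Suc)
        moreover have "exp (- a) * ?l = \<xi> j u"
          by (simp add: \<xi>_def right_diff_distrib mult.assoc[symmetric] exp_add[symmetric])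
        moreover have "exp (- a) * ?R (Suc n) = \<eta> n j u" for n
        proof -
          have "real j + real (Suc i) / ?N n = real (Suc (i + j * Suc n)) / ?N n"
            "real j + real i / ?N n = real (i + j * Suc n) / ?N n" for i
            by (simp_all add: divide_simps del: of_nat_Suc) (simp_all add: algebra_simps)
          then show ?thesis
            unfolding \<eta>_eq c_def inc_def sum_distrib_left by (intro sum.cong refl) (simp only: mult.assoc)
        qed
        ultimately show "(\<lambda>n. \<eta> n j u) \<longlonglongrightarrow> \<xi> j u" by (simp only:)
      qed
    qed
  qed
  have \<zeta>_eq: "\<zeta> = case_nat (X 0) \<xi>" unfolding \<zeta>_def \<xi>_def by simp
  show indep: "indep_vars (\<lambda>_. borel) \<zeta> UNIV"
  proof (rule indep_vars_limit[OF \<zeta>_indep_n])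
    fix i :: nat
    show "\<zeta> i \<in> borel_measurable M" unfolding \<zeta>_eq by (cases i) auto
    show "AE u in M. (\<lambda>n. case_nat (X 0) (\<eta> n) i u) \<longlonglongrightarrow> \<zeta> i u"
      unfolding \<zeta>_eq using lim by eventually_elim (cases i, auto)
  qed
  \<comment> \<open>\<open>q\<^sup>2\<close> is the integral of
    \<open>b\<^sup>2 * exp (- 2 * a * (1 - u))\<close> over \<open>u\<close> in [0, 1], the variance
    of the stochastic integral that the weighted sums approximate.\<close>
  define q where "q = b * sqrt ((1 - exp (- 2 * a)) / (2 * a))"
  have "0 < 1 - exp (- 2 * a)" using a by simp
  then have q: "0 < q" using a b by (simp add: q_def)
  have char_\<xi>: "char (distr M borel (\<xi> j)) t = exp (- (q\<^sup>2 * t\<^sup>2) / 2)" for j t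
  proof (rule LIMSEQ_unique)
    define s where "s n = (\<Sum>i<Suc n. (c n i)\<^sup>2 / ?N n)" for n
    have s_pos: "0 < s n" for n
      unfolding s_def c_def using b by (intro sum_pos) auto
    have "char (distr M borel (\<eta> n j)) t = exp (- (s n * t\<^sup>2) / 2)" for n
    proof -
      have "distributed M lborel (\<lambda>u. \<Sum>i\<in>K n j. c n (i - j * Suc n) * inc n i u)
        (normal_density (\<Sum>i\<in>K n j. 0) (sqrt (\<Sum>i\<in>K n j. (c n (i - j * Suc n) * sqrt (1 / ?N n))\<^sup>2)))"
      proof (rule sum_indep_normal)
        show "indep_vars (\<lambda>i. borel) (\<lambda>i x. c n (i - j * Suc n) * inc n i x) (K n j)"
          by (rule indep_vars_compose2[OF indep_vars_subset[OF inc_indep]]) auto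
        fix i assume "i \<in> K n j"
        have c: "0 < c n (i - j * Suc n)" using b by (simp add: c_def)
        then show "0 < c n (i - j * Suc n) * sqrt (1 / ?N n)" by simp
        show "distributed M lborel (\<lambda>x. c n (i - j * Suc n) * inc n i x)
           (normal_density 0 (c n (i - j * Suc n) * sqrt (1 / ?N n)))"
          using normal_density_affine[OF inc_normal[of n i], of "c n (i - j * Suc n)" 0] c by simp
      qed (auto simp: K_def)
      also have "(\<Sum>i\<in>K n j. (c n (i - j * Suc n) * sqrt (1 / ?N n))\<^sup>2) = s n"
        unfolding K_def s_def
        by (subst sum.shift_bounds_nat_ivl) (simp add: atLeast0LessThan power_mult_distrib)
      also have "(\<lambda>u. \<Sum>i\<in>K n j. c n (i - j * Suc n) * inc n i u) = \<eta> n j"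
        by (rule ext) (rule \<eta>_def[symmetric])
      finally have "distr M lborel (\<eta> n j) = density lborel (normal_density 0 (sqrt (s n)))"
        by (simp add: distributed_def)
      moreover have "distr M borel (\<eta> n j) = distr M lborel (\<eta> n j)" by (rule distr_cong) auto
      ultimately have "distr M borel (\<eta> n j) = density lborel (normal_density 0 (sqrt (s n)))" by simp
      then show ?thesis using char_normal[of "sqrt (s n)" t] s_pos[of n] by simp
    qed
    moreover have "s \<longlonglongrightarrow> q\<^sup>2"
    proof -
      \<comment> \<open>The variances of the weighted sums are geometric sums with ratio
        \<open>exp (2 * a / (n + 1))\<close>, hence explicit.\<close>
      have s_form: "s n = b\<^sup>2 * exp (- 2 * a) * (exp (2 * a) - 1) / (?N n * (exp (2 * a / ?N n) - 1))" for n
      proof -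
        have "s n = b\<^sup>2 * exp (- 2 * a) / ?N n * (\<Sum>i<Suc n. exp (2 * a / ?N n) ^ i)"
          unfolding s_def c_def sum_distrib_left
        proof (intro sum.cong refl)
          fix i
          have "(exp (a * (real i / ?N n)))\<^sup>2 = exp (2 * a / ?N n) ^ i"
            unfolding power2_eq_square exp_add[symmetric] exp_of_nat_mult[symmetric]
            by (rule arg_cong[where f=exp]) (simp add: divide_simps del: of_nat_Suc)
          moreover have "(exp (- a))\<^sup>2 = exp (- 2 * a)" by (simp add: power2_eq_square exp_add[symmetric])
          ultimately show "(exp (- a) * exp (a * (real i / ?N n)) * b)\<^sup>2 / ?N n
            = b\<^sup>2 * exp (- 2 * a) / ?N n * exp (2 * a / ?N n) ^ i"
            by (simp only: power_mult_distrib) simp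
        qed
        also have "(\<Sum>i<Suc n. exp (2 * a / ?N n) ^ i) = (exp (2 * a / ?N n) ^ Suc n - 1) / (exp (2 * a / ?N n) - 1)"
          by (rule geometric_sum) (use a in auto)
        also have "exp (2 * a / ?N n) ^ Suc n = exp (2 * a)"
          unfolding exp_of_nat_mult[symmetric] by simp
        finally show ?thesis by (simp add: field_simps)
      qed
      have s_lim: "(\<lambda>n. b\<^sup>2 * exp (- 2 * a) * (exp (2 * a) - 1) / (?N n * (exp (2 * a / ?N n) - 1)))
        \<longlonglongrightarrow> b\<^sup>2 * exp (- 2 * a) * (exp (2 * a) - 1) / (2 * a)"
      proof (intro tendsto_divide tendsto_const)
        have "((\<lambda>n. real n * (exp (2 * a / real n) - 1)) \<longlongrightarrow> 2 * a) sequentially"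
          using a by real_asymp
        then show "(\<lambda>n. ?N n * (exp (2 * a / ?N n) - 1)) \<longlonglongrightarrow> 2 * a" by (rule LIMSEQ_Suc)
      qed (use a in auto)
      have s_val: "b\<^sup>2 * exp (- 2 * a) * (exp (2 * a) - 1) / (2 * a) = q\<^sup>2"
        unfolding q_def power_mult_distrib using a \<open>0 < 1 - exp (- 2 * a)\<close>
        by (simp add: right_diff_distrib exp_add[symmetric] mult.assoc)
      show ?thesis using s_lim unfolding s_val s_form[symmetric] .
    qed
    then have "(\<lambda>n. complex_of_real (exp (- (s n * t\<^sup>2) / 2))) \<longlonglongrightarrow> complex_of_real (exp (- (q\<^sup>2 * t\<^sup>2) / 2))"
      by (intro tendsto_intros) auto
    ultimately show "(\<lambda>n. char (distr M borel (\<eta> n j)) t) \<longlonglongrightarrow> complex_of_real (exp (- (q\<^sup>2 * t\<^sup>2) / 2))"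
      by simp
    show "(\<lambda>n. char (distr M borel (\<eta> n j)) t) \<longlonglongrightarrow> char (distr M borel (\<xi> j)) t"
    proof -
      have char_eq: "char (distr M borel f) t = (\<integral>x. iexp (t * f x) \<partial>M)" if [measurable]: "f \<in> borel_measurable M" for f
        unfolding char_def by (subst integral_distr) auto
      have "(\<lambda>n. \<integral>x. iexp (t * \<eta> n j x) \<partial>M) \<longlonglongrightarrow> (\<integral>x. iexp (t * \<xi> j x) \<partial>M)"
      proof (rule integral_dominated_convergence[where w="\<lambda>_. 1"])
        show "AE x in M. (\<lambda>n. iexp (t * \<eta> n j x)) \<longlonglongrightarrow> iexp (t * \<xi> j x)"
          using lim by eventually_elim (intro tendsto_intros, auto)
      qed auto
      then show ?thesis by (simp add: char_eq)
    qed
  qed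
  define \<phi> where "\<phi> = char (distr M borel (X 0))"
  have distr_X: "distr M borel (X (real j)) = distr M borel (X 0)" for j
    using stationary_process_distr[OF stat, of "{0}" "real j" "\<lambda>g. g 0" borel] by simp
  \<comment> \<open>\<open>X 1 = exp (- a) * X 0 + \<xi> 0\<close> with independent summands, and
    \<open>X 1\<close> has the law of \<open>X 0\<close>: a functional equation for
    \<open>\<phi>\<close>.\<close>
  have \<phi>_rec: "\<phi> t = \<phi> (exp (- a) * t) * exp (- (q\<^sup>2 * t\<^sup>2) / 2)" for t
  proof -
    have "indep_var borel ((\<lambda>g. exp (- a) * g 0) \<circ> (\<lambda>u. restrict (\<lambda>i. \<zeta> i u) {0})) borel ((\<lambda>g. g 1) \<circ> (\<lambda>u. restrict (\<lambda>i. \<zeta> i u) {1}))"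
      by (rule indep_var_compose[OF indep_var_restrict[OF indep, of "{0}" "{1}"]]) auto
    then have "indep_var borel (\<lambda>u. exp (- a) * X 0 u) borel (\<xi> 0)"
      by (simp add: comp_def \<zeta>_eq)
    moreover have "(\<lambda>u. exp (- a) * X 0 u + \<xi> 0 u) = X (real 1)" by (simp add: \<xi>_def)
    ultimately
    have "char (distr M borel (X (real 1))) t = char (distr M borel (\<lambda>u. exp (- a) * X 0 u)) t * exp (- (q\<^sup>2 * t\<^sup>2) / 2)"
      using char_distr_add[of "\<lambda>u. exp (- a) * X 0 u" "\<xi> 0" t] by (simp only: char_\<xi>)
    moreover have "char (distr M borel (\<lambda>u. exp (- a) * X 0 u)) t = \<phi> (exp (- a) * t)"
      unfolding \<phi>_def char_def by (simp add: integral_distr mult_ac)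
    ultimately show ?thesis unfolding distr_X \<phi>_def by simp
  qed
  define \<sigma> where "\<sigma> = b / sqrt (2 * a)"
  have \<sigma>: "0 < \<sigma>" using a b by (simp add: \<sigma>_def)
  have q\<sigma>: "q\<^sup>2 = \<sigma>\<^sup>2 * (1 - exp (- a) ^ 2)"
    unfolding q_def \<sigma>_def power_mult_distrib power_divide using a \<open>0 < 1 - exp (- 2 * a)\<close>
    by (simp add: exp_double[symmetric])
  \<comment> \<open>Iterating pushes the argument of \<open>\<phi>\<close> to 0, where
    \<open>\<phi>\<close> is continuous with value 1, while the accumulated Gaussian factors
    converge. So the functional equation determines \<open>\<phi>\<close>.\<close>
  have \<phi>_n: "\<phi> t = \<phi> (exp (- a) ^ n * t) * exp (- (\<sigma>\<^sup>2 * (1 - (exp (- a) ^ n)\<^sup>2) * t\<^sup>2) / 2)" for n t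
  proof (induction n)
    case (Suc n)
    define r where "r = exp (- a)"
    have "\<phi> t = \<phi> (r * (r ^ n * t)) * (exp (- (q\<^sup>2 * (r ^ n * t)\<^sup>2) / 2) * exp (- (\<sigma>\<^sup>2 * (1 - (r ^ n)\<^sup>2) * t\<^sup>2) / 2))"
      using Suc \<phi>_rec[of "r ^ n * t"] by (simp add: r_def mult_ac)
    also have "exp (- (q\<^sup>2 * (r ^ n * t)\<^sup>2) / 2) * exp (- (\<sigma>\<^sup>2 * (1 - (r ^ n)\<^sup>2) * t\<^sup>2) / 2) = exp (- (\<sigma>\<^sup>2 * (1 - (r ^ Suc n)\<^sup>2) * t\<^sup>2) / 2)"
      unfolding exp_add[symmetric] q\<sigma> r_def[symmetric] by (simp add: field_simps power_mult_distrib)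
    finally show ?case by (simp add: r_def mult_ac)
  qed simp
  interpret X0: real_distribution "distr M borel (X 0)" by simp
  have "\<phi> t = exp (- (\<sigma>\<^sup>2 * t\<^sup>2) / 2)" for t
  proof (rule LIMSEQ_unique)
    show "(\<lambda>n. \<phi> t) \<longlonglongrightarrow> \<phi> t" by simp
    have r: "(\<lambda>n. exp (- a) ^ n) \<longlonglongrightarrow> 0" by (rule LIMSEQ_realpow_zero) (use a in auto)
    have "(\<lambda>n. exp (- a) ^ n * t) \<longlonglongrightarrow> 0 * t" using r by (rule tendsto_mult_right)
    then have "(\<lambda>n. \<phi> (exp (- a) ^ n * t)) \<longlonglongrightarrow> \<phi> 0"
      unfolding \<phi>_def using isCont_tendsto_compose[OF X0.isCont_char] by fastforce
    moreover have "(\<lambda>n. exp (- (\<sigma>\<^sup>2 * (1 - (exp (- a) ^ n)\<^sup>2) * t\<^sup>2) / 2)) \<longlonglongrightarrow> exp (- (\<sigma>\<^sup>2 * (1 - 0\<^sup>2) * t\<^sup>2) / 2)"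
      by (intro tendsto_intros r) auto
    ultimately have "(\<lambda>n. \<phi> (exp (- a) ^ n * t) * exp (- (\<sigma>\<^sup>2 * (1 - (exp (- a) ^ n)\<^sup>2) * t\<^sup>2) / 2)) \<longlonglongrightarrow> \<phi> 0 * exp (- (\<sigma>\<^sup>2 * (1 - 0\<^sup>2) * t\<^sup>2) / 2)"
      by (intro tendsto_mult tendsto_of_real)
    then show "(\<lambda>n. \<phi> t) \<longlonglongrightarrow> exp (- (\<sigma>\<^sup>2 * t\<^sup>2) / 2)"
      using \<phi>_n[of t] X0.char_zero by (simp add: \<phi>_def)
  qed
  then have "distr M borel (X 0) = density lborel (normal_density 0 \<sigma>)"
    by (intro Levy_uniqueness real_distribution_normal \<sigma>)
       (auto simp: \<phi>_def fun_eq_iff char_normal[OF \<sigma>] X0.real_distribution_axioms)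
  then show "distr M borel (X (real j)) = density lborel (normal_density 0 (b / sqrt (2 * a)))" for j
    unfolding distr_X \<sigma>_def .
qed

section \<open>Limit theorems for weakly dependent sequences\<close>

lemma norm_integral_le_integral:
  fixes f :: "'a \<Rightarrow> 'b :: {banach, second_countable_topology}"
  assumes "integrable M f" "integrable M g" "\<And>x. norm (f x) \<le> g x"
  shows "norm (\<integral>x. f x \<partial>M) \<le> (\<integral>x. g x \<partial>M)"
  using assms by (intro order.trans[OF integral_norm_bound integral_mono]) auto

lemma abs_cube_diff_le: "\<bar>x ^ 3 - y ^ 3\<bar> \<le> \<bar>x - y\<bar> * (3 / 2 * (x\<^sup>2 + y\<^sup>2))" for x y :: real
proof -
  have "x ^ 3 - y ^ 3 = (x - y) * (x\<^sup>2 + x * y + y\<^sup>2)"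
    by (simp add: power2_eq_square power3_eq_cube algebra_simps)
  moreover have "\<bar>x\<^sup>2 + x * y + y\<^sup>2\<bar> \<le> 3 / 2 * (x\<^sup>2 + y\<^sup>2)"
  proof -
    define P A B where "P = x * y" and "A = x\<^sup>2" and "B = y\<^sup>2"
    have "2 * P \<le> A + B" "- (2 * P) \<le> A + B" "0 \<le> A" "0 \<le> B"
      using sum_squares_bound[of x y] sum_squares_bound[of "- x" y] by (simp_all add: P_def A_def B_def)
    then show ?thesis
      unfolding P_def[symmetric] A_def[symmetric] B_def[symmetric] abs_le_iff by (auto simp: field_simps)
  qed
  ultimately show ?thesis by (simp only: abs_mult) (intro mult_left_mono, auto)
qed

lemma norm_triangle7:
  "norm (a + b - c - d - e - f - g) \<le> norm a + norm b + norm c + norm d + norm e + norm f + norm (g :: 'a :: real_normed_vector)"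
  by (rule order.trans[OF norm_triangle_ineq4 add_right_mono])+ (rule norm_triangle_ineq)

lemma iexp_lipschitz: "cmod (iexp x - iexp y) \<le> \<bar>x - y\<bar>"
proof -
  have "cmod (iexp x - iexp y) = cmod (iexp y) * cmod (iexp (x - y) - 1)"
    unfolding norm_mult[symmetric] by (simp add: algebra_simps exp_diff)
  also have "\<dots> \<le> \<bar>x - y\<bar>" using iexp_approx1[of "x - y" 0] by simp
  finally show ?thesis .
qed

lemma (in prob_space) cmod_integral_iexp_diff_le:
  assumes [measurable]: "f \<in> borel_measurable M" "g \<in> borel_measurable M"
    and "integrable M b" "\<And>x. \<bar>f x - g x\<bar> \<le> b x"
  shows "cmod ((\<integral>x. iexp (f x) \<partial>M) - (\<integral>x. iexp (g x) \<partial>M)) \<le> (\<integral>x. b x \<partial>M)"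
proof -
  have ie: "integrable M (\<lambda>x. iexp (f x))" if [measurable]: "f \<in> borel_measurable M" for f
    by (rule integrable_const_bound[where B=1]) auto
  have "cmod (\<integral>x. iexp (f x) - iexp (g x) \<partial>M) \<le> (\<integral>x. b x \<partial>M)"
    by (intro norm_integral_le_integral Bochner_Integration.integrable_diff ie assms
        order.trans[OF iexp_lipschitz assms(4)])
  then show ?thesis
    by (subst Bochner_Integration.integral_diff[symmetric]) (auto intro: ie)
qed

text \<open>\<open>A i\<close> is the information available at index \<open>i\<close>. The test
  functions \<open>F\<close> are complex because the past enters as \<open>iexp (s * S i)\<close>. A
  pair \<open>Z j\<close>, \<open>Z (j + l)\<close> counts as one observable with mean
  \<open>c l\<close>, decoupled at a rate given by the gap before its earlier member;
  \<open>cov\<close> is the form in which stationarity enters.\<close>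

locale weakly_dependent = prob_space +
  fixes A :: "nat \<Rightarrow> 'a measure" and Z :: "nat \<Rightarrow> 'a \<Rightarrow> real" and K r :: real and c :: "nat \<Rightarrow> real"
  assumes subalg_M: "subalgebra M (A i)"
    and subalg_mono: "i \<le> j \<Longrightarrow> subalgebra (A j) (A i)"
    and Z_adapted: "Z j \<in> borel_measurable (A j)"
    and Z_le: "\<bar>Z j x\<bar> \<le> 1"
    and r: "0 < r" "r < 1" and K: "0 \<le> K"
    and decouple1: "i \<le> j \<Longrightarrow> F \<in> borel_measurable (A i) \<Longrightarrow> (\<And>x. cmod (F x) \<le> 1) \<Longrightarrow>
      cmod (\<integral>x. F x * of_real (Z j x) \<partial>M) \<le> K * r ^ (j - i)"
    and decouple2: "i \<le> j \<Longrightarrow> F \<in> borel_measurable (A i) \<Longrightarrow> (\<And>x. cmod (F x) \<le> 1) \<Longrightarrow>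
      cmod ((\<integral>x. F x * of_real (Z j x * Z (j + l) x) \<partial>M) - (\<integral>x. F x \<partial>M) * of_real (c l)) \<le> K * r ^ (j - i)"
    and cov: "(\<integral>x. Z j x * Z (j + l) x \<partial>M) = c l"
begin

section \<open>Partial sums and their second moments\<close>

definition S :: "nat \<Rightarrow> 'a \<Rightarrow> real" where "S n x = (\<Sum>j<n. Z j x)"

text \<open>The long-run variance, the limit of the second moment of \<open>S n\<close> divided by
  \<open>n\<close>.\<close>

definition v2 :: real where "v2 = c 0 + 2 * (\<Sum>l. c (Suc l))"

lemma measurable_A_mono: "f \<in> borel_measurable (A i) \<Longrightarrow> i \<le> j \<Longrightarrow> f \<in> borel_measurable (A j)"
  using measurable_from_subalg[OF subalg_mono] by blast

lemma measurable_A_M: "f \<in> borel_measurable (A i) \<Longrightarrow> f \<in> borel_measurable M"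
  using measurable_from_subalg[OF subalg_M] by blast

lemma Z_measurable[measurable]: "Z j \<in> borel_measurable M"
  by (rule measurable_A_M[OF Z_adapted])

lemma S_adapted: "n \<le> k \<Longrightarrow> S n \<in> borel_measurable (A k)"
  unfolding S_def by (intro borel_measurable_sum measurable_A_mono[OF Z_adapted]) auto

lemma S_measurable[measurable]: "S n \<in> borel_measurable M"
  by (rule measurable_A_M[OF S_adapted[OF order_refl]])

lemma S_diff_le: "m \<le> n \<Longrightarrow> \<bar>S n x - S m x\<bar> \<le> real (n - m)"
proof -
  assume "m \<le> n"
  then have "S n x - S m x = (\<Sum>j\<in>{m..<n}. Z j x)"
    unfolding S_def by (simp add: sum_diff_nat_ivl lessThan_atLeast0)
  also have "\<bar>\<dots>\<bar> \<le> (\<Sum>j\<in>{m..<n}. 1)" by (rule order.trans[OF sum_abs sum_mono]) (rule Z_le)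
  finally show ?thesis by simp
qed

lemma S_le: "\<bar>S n x\<bar> \<le> real n"
  using S_diff_le[of 0 n x] by (simp add: S_def)

lemma integrable_bounded:
  fixes f :: "'a \<Rightarrow> 'b :: {banach, second_countable_topology}"
  assumes "f \<in> borel_measurable M" "\<And>x. norm (f x) \<le> B"
  shows "integrable M f"
  by (rule integrable_const_bound[where B=B]) (use assms in auto)

lemma norm_integral_le:
  fixes f :: "'a \<Rightarrow> 'b :: {banach, second_countable_topology}"
  assumes "f \<in> borel_measurable M" "\<And>x. norm (f x) \<le> B"
  shows "norm (\<integral>x. f x \<partial>M) \<le> B"
proof -
  have "norm (\<integral>x. f x \<partial>M) \<le> (\<integral>x. B \<partial>M)"
    by (rule norm_integral_le_integral) (use assms integrable_bounded[OF assms] in auto)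
  then show ?thesis by (simp add: prob_space)
qed

lemma decouple_real:
  assumes "i \<le> j" "F \<in> borel_measurable (A i)" "\<And>x. \<bar>F x\<bar> \<le> B" "0 < B"
  shows "\<bar>\<integral>x. F x * Z j x \<partial>M\<bar> \<le> B * (K * r ^ (j - i))"
proof -
  have "cmod (\<integral>x. complex_of_real (F x / B) * of_real (Z j x) \<partial>M) \<le> K * r ^ (j - i)"
    using assms by (intro decouple1) (auto simp: norm_divide)
  also have "(\<integral>x. complex_of_real (F x / B) * of_real (Z j x) \<partial>M) = of_real ((\<integral>x. F x * Z j x \<partial>M) / B)"
    by (simp only: of_real_mult[symmetric] integral_complex_of_real) simp
  finally show ?thesis using assms(4) by (simp add: norm_divide divide_le_eq mult.commute)
qed

lemma c_le: "\<bar>c l\<bar> \<le> K * r ^ l"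
  using decouple_real[of 0 l "Z 0" 1] Z_adapted Z_le cov[of 0 l] by simp

lemma c_le_1: "\<bar>c l\<bar> \<le> 1"
proof -
  have "norm (\<integral>x. Z 0 x * Z (0 + l) x \<partial>M) \<le> 1"
    by (rule norm_integral_le) (use Z_le in \<open>auto simp: abs_mult intro!: mult_le_one\<close>)
  then show ?thesis unfolding cov by simp
qed

lemma summable_Kr: "summable (\<lambda>l. K * r ^ (l + n))"
  using r by (auto simp: power_add intro!: summable_mult summable_mult2 summable_geometric)

lemma summable_abs_c: "summable (\<lambda>l. \<bar>c (l + n)\<bar>)"
  by (rule summable_comparison_test'[OF summable_Kr[of n], of 0]) (use c_le in auto)

lemma summable_c: "summable (\<lambda>l. c (Suc l))"
  using summable_rabs_cancel[OF summable_abs_c[of 1]] by simp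

lemma c_tail: "\<bar>(\<Sum>l. c (Suc l)) - (\<Sum>l<n. c (Suc l))\<bar> \<le> K * r ^ n / (1 - r)"
proof -
  have "(\<Sum>l. c (Suc l)) - (\<Sum>l<n. c (Suc l)) = (\<Sum>l. c (l + Suc n))"
    using suminf_minus_initial_segment[OF summable_c, of n] by simp
  also have "\<bar>\<dots>\<bar> \<le> (\<Sum>l. \<bar>c (l + Suc n)\<bar>)" by (rule summable_rabs[OF summable_abs_c])
  also have "\<dots> \<le> (\<Sum>l. K * r ^ (l + Suc n))"
    by (intro suminf_le c_le summable_abs_c summable_Kr)
  also have "\<dots> \<le> (\<Sum>l. K * r ^ (l + n))"
    using r K by (intro suminf_le summable_Kr mult_left_mono power_decreasing) auto
  also have "\<dots> = (\<Sum>l. (K * r ^ n) * r ^ l)" by (simp add: power_add mult_ac)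
  also have "\<dots> = K * r ^ n / (1 - r)"
    using r by (subst suminf_mult) (auto simp: suminf_geometric summable_geometric)
  finally show ?thesis .
qed

text \<open>Absorbs the additive constant of \<open>second_moment\<close>, which makes
  \<open>second_moment_le\<close> homogeneous in \<open>n\<close>.\<close>

definition C2 :: real where "C2 = \<bar>v2\<bar> + 2 * K / (1 - r)\<^sup>2"

lemma C2_nonneg: "0 \<le> C2" using K unfolding C2_def by auto

lemma S_Suc: "S (Suc n) x = S n x + Z n x"
  by (simp add: S_def)

lemma S_0: "S 0 x = 0" by (simp add: S_def)

lemma integrable_SZ[simp]: "integrable M (\<lambda>x. S n x ^ a * Z j x ^ b)"
proof (rule integrable_bounded)
  fix x
  have "\<bar>S n x\<bar> ^ a * \<bar>Z j x\<bar> ^ b \<le> real n ^ a * 1"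
    by (intro mult_mono power_mono S_le power_le_one Z_le) auto
  then show "norm (S n x ^ a * Z j x ^ b) \<le> real n ^ a" by (simp add: abs_mult power_abs)
qed simp

lemma integrable_S[simp]: "integrable M (\<lambda>x. S n x ^ a)"
  using integrable_SZ[of n a 0 0] by simp

lemma integrable_SZ1[simp]: "integrable M (\<lambda>x. S n x ^ a * Z j x)" "integrable M (\<lambda>x. S n x * Z j x ^ b)"
   "integrable M (\<lambda>x. S n x * Z j x)"  "integrable M (\<lambda>x. Z j x)" "integrable M (\<lambda>x. Z j x ^ b)" "integrable M (\<lambda>x. S n x)"
  using integrable_SZ[of n a j 1] integrable_SZ[of n 1 j b] integrable_SZ[of n 1 j 1]
   integrable_SZ[of n 0 j 1] integrable_SZ[of n 0 j b] integrable_SZ[of n 1 j 0] by simp_all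

lemma second_moment_Suc: "(\<integral>x. (S (Suc n) x)\<^sup>2 \<partial>M) = (\<integral>x. (S n x)\<^sup>2 \<partial>M) + (c 0 + 2 * (\<Sum>l<n. c (Suc l)))"
proof -
  have "(\<integral>x. S n x * Z n x \<partial>M) = (\<Sum>i<n. \<integral>x. Z i x * Z n x \<partial>M)"
    unfolding S_def sum_distrib_right
  proof (rule Bochner_Integration.integral_sum)
    fix i show "integrable M (\<lambda>x. Z i x * Z n x)"
      by (rule integrable_bounded[where B=1]) (use Z_le in \<open>auto simp: abs_mult intro!: mult_le_one\<close>)
  qed
  also have "\<dots> = (\<Sum>i<n. c (n - i))"
  proof (rule sum.cong)
    fix i assume "i \<in> {..<n}"
    then show "(\<integral>x. Z i x * Z n x \<partial>M) = c (n - i)" using cov[of i "n - i"] by simp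
  qed simp
  also have "\<dots> = (\<Sum>i<n. c (Suc (n - Suc i)))" by (intro sum.cong) (auto simp: Suc_diff_Suc)
  also have "\<dots> = (\<Sum>l<n. c (Suc l))" by (rule sum.nat_diff_reindex)
  finally have SZ: "(\<integral>x. S n x * Z n x \<partial>M) = (\<Sum>l<n. c (Suc l))" .
  have ZZ: "(\<integral>x. (Z n x)\<^sup>2 \<partial>M) = c 0" using cov[of n 0] by (simp add: power2_eq_square)
  have "(\<integral>x. (S (Suc n) x)\<^sup>2 \<partial>M) = (\<integral>x. (S n x)\<^sup>2 + 2 * (S n x * Z n x) + (Z n x)\<^sup>2 \<partial>M)"
    by (simp add: S_Suc power2_sum mult_ac add_ac)
  also have "\<dots> = (\<integral>x. (S n x)\<^sup>2 \<partial>M) + 2 * (\<integral>x. S n x * Z n x \<partial>M) + (\<integral>x. (Z n x)\<^sup>2 \<partial>M)"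
    by simp
  finally show ?thesis unfolding SZ ZZ by simp
qed

text \<open>By \<open>second_moment_Suc\<close> each step adds \<open>v2\<close> minus twice a tail
  of the covariance series. The tails are geometric, so the deviations sum to a constant instead of
  growing with \<open>n\<close>.\<close>

lemma second_moment: "\<bar>(\<integral>x. (S n x)\<^sup>2 \<partial>M) - real n * v2\<bar> \<le> 2 * K / (1 - r)\<^sup>2"
proof -
  have "\<bar>(\<integral>x. (S n x)\<^sup>2 \<partial>M) - real n * v2\<bar> \<le> (\<Sum>j<n. 2 * (K * r ^ j / (1 - r)))"
  proof (induction n)
    case (Suc n)
    have "\<bar>(c 0 + 2 * (\<Sum>l<n. c (Suc l))) - v2\<bar> \<le> 2 * (K * r ^ n / (1 - r))"
      using c_tail[of n] unfolding v2_def by linarith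
    then show ?case using Suc second_moment_Suc[of n] by (simp add: distrib_right)
  qed (simp add: S_0)
  also have "\<dots> = 2 * K / (1 - r) * (\<Sum>j<n. r ^ j)"
    unfolding sum_distrib_left by (intro sum.cong) auto
  also have "\<dots> \<le> 2 * K / (1 - r) * (1 / (1 - r))"
  proof (rule mult_left_mono)
    have "(\<Sum>j<n. r ^ j) \<le> (\<Sum>j. r ^ j)"
      using r by (intro sum_le_suminf summable_geometric) auto
    then show "(\<Sum>j<n. r ^ j) \<le> 1 / (1 - r)" using r by (simp add: suminf_geometric)
  qed (use r K in auto)
  finally show ?thesis by (simp add: power2_eq_square)
qed

lemma second_moment_le: "(\<integral>x. (S n x)\<^sup>2 \<partial>M) \<le> C2 * real n"
proof (cases "n = 0")
  case False
  have "(\<integral>x. (S n x)\<^sup>2 \<partial>M) \<le> real n * v2 + 2 * K / (1 - r)\<^sup>2"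
    using second_moment[of n] by linarith
  also have "\<dots> \<le> real n * \<bar>v2\<bar> + real n * (2 * K / (1 - r)\<^sup>2)"
  proof (intro add_mono mult_left_mono)
    have "1 * (2 * K / (1 - r)\<^sup>2) \<le> real n * (2 * K / (1 - r)\<^sup>2)"
      using False K by (intro mult_right_mono) auto
    then show "2 * K / (1 - r)\<^sup>2 \<le> real n * (2 * K / (1 - r)\<^sup>2)" by simp
  qed auto
  finally show ?thesis unfolding C2_def by (simp add: algebra_simps)
qed (simp add: S_0)

lemma second_moment_limit: "(\<lambda>n. (\<integral>x. (S n x)\<^sup>2 \<partial>M) / real n) \<longlonglongrightarrow> v2"
proof (rule LIM_zero_cancel, rule Lim_null_comparison)
  show "eventually (\<lambda>n. norm ((\<integral>x. (S n x)\<^sup>2 \<partial>M) / real n - v2) \<le> (2 * K / (1 - r)\<^sup>2) / real n) sequentially"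
    using eventually_gt_at_top[of 0]
  proof eventually_elim
    case (elim n)
    have "(\<integral>x. (S n x)\<^sup>2 \<partial>M) / real n - v2 = ((\<integral>x. (S n x)\<^sup>2 \<partial>M) - real n * v2) / real n"
      using elim by (simp add: field_simps)
    then show ?case using divide_right_mono[OF second_moment[of n], of "real n"] by simp
  qed
  show "(\<lambda>n. (2 * K / (1 - r)\<^sup>2) / real n) \<longlonglongrightarrow> 0" by (rule lim_const_over_n)
qed

lemma v2_nonneg: "0 \<le> v2"
  by (rule LIMSEQ_le_const[OF second_moment_limit]) (auto intro!: divide_nonneg_nonneg integral_nonneg_AE)

text \<open>A gap of length \<open>m\<close> separates past from present:
  \<open>S (j - m) ^ 3\<close> decouples from \<open>Z j\<close>, and exchanging
  \<open>S j ^ 3\<close> for it costs \<open>m\<close> times second moments, which are linear in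
  \<open>N\<close>. If \<open>m > j\<close>, truncated subtraction yields \<open>S 0 = 0\<close> and
  the first part vanishes.\<close>

lemma S_cubed_Z:
  assumes "j < N"
  shows "\<bar>\<integral>w. S j w ^ 3 * Z j w \<partial>M\<bar> \<le> real N ^ 3 * (K * r ^ m) + 3 * real m * C2 * real N"
proof -
  let ?i = "j - m"
  have 1: "\<bar>\<integral>w. S ?i w ^ 3 * Z j w \<partial>M\<bar> \<le> real N ^ 3 * (K * r ^ m)"
  proof (cases "m \<le> j")
    case True
    have "\<bar>\<integral>w. S ?i w ^ 3 * Z j w \<partial>M\<bar> \<le> real N ^ 3 * (K * r ^ (j - ?i))"
    proof (rule decouple_real)
      fix w
      have "\<bar>S ?i w\<bar> \<le> real N" using S_le[of ?i w] assms by linarith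
      then show "\<bar>S ?i w ^ 3\<bar> \<le> real N ^ 3" by (simp add: power_abs power_mono)
      note S_adapted[OF order_refl, measurable]
      show "(\<lambda>w. S ?i w ^ 3) \<in> borel_measurable (A ?i)" by measurable
    qed (use assms in auto)
    then show ?thesis using True by simp
  next
    case False
    then have "?i = 0" by simp
    then show ?thesis using K r by (simp add: S_0)
  qed
  have "\<bar>\<integral>w. (S j w ^ 3 - S ?i w ^ 3) * Z j w \<partial>M\<bar> \<le> (\<integral>w. real m * (3 / 2) * ((S j w)\<^sup>2 + (S ?i w)\<^sup>2) \<partial>M)"
  proof (rule norm_integral_le_integral[where f="\<lambda>w. (S j w ^ 3 - S ?i w ^ 3) * Z j w", unfolded real_norm_def])
    show "integrable M (\<lambda>w. (S j w ^ 3 - S ?i w ^ 3) * Z j w)"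
      by (simp add: left_diff_distrib)
    fix w
    let ?x = "S j w" and ?y = "S ?i w"
    have "\<bar>(?x ^ 3 - ?y ^ 3) * Z j w\<bar> \<le> \<bar>?x ^ 3 - ?y ^ 3\<bar>"
      using Z_le[of j w] by (simp add: abs_mult mult_left_le)
    also have "\<dots> \<le> \<bar>?x - ?y\<bar> * (3 / 2 * (?x\<^sup>2 + ?y\<^sup>2))" by (rule abs_cube_diff_le)
    also have "\<dots> \<le> real m * (3 / 2 * (?x\<^sup>2 + ?y\<^sup>2))"
      using S_diff_le[of ?i j w] by (intro mult_right_mono) auto
    finally show "\<bar>(?x ^ 3 - ?y ^ 3) * Z j w\<bar> \<le> real m * (3 / 2) * (?x\<^sup>2 + ?y\<^sup>2)" by (simp only: mult.assoc)
  qed simp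
  also have "\<dots> = real m * (3 / 2) * ((\<integral>w. (S j w)\<^sup>2 \<partial>M) + (\<integral>w. (S ?i w)\<^sup>2 \<partial>M))" by simp
  also have "\<dots> \<le> real m * (3 / 2) * (C2 * real N + C2 * real N)"
  proof (intro mult_left_mono add_mono)
    show "(\<integral>w. (S j w)\<^sup>2 \<partial>M) \<le> C2 * real N"
      using assms C2_nonneg by (intro order.trans[OF second_moment_le] mult_left_mono) auto
    show "(\<integral>w. (S ?i w)\<^sup>2 \<partial>M) \<le> C2 * real N"
      using assms C2_nonneg by (intro order.trans[OF second_moment_le] mult_left_mono) auto
  qed auto
  also have "\<dots> = 3 * real m * C2 * real N" by simp
  finally have 2: "\<bar>\<integral>w. (S j w ^ 3 - S ?i w ^ 3) * Z j w \<partial>M\<bar> \<le> 3 * real m * C2 * real N" .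
  have "(\<integral>w. S j w ^ 3 * Z j w \<partial>M) = (\<integral>w. S ?i w ^ 3 * Z j w + (S j w ^ 3 - S ?i w ^ 3) * Z j w \<partial>M)"
    by (simp add: left_diff_distrib)
  also have "\<dots> = (\<integral>w. S ?i w ^ 3 * Z j w \<partial>M) + (\<integral>w. (S j w ^ 3 - S ?i w ^ 3) * Z j w \<partial>M)"
    by (rule Bochner_Integration.integral_add) (simp_all add: left_diff_distrib)
  finally show ?thesis using 1 2 by linarith
qed

text \<open>Only the cubic term in the expansion of \<open>(S n + Z n) ^ 4\<close> needs decoupling;
  the others are at most of order \<open>N\<close> by the second moment or by
  \<open>\<bar>S n\<bar> \<le> N\<close>. The horizon \<open>N\<close> is kept apart from
  \<open>n\<close> so that every step of the induction obeys the same bound.\<close>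

lemma fourth_moment_aux:
  "n \<le> N \<Longrightarrow> (\<integral>x. S n x ^ 4 \<partial>M)
    \<le> real n * (4 * (real N ^ 3 * (K * r ^ m) + 3 * real m * C2 * real N) + 6 * (C2 * real N) + 4 * real N + 1)"
proof (induction n)
  case (Suc n)
  have "(\<integral>x. S (Suc n) x ^ 4 \<partial>M) = (\<integral>x. S n x ^ 4 + 4 * (S n x ^ 3 * Z n x) + 6 * (S n x ^ 2 * Z n x ^ 2) + 4 * (S n x * Z n x ^ 3) + Z n x ^ 4 \<partial>M)"
    unfolding S_Suc by (intro Bochner_Integration.integral_cong refl) (simp add: power4_eq_xxxx power3_eq_cube power2_eq_square algebra_simps)
  also have "\<dots> = (\<integral>x. S n x ^ 4 \<partial>M) + 4 * (\<integral>x. S n x ^ 3 * Z n x \<partial>M) + 6 * (\<integral>x. S n x ^ 2 * Z n x ^ 2 \<partial>M)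
     + 4 * (\<integral>x. S n x * Z n x ^ 3 \<partial>M) + (\<integral>x. Z n x ^ 4 \<partial>M)" by simp
  also have "\<dots> \<le> (\<integral>x. S n x ^ 4 \<partial>M) + 4 * (real N ^ 3 * (K * r ^ m) + 3 * real m * C2 * real N) + 6 * (C2 * real N) + 4 * real N + 1"
  proof (intro add_mono mult_left_mono order_refl)
    show "(\<integral>x. S n x ^ 3 * Z n x \<partial>M) \<le> real N ^ 3 * (K * r ^ m) + 3 * real m * C2 * real N"
      using S_cubed_Z[of n N m] Suc.prems by linarith
    have "(\<integral>x. S n x ^ 2 * Z n x ^ 2 \<partial>M) \<le> (\<integral>x. (S n x)\<^sup>2 \<partial>M)"
      by (rule integral_mono) (use Z_le in \<open>auto simp: mult_left_le abs_square_le_1\<close>)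
    also have "\<dots> \<le> C2 * real n" by (rule second_moment_le)
    also have "\<dots> \<le> C2 * real N" using Suc.prems C2_nonneg by (intro mult_left_mono) auto
    finally show "(\<integral>x. S n x ^ 2 * Z n x ^ 2 \<partial>M) \<le> C2 * real N" .
    have "norm (\<integral>x. S n x * Z n x ^ 3 \<partial>M) \<le> real N"
    proof (rule norm_integral_le)
      fix x
      have "\<bar>S n x\<bar> * \<bar>Z n x\<bar> ^ 3 \<le> real N * 1"
        using S_le[of n x] Suc.prems by (intro mult_mono power_le_one Z_le) auto
      then show "norm (S n x * Z n x ^ 3) \<le> real N" by (simp add: abs_mult power_abs)
    qed simp
    then show "(\<integral>x. S n x * Z n x ^ 3 \<partial>M) \<le> real N" by simp
    have "norm (\<integral>x. Z n x ^ 4 \<partial>M) \<le> 1"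
      by (rule norm_integral_le, simp, unfold real_norm_def power_abs) (intro power_le_one Z_le abs_ge_zero)
    then show "(\<integral>x. Z n x ^ 4 \<partial>M) \<le> 1" by simp
  qed auto
  finally show ?case using Suc by (simp add: distrib_right)
qed (simp add: S_0)

text \<open>The logarithmic gap: solve \<open>r ^ m = N powr (- p)\<close> for \<open>m\<close>. Of
  the \<open>+ 2\<close>, one pays for rounding up and one for the \<open>Suc\<close> that enforces
  \<open>1 \<le> m\<close>.\<close>

lemma gap_exists:
  fixes N p :: nat
  assumes "1 \<le> N"
  obtains m :: nat where "1 \<le> m" "r ^ m \<le> 1 / real N ^ p" "real m \<le> real p * ln (real N) / (- ln r) + 2"
proof -
  define L where "L = - ln r"
  have L: "0 < L" using r by (simp add: L_def)
  define m where "m = Suc (nat \<lceil>real p * ln (real N) / L\<rceil>)"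
  have nn: "0 \<le> real p * ln (real N) / L" using assms L by simp
  have m1: "real p * ln (real N) / L \<le> real m" unfolding m_def by (simp add: le_nat_iff) linarith
  have "real p * ln (real N) \<le> real m * L" using m1 L by (simp add: divide_le_eq)
  then have "exp (- (real m * L)) \<le> exp (- (real p * ln (real N)))" by simp
  moreover have "exp (- (real m * L)) = r ^ m"
    using r exp_of_nat_mult[of m "ln r"] by (simp add: L_def)
  moreover have "exp (- (real p * ln (real N))) = 1 / real N ^ p"
    using assms exp_of_nat_mult[of p "ln (real N)"] by (simp add: exp_minus field_simps)
  ultimately have "r ^ m \<le> 1 / real N ^ p" by simp
  moreover have "real m \<le> real p * ln (real N) / L + 2"
  proof -
    have "real m = of_int \<lceil>real p * ln (real N) / L\<rceil> + 1" unfolding m_def using nn by simp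
    then show ?thesis using of_int_ceiling_le_add_one[of "real p * ln (real N) / L"] by linarith
  qed
  ultimately show ?thesis using that[of m] by (simp add: L_def m_def)
qed

text \<open>Exponent 3 in the gap cancels the \<open>N ^ 3\<close> in front of
  \<open>K * r ^ m\<close>. What remains is of order \<open>N\<^sup>2 * ln N\<close>; the crude
  \<open>ln N \<le> 2 * sqrt N\<close> trades the logarithm for a power that is still good enough in
  \<open>strong_law\<close> and in \<open>P_tail\<close>.\<close>

lemma fourth_moment: "\<exists>C\<ge>0. \<forall>N. (\<integral>x. S N x ^ 4 \<partial>M) \<le> C * (real N ^ 2 * sqrt (real N))"
proof -
  define L where "L = - ln r"
  have L: "0 < L" using r by (simp add: L_def)
  define C where "C = 4 * K + 12 * C2 * (6 / L + 2) + 6 * C2 + 5"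
  have "(\<integral>x. S N x ^ 4 \<partial>M) \<le> C * (real N ^ 2 * sqrt (real N))" for N
  proof (cases "N = 0")
    case True then show ?thesis by (simp add: S_0)
  next
    case False
    then have N: "1 \<le> N" by simp
    from gap_exists[OF N, of 3] obtain m where m: "r ^ m \<le> 1 / real N ^ 3" "real m \<le> 3 * ln (real N) / L + 2"
      by (auto simp: L_def)
    have sq: "1 \<le> sqrt (real N)" using N by simp
    have "ln (real N) = 2 * ln (sqrt (real N))" using N by (simp add: ln_sqrt)
    also have "\<dots> \<le> 2 * sqrt (real N)" using ln_le_minus_one[of "sqrt (real N)"] sq by simp
    finally have "3 * ln (real N) / L + 2 \<le> 3 * (2 * sqrt (real N)) / L + 2 * sqrt (real N)"
      using L sq by (intro add_mono divide_right_mono) auto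
    then have m': "real m \<le> (6 / L + 2) * sqrt (real N)" using m(2) by (simp add: distrib_right)
    have NN: "1 \<le> real N * sqrt (real N)" using N sq by (metis mult_mono mult_1 of_nat_1 of_nat_le_iff of_nat_0_le_iff zero_le_one order_trans)
    have Ns: "real N \<le> real N * sqrt (real N)" using mult_left_mono[OF sq, of "real N"] by simp
    have "real N ^ 3 * (K * r ^ m) \<le> real N ^ 3 * (K * (1 / real N ^ 3))"
      using m(1) K by (intro mult_left_mono) auto
    also have "\<dots> = K" using N by simp
    also have "\<dots> \<le> K * (real N * sqrt (real N))" using mult_left_mono[OF NN K] by simp
    finally have 1: "real N ^ 3 * (K * r ^ m) \<le> K * (real N * sqrt (real N))" .
    have 2: "3 * real m * C2 * real N \<le> 3 * ((6 / L + 2) * sqrt (real N)) * C2 * real N"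
      using m' C2_nonneg by (intro mult_right_mono mult_left_mono) auto
    have 3: "C2 * real N \<le> C2 * (real N * sqrt (real N))"
      using Ns C2_nonneg by (intro mult_left_mono) auto
    have "4 * (real N ^ 3 * (K * r ^ m) + 3 * real m * C2 * real N) + 6 * (C2 * real N) + 4 * real N + 1
      \<le> 4 * (K * (real N * sqrt (real N)) + 3 * ((6 / L + 2) * sqrt (real N)) * C2 * real N)
        + 6 * (C2 * (real N * sqrt (real N))) + 4 * (real N * sqrt (real N)) + real N * sqrt (real N)"
      by (intro add_mono mult_left_mono 1 2 3 NN Ns) auto
    also have "\<dots> = C * (real N * sqrt (real N))" unfolding C_def by (simp add: algebra_simps)
    finally have "real N * (4 * (real N ^ 3 * (K * r ^ m) + 3 * real m * C2 * real N) + 6 * (C2 * real N) + 4 * real N + 1)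
       \<le> real N * (C * (real N * sqrt (real N)))" by (rule mult_left_mono) simp
    then show ?thesis using fourth_moment_aux[of N N m] by (simp add: power2_eq_square mult_ac)
  qed
  moreover have "0 \<le> C" unfolding C_def using K C2_nonneg L by simp
  ultimately show ?thesis by blast
qed

text \<open>The fourth moments of \<open>S n / n\<close> are of order
  \<open>n powr (- 3 / 2)\<close>, so the series of fourth powers has finite expectation. Hence it
  converges almost surely and its terms tend to 0.\<close>

lemma strong_law: "AE x in M. (\<lambda>n. S n x / real n) \<longlonglongrightarrow> 0"
proof -
  obtain C where C: "0 \<le> C" "\<And>N. (\<integral>x. S N x ^ 4 \<partial>M) \<le> C * (real N ^ 2 * sqrt (real N))"
    using fourth_moment by blast
  have le: "(\<integral>\<^sup>+x. ennreal ((S n x / real n) ^ 4) \<partial>M) \<le> ennreal (C * real n powr (- 3 / 2))" for n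
  proof (cases "n = 0")
    case True then show ?thesis by (simp add: S_0)
  next
    case False
    have "(\<integral>\<^sup>+x. ennreal ((S n x / real n) ^ 4) \<partial>M) = ennreal (\<integral>x. (S n x / real n) ^ 4 \<partial>M)"
      by (rule nn_integral_eq_integral) (auto simp: power_divide)
    also have "(\<integral>x. (S n x / real n) ^ 4 \<partial>M) = (\<integral>x. S n x ^ 4 \<partial>M) / real n ^ 4" by (simp add: power_divide)
    also have "\<dots> \<le> C * (real n ^ 2 * sqrt (real n)) / real n ^ 4"
      by (intro divide_right_mono C) auto
    also have "\<dots> = C * real n powr (- 3 / 2)"
    proof -
      have pw: "real n ^ 2 = real n powr 2" "real n ^ 4 = real n powr 4" "sqrt (real n) = real n powr (1 / 2)"
        using False by (simp_all add: powr_half_sqrt)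
      have "real n ^ 2 * sqrt (real n) / real n ^ 4 = real n powr (- 3 / 2)"
        unfolding pw powr_add[symmetric] powr_diff[symmetric] by simp
      then show ?thesis by (metis times_divide_eq_right)
    qed
    finally show ?thesis by (simp add: ennreal_leI)
  qed
  have "(\<integral>\<^sup>+x. (\<Sum>n. ennreal ((S n x / real n) ^ 4)) \<partial>M) = (\<Sum>n. \<integral>\<^sup>+x. ennreal ((S n x / real n) ^ 4) \<partial>M)"
    by (rule nn_integral_suminf) simp
  also have "\<dots> \<le> (\<Sum>n. ennreal (C * real n powr (- 3 / 2)))"
    by (intro suminf_le le) auto
  also have "\<dots> < \<infinity>"
  proof -
    have "summable (\<lambda>n. C * real n powr (- 3 / 2))"
      by (intro summable_mult) (simp add: summable_real_powr_iff)
    then have "(\<Sum>n. ennreal (C * real n powr (- 3 / 2))) = ennreal (\<Sum>n. C * real n powr (- 3 / 2))"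
      using C by (intro suminf_ennreal2) auto
    then show ?thesis by simp
  qed
  finally have "AE x in M. (\<Sum>n. ennreal ((S n x / real n) ^ 4)) \<noteq> \<infinity>"
    by (intro nn_integral_PInf_AE) auto
  then show ?thesis
  proof eventually_elim
    case (elim x)
    then have "summable (\<lambda>n. (S n x / real n) ^ 4)"
      by (intro summable_suminf_not_top) auto
    then have "(\<lambda>n. (S n x / real n) ^ 4) \<longlonglongrightarrow> 0" by (rule summable_LIMSEQ_zero)
    then show ?case by simp
  qed
qed

section \<open>Characteristic functions of the partial sums and the central limit theorem\<close>

definition \<phi> :: "real \<Rightarrow> nat \<Rightarrow> complex" where "\<phi> s j = (\<integral>x. iexp (s * S j x) \<partial>M)"

lemma \<phi>_diff:
  assumes "i \<le> j"
  shows "cmod (\<phi> s j - \<phi> s i) \<le> \<bar>s\<bar> * real (j - i)"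
proof -
  have "cmod (\<phi> s j - \<phi> s i) \<le> (\<integral>x. \<bar>s\<bar> * real (j - i) \<partial>M)"
    unfolding \<phi>_def
  proof (rule cmod_integral_iexp_diff_le)
    fix x
    show "\<bar>s * S j x - s * S i x\<bar> \<le> \<bar>s\<bar> * real (j - i)"
      using S_diff_le[OF assms] by (simp add: abs_mult right_diff_distrib[symmetric] mult_left_mono)
  qed simp_all
  then show ?thesis by (simp add: prob_space)
qed

lemma \<phi>_le_1: "cmod (\<phi> s j) \<le> 1"
  unfolding \<phi>_def by (rule norm_integral_le) auto

text \<open>Used with \<open>x = S j\<close>, \<open>y = S (j - m)\<close>,
  \<open>w = S (j - 2 * m)\<close> and \<open>z = Z j\<close>. A second order expansion in
  \<open>z\<close> alone leaves \<open>iexp (s * x)\<close> next to \<open>z\<close>, too close to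
  decouple. So in the linear and quadratic terms that exponential is moved back in time, and in the
  linear term the first order correction \<open>x - y\<close> of this move is itself paired with an
  exponential one gap earlier. Everything discarded is cubic in \<open>s\<close>.\<close>

lemma iexp_step_pointwise:
  fixes x y w z s :: real and m :: nat
  assumes m: "1 \<le> m" and xy: "\<bar>x - y\<bar> \<le> real m" and yw: "\<bar>y - w\<bar> \<le> real m" and z: "\<bar>z\<bar> \<le> 1"
  shows "cmod (iexp (s * (x + z)) - (iexp (s * x) + \<i> * s * (iexp (s * y) * z) - s\<^sup>2 * (iexp (s * w) * (x - y) * z) - s\<^sup>2 / 2 * (iexp (s * y) * z\<^sup>2)))
    \<le> 3 * \<bar>s\<bar> ^ 3 * (real m)\<^sup>2"
proof -
  define e where "e = iexp (s * x)"
  define e1 where "e1 = iexp (s * y)"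
  define e2 where "e2 = iexp (s * w)"
  define T where "T = x - y"
  have T: "\<bar>T\<bar> \<le> real m" using xy by (simp add: T_def)
  have mm: "1 \<le> (real m)\<^sup>2" "real m \<le> (real m)\<^sup>2" using one_le_power[of "real m" 2] mult_left_mono[of 1 "real m" "real m"] m by (auto simp: power2_eq_square)
  define R where "R = e * (iexp (s * z) - (1 + \<i> * s * z - (s * z)\<^sup>2 / 2))"
  define R1 where "R1 = e1 * (iexp (s * T) - (1 + \<i> * s * T)) * z"
  define R2 where "R2 = (e1 - e2) * T * z"
  define R3 where "R3 = (e - e1) * z\<^sup>2"
  have n1: "cmod e = 1" "cmod e1 = 1" by (auto simp: e_def e1_def)
  have R: "cmod R \<le> \<bar>s\<bar> ^ 3"
  proof -
    have "cmod (iexp (s * z) - (1 + \<i> * s * z - (s * z)\<^sup>2 / 2)) \<le> \<bar>s * z\<bar> ^ 3 / 6"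
      using iexp_approx1[of "s * z" 2] by (simp add: numeral_2_eq_2 atMost_Suc fact_numeral power2_eq_square algebra_simps numeral_eq_Suc)
    also have "\<dots> \<le> \<bar>s * z\<bar> ^ 3" by simp
    also have "\<dots> \<le> \<bar>s\<bar> ^ 3" using z by (intro power_mono) (auto simp: abs_mult mult_left_le)
    finally show ?thesis by (simp add: R_def norm_mult n1)
  qed
  have R1: "cmod R1 \<le> s\<^sup>2 * (real m)\<^sup>2 / 2"
  proof -
    have "cmod (iexp (s * T) - (1 + \<i> * s * T)) \<le> (s * T)\<^sup>2 / 2"
      using iexp_approx1[of "s * T" 1] by (simp add: numeral_2_eq_2[symmetric] mult_ac)
    also have "\<dots> \<le> s\<^sup>2 * (real m)\<^sup>2 / 2"
      using power_mono[OF T, of 2] by (simp add: power_mult_distrib mult_left_mono)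
    finally have "cmod (iexp (s * T) - (1 + \<i> * s * T)) * \<bar>z\<bar> \<le> s\<^sup>2 * (real m)\<^sup>2 / 2 * 1"
      by (intro mult_mono z) auto
    then show ?thesis by (simp add: R1_def norm_mult n1)
  qed
  have R2: "cmod R2 \<le> \<bar>s\<bar> * real m * real m"
  proof -
    have "cmod (e1 - e2) \<le> \<bar>s * y - s * w\<bar>" unfolding e1_def e2_def by (rule iexp_lipschitz)
    also have "\<dots> \<le> \<bar>s\<bar> * real m" using yw by (simp add: abs_mult right_diff_distrib[symmetric] mult_left_mono)
    finally have "cmod (e1 - e2) * \<bar>T\<bar> * \<bar>z\<bar> \<le> \<bar>s\<bar> * real m * real m * 1"
      by (intro mult_mono T z) auto
    then show ?thesis by (simp add: R2_def norm_mult)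
  qed
  have R3: "cmod R3 \<le> \<bar>s\<bar> * real m"
  proof -
    have "cmod (e - e1) \<le> \<bar>s * x - s * y\<bar>" unfolding e_def e1_def by (rule iexp_lipschitz)
    also have "\<dots> \<le> \<bar>s\<bar> * real m" using xy by (simp add: abs_mult right_diff_distrib[symmetric] mult_left_mono)
    finally have "cmod (e - e1) * z\<^sup>2 \<le> \<bar>s\<bar> * real m * 1"
      using z by (intro mult_mono) (auto simp: abs_square_le_1)
    then show ?thesis by (simp add: R3_def norm_mult norm_power)
  qed
  have ee: "e = e1 * iexp (s * T)" unfolding e_def e1_def T_def
    by (simp add: exp_add[symmetric] algebra_simps)
  have "iexp (s * (x + z)) = e * iexp (s * z)" unfolding e_def by (simp add: exp_add[symmetric] algebra_simps)
  also have "\<dots> = e + \<i> * s * (e * z) - s\<^sup>2 / 2 * (e * z\<^sup>2) + R"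
    by (simp add: R_def algebra_simps power2_eq_square)
  also have "e * z = e1 * z + \<i> * s * (e2 * T * z + R2) + R1"
    by (subst ee) (simp add: R1_def R2_def algebra_simps)
  also have "e * z\<^sup>2 = e1 * z\<^sup>2 + R3"
    by (simp add: R3_def algebra_simps)
  finally have EQ: "iexp (s * (x + z)) = e + \<i> * s * (e1 * z + \<i> * s * (e2 * T * z + R2) + R1) - s\<^sup>2 / 2 * (e1 * z\<^sup>2 + R3) + R" .
  have "iexp (s * (x + z)) - (e + \<i> * s * (e1 * z) - s\<^sup>2 * (e2 * T * z) - s\<^sup>2 / 2 * (e1 * z\<^sup>2))
    = - (s\<^sup>2) * R2 + \<i> * s * R1 - s\<^sup>2 / 2 * R3 + R"
    unfolding EQ by (simp add: field_simps power2_eq_square)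
  also have "cmod \<dots> \<le> cmod (- (s\<^sup>2) * R2 + \<i> * s * R1 - s\<^sup>2 / 2 * R3) + cmod R"
    by (rule norm_triangle_ineq)
  also have "\<dots> \<le> cmod (- (s\<^sup>2) * R2) + cmod (\<i> * s * R1) + cmod (s\<^sup>2 / 2 * R3) + cmod R"
    by norm
  also have "\<dots> = s\<^sup>2 * cmod R2 + \<bar>s\<bar> * cmod R1 + s\<^sup>2 / 2 * cmod R3 + cmod R"
    by (simp add: norm_mult norm_divide norm_power)
  also have "\<dots> \<le> s\<^sup>2 * (\<bar>s\<bar> * real m * real m) + \<bar>s\<bar> * (s\<^sup>2 * (real m)\<^sup>2 / 2) + s\<^sup>2 / 2 * (\<bar>s\<bar> * real m) + \<bar>s\<bar> ^ 3"
    by (intro add_mono mult_left_mono R R1 R2 R3) auto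
  also have "\<dots> = \<bar>s\<bar> ^ 3 * ((3 / 2) * (real m)\<^sup>2 + real m / 2 + 1)"
  proof -
    have "s\<^sup>2 = \<bar>s\<bar>\<^sup>2" by simp
    then show ?thesis by (simp only: power2_eq_square power3_eq_cube) (simp add: algebra_simps)
  qed
  also have "\<dots> \<le> \<bar>s\<bar> ^ 3 * (3 * (real m)\<^sup>2)"
    by (intro mult_left_mono) (use mm in linarith, simp)
  finally show ?thesis unfolding e_def e1_def e2_def T_def by (simp add: mult_ac)
qed

text \<open>The linear term \<open>E1\<close> is negligible because \<open>Z\<close> is almost
  uncorrelated with the past; the correction \<open>E2\<close> produces the covariances
  \<open>c 1, ..., c m\<close> and \<open>E3\<close> half of \<open>c 0\<close>, together
  \<open>v2 / 2\<close> up to a geometric tail. The exponential in \<open>E2\<close> sits at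
  \<open>j - 2 * m\<close> because the pairs in it begin as early as \<open>j - m\<close> and need a
  gap before that.\<close>

lemma \<phi>_step:
  assumes m: "1 \<le> m" "2 * m \<le> j"
  shows "cmod (\<phi> s (Suc j) - (1 - s\<^sup>2 * v2 / 2) * \<phi> s j)
    \<le> 6 * \<bar>s\<bar> ^ 3 * (real m)\<^sup>2 + K * r ^ m * (\<bar>s\<bar> + 2 * s\<^sup>2 * real m + s\<^sup>2 / (1 - r))"
proof -
  let ?i = "j - m" and ?h = "j - 2 * m"
  define e where "e k x = iexp (s * S k x)" for k x
  have e_ad: "e k \<in> borel_measurable (A k)" for k
  proof -
    note S_adapted[OF order_refl, measurable]
    show ?thesis unfolding e_def by measurable
  qed
  have [measurable]: "e k \<in> borel_measurable M" for k by (rule measurable_A_M[OF e_ad])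
  have e1: "cmod (e k x) = 1" for k x by (simp add: e_def)
  have \<phi>_e: "\<phi> s k = (\<integral>x. e k x \<partial>M)" for k by (simp add: \<phi>_def e_def)
  define T where "T x = S j x - S ?i x" for x
  have [measurable]: "T \<in> borel_measurable M" unfolding T_def by measurable
  have T_sum: "T x = (\<Sum>l<m. Z (j - Suc l) x)" for x
  proof -
    have "T x = (\<Sum>k\<in>{?i..<j}. Z k x)"
      unfolding T_def S_def using m by (simp add: sum_diff_nat_ivl lessThan_atLeast0)
    also have "\<dots> = (\<Sum>l<m. Z (j - Suc l) x)"
      by (rule sum.reindex_bij_witness[of _ "\<lambda>l. j - Suc l" "\<lambda>k. j - Suc k"]) (use m in auto)
    finally show ?thesis .
  qed
  have T_le: "\<bar>T x\<bar> \<le> real m" for x unfolding T_def using S_diff_le[of ?i j x] m by simp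
  have int1: "integrable M (\<lambda>x. e k x * Z l x)" for k l
    by (rule integrable_bounded[where B=1]) (auto simp: norm_mult e1 Z_le)
  have int2: "integrable M (\<lambda>x. e k x * (Z l x * Z l' x))" for k l l'
    by (rule integrable_bounded[where B=1]) (auto simp: norm_mult e1 Z_le intro!: mult_le_one)
  have int2': "integrable M (\<lambda>x. e k x * (Z l x)\<^sup>2)" for k l
    using int2[of k l l] by (simp add: power2_eq_square)
  have int3: "integrable M (\<lambda>x. e k x * T x * Z l x)" for k l
  proof (rule integrable_bounded)
    fix x
    have "\<bar>T x\<bar> * \<bar>Z l x\<bar> \<le> real m * 1" by (intro mult_mono T_le Z_le) auto
    then show "cmod (e k x * T x * Z l x) \<le> real m" by (simp add: norm_mult e1)
  qed simp
  have int0: "integrable M (e k)" for k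
    by (rule integrable_bounded[where B=1]) (auto simp: e1)
  define E1 where "E1 = (\<integral>x. e ?i x * Z j x \<partial>M)"
  define E2 where "E2 = (\<integral>x. e ?h x * T x * Z j x \<partial>M)"
  define E3 where "E3 = (\<integral>x. e ?i x * (Z j x)\<^sup>2 \<partial>M)"
  define U where "U = (\<Sum>l<m. c (Suc l))"
  have main: "cmod (\<phi> s (Suc j) - (\<phi> s j + \<i> * s * E1 - s\<^sup>2 * E2 - s\<^sup>2 / 2 * E3)) \<le> 3 * \<bar>s\<bar> ^ 3 * (real m)\<^sup>2"
  proof -
    have "\<phi> s (Suc j) - (\<phi> s j + \<i> * s * E1 - s\<^sup>2 * E2 - s\<^sup>2 / 2 * E3)
      = (\<integral>x. e (Suc j) x - (e j x + \<i> * s * (e ?i x * Z j x) - s\<^sup>2 * (e ?h x * T x * Z j x) - s\<^sup>2 / 2 * (e ?i x * (Z j x)\<^sup>2)) \<partial>M)"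
      unfolding \<phi>_e E1_def E2_def E3_def by (simp add: int0 int1 int2'[simplified] int3)
    also have "cmod \<dots> \<le> 3 * \<bar>s\<bar> ^ 3 * (real m)\<^sup>2"
    proof (rule norm_integral_le)
      fix x
      have 2: "\<bar>S ?i x - S ?h x\<bar> \<le> real m" using S_diff_le[of ?h ?i x] m by simp
      show "cmod (e (Suc j) x - (e j x + \<i> * s * (e ?i x * Z j x) - s\<^sup>2 * (e ?h x * T x * Z j x) - s\<^sup>2 / 2 * (e ?i x * (Z j x)\<^sup>2))) \<le> 3 * \<bar>s\<bar> ^ 3 * (real m)\<^sup>2"
        using iexp_step_pointwise[OF m(1) T_le[of x, unfolded T_def] 2 Z_le[of j x], of s]
        unfolding e_def S_Suc T_def by simp
    qed simp
    finally show ?thesis .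
  qed
  have E1: "cmod E1 \<le> K * r ^ m"
    using decouple1[of ?i j "e ?i"] e_ad m by (simp add: E1_def e1)
  have E3: "cmod (E3 - \<phi> s ?i * c 0) \<le> K * r ^ m"
    using decouple2[of ?i j "e ?i" 0] e_ad m by (simp add: E3_def e1 \<phi>_e power2_eq_square)
  have E2: "cmod (E2 - \<phi> s ?h * U) \<le> real m * (K * r ^ m)"
  proof -
    have "E2 = (\<integral>x. (\<Sum>l<m. e ?h x * (Z (j - Suc l) x * Z j x)) \<partial>M)"
      unfolding E2_def T_sum by (simp add: sum_distrib_left sum_distrib_right mult_ac)
    also have "\<dots> = (\<Sum>l<m. \<integral>x. e ?h x * (Z (j - Suc l) x * Z j x) \<partial>M)"
      using int2 by (subst Bochner_Integration.integral_sum) auto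
    finally have "E2 - \<phi> s ?h * U = (\<Sum>l<m. (\<integral>x. e ?h x * (Z (j - Suc l) x * Z j x) \<partial>M) - \<phi> s ?h * c (Suc l))"
      unfolding U_def by (simp add: sum_subtractf sum_distrib_left)
    also have "cmod \<dots> \<le> (\<Sum>l<m. K * r ^ m)"
    proof (rule order.trans[OF norm_sum sum_mono])
      fix l assume "l \<in> {..<m}"
      then have l: "l < m" by simp
      have "cmod ((\<integral>x. e ?h x * of_real (Z (j - Suc l) x * Z (j - Suc l + Suc l) x) \<partial>M) - (\<integral>x. e ?h x \<partial>M) * c (Suc l))
        \<le> K * r ^ (j - Suc l - ?h)"
        by (rule decouple2) (use l m e_ad in \<open>auto simp: e1\<close>)
      also have "\<dots> \<le> K * r ^ m" using K r l m by (intro mult_left_mono power_decreasing) auto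
      finally show "cmod ((\<integral>x. e ?h x * (Z (j - Suc l) x * Z j x) \<partial>M) - \<phi> s ?h * c (Suc l)) \<le> K * r ^ m"
        using l m by (simp add: \<phi>_e)
    qed
    finally show ?thesis by simp
  qed
  let ?W = "\<phi> s (Suc j) - (1 - s\<^sup>2 * v2 / 2) * \<phi> s j"
  let ?Ei = "E3 - \<phi> s ?i * c 0"
  let ?Eh = "E2 - \<phi> s ?h * U"
  let ?dh = "\<phi> s ?h - \<phi> s j"
  let ?di = "\<phi> s ?i - \<phi> s j"
  let ?u = "U + c 0 / 2 - v2 / 2"
  let ?K = "K * r ^ m"
  have U_le: "\<bar>U\<bar> \<le> real m"
    unfolding U_def using sum_mono[of "{..<m}" "\<lambda>l. \<bar>c (Suc l)\<bar>" "\<lambda>_. 1"] c_le_1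
    by (intro order.trans[OF sum_abs]) auto
  have tail: "\<bar>?u\<bar> \<le> ?K / (1 - r)"
  proof -
    have "?u = - ((\<Sum>l. c (Suc l)) - U)" unfolding v2_def by (simp add: field_simps)
    then show ?thesis using c_tail[of m] by (simp add: U_def)
  qed
  have h: "cmod (?dh) \<le> \<bar>s\<bar> * (2 * real m)"
    using \<phi>_diff[of ?h j s] m by (simp add: norm_minus_commute)
  have i: "cmod (?di) \<le> \<bar>s\<bar> * real m"
    using \<phi>_diff[of ?i j s] m by (simp add: norm_minus_commute)
  define D where "D = \<phi> s (Suc j) - (\<phi> s j + \<i> * s * E1 - s\<^sup>2 * E2 - s\<^sup>2 / 2 * E3)"
  \<comment> \<open>Regroups the error: \<open>D\<close> from the pointwise expansion, the
    decoupling errors, the shifts of \<open>\<phi>\<close> from \<open>j - m\<close> and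
    \<open>j - 2 * m\<close> to \<open>j\<close>, and the tail of the covariance series.\<close>
  have eq: "?W
    = D + \<i> * s * E1 - s\<^sup>2 * (?Eh) - s\<^sup>2 * ((?dh) * U) - s\<^sup>2 / 2 * (?Ei)
      - s\<^sup>2 / 2 * ((?di) * c 0) - s\<^sup>2 * (\<phi> s j * (?u))"
    unfolding D_def by (simp add: algebra_simps)
  have "cmod (?W) \<le> cmod D + cmod (\<i> * s * E1) + cmod (s\<^sup>2 * (?Eh)) + cmod (s\<^sup>2 * ((?dh) * U))
     + cmod (s\<^sup>2 / 2 * (?Ei)) + cmod (s\<^sup>2 / 2 * ((?di) * c 0)) + cmod (s\<^sup>2 * (\<phi> s j * (?u)))"
    unfolding eq by (rule norm_triangle7)
  also have "\<dots> = cmod D + \<bar>s\<bar> * cmod E1 + s\<^sup>2 * cmod (?Eh) + s\<^sup>2 * (cmod (?dh) * \<bar>U\<bar>)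
     + s\<^sup>2 / 2 * cmod (?Ei) + s\<^sup>2 / 2 * (cmod (?di) * \<bar>c 0\<bar>) + s\<^sup>2 * (cmod (\<phi> s j) * \<bar>?u\<bar>)"
    by (simp only: norm_mult norm_of_real norm_ii abs_divide abs_power2 abs_numeral mult_1_left)
  also have "\<dots> \<le> 3 * \<bar>s\<bar> ^ 3 * (real m)\<^sup>2 + \<bar>s\<bar> * (?K) + s\<^sup>2 * (real m * (?K)) + s\<^sup>2 * ((\<bar>s\<bar> * (2 * real m)) * real m)
     + s\<^sup>2 / 2 * (?K) + s\<^sup>2 / 2 * ((\<bar>s\<bar> * real m) * 1) + s\<^sup>2 * (1 * (?K / (1 - r)))"
  proof (intro add_mono)
    show "cmod D \<le> 3 * \<bar>s\<bar> ^ 3 * (real m)\<^sup>2" using main by (simp add: D_def)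
    show "\<bar>s\<bar> * cmod E1 \<le> \<bar>s\<bar> * (?K)" by (rule mult_left_mono[OF E1]) simp
    show "s\<^sup>2 * cmod (?Eh) \<le> s\<^sup>2 * (real m * (?K))" by (rule mult_left_mono[OF E2]) simp
    show "s\<^sup>2 * (cmod (?dh) * \<bar>U\<bar>) \<le> s\<^sup>2 * ((\<bar>s\<bar> * (2 * real m)) * real m)"
      by (rule mult_left_mono[OF mult_mono[OF h U_le]]) auto
    show "s\<^sup>2 / 2 * cmod (?Ei) \<le> s\<^sup>2 / 2 * (?K)" by (rule mult_left_mono[OF E3]) simp
    show "s\<^sup>2 / 2 * (cmod (?di) * \<bar>c 0\<bar>) \<le> s\<^sup>2 / 2 * ((\<bar>s\<bar> * real m) * 1)"
      by (rule mult_left_mono[OF mult_mono[OF i c_le_1]]) auto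
    show "s\<^sup>2 * (cmod (\<phi> s j) * \<bar>?u\<bar>) \<le> s\<^sup>2 * (1 * (?K / (1 - r)))"
      by (rule mult_left_mono[OF mult_mono[OF \<phi>_le_1 tail]]) auto
  qed
  also have "\<dots> = \<bar>s\<bar> ^ 3 * (5 * (real m)\<^sup>2 + real m / 2) + ?K * (\<bar>s\<bar> + s\<^sup>2 * real m + s\<^sup>2 / 2 + s\<^sup>2 / (1 - r))"
  proof -
    have "s\<^sup>2 = \<bar>s\<bar>\<^sup>2" by simp
    then show ?thesis by (simp only: power2_eq_square power3_eq_cube) (simp add: algebra_simps)
  qed
  also have "\<dots> \<le> \<bar>s\<bar> ^ 3 * (6 * (real m)\<^sup>2) + ?K * (\<bar>s\<bar> + 2 * s\<^sup>2 * real m + s\<^sup>2 / (1 - r))"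
  proof (rule add_mono[OF mult_left_mono mult_left_mono])
    have "real m \<le> (real m)\<^sup>2"
      using m mult_left_mono[of 1 "real m" "real m"] by (auto simp: power2_eq_square)
    then show "5 * (real m)\<^sup>2 + real m / 2 \<le> 6 * (real m)\<^sup>2" by linarith
    have "s\<^sup>2 * 1 \<le> s\<^sup>2 * real m" using m by (intro mult_left_mono) auto
    then show "\<bar>s\<bar> + s\<^sup>2 * real m + s\<^sup>2 / 2 + s\<^sup>2 / (1 - r) \<le> \<bar>s\<bar> + 2 * s\<^sup>2 * real m + s\<^sup>2 / (1 - r)"
      using zero_le_power2[of s] by linarith
  qed (use K r in auto)
  finally show ?thesis by (simp add: mult_ac)
qed

lemma exp_neg_approx: "0 \<le> x \<Longrightarrow> \<bar>(1 - x) - exp (- x)\<bar> \<le> x\<^sup>2" for x :: real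
proof -
  assume x: "0 \<le> x"
  have 1: "1 - x \<le> exp (- x)" using exp_ge_add_one_self[of "- x"] by simp
  have "exp (- x) \<le> 1 / (1 + x)" using exp_ge_add_one_self[of x] x by (simp add: exp_minus field_simps)
  also have "\<dots> \<le> 1 - x + x\<^sup>2" using x by (simp add: field_simps power2_eq_square)
  finally show ?thesis using 1 by simp
qed

text \<open>The recursion multiplies by a factor \<open>exp (- s\<^sup>2 * v2 / 2) \<le> 1\<close>,
  so one-step errors add up without amplification. In the first \<open>2 * m\<close> steps there is
  no room for the gaps and only a trivial bound per step is available; with \<open>m\<close>
  logarithmic these steps do not matter after scaling.\<close>

lemma \<phi>_approx:
  assumes m: "1 \<le> m"
  shows "cmod (\<phi> s n - exp (- (s\<^sup>2 * v2 / 2) * real n)) \<le> 2 * real m * (\<bar>s\<bar> + s\<^sup>2 * v2 / 2)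
    + real n * (6 * \<bar>s\<bar> ^ 3 * (real m)\<^sup>2 + K * r ^ m * (\<bar>s\<bar> + 2 * s\<^sup>2 * real m + s\<^sup>2 / (1 - r)) + (s\<^sup>2 * v2 / 2)\<^sup>2)"
proof -
  define x where "x = s\<^sup>2 * v2 / 2"
  have x: "0 \<le> x" using v2_nonneg by (simp add: x_def)
  define err where "err = 6 * \<bar>s\<bar> ^ 3 * (real m)\<^sup>2 + K * r ^ m * (\<bar>s\<bar> + 2 * s\<^sup>2 * real m + s\<^sup>2 / (1 - r)) + x\<^sup>2"
  have err: "0 \<le> err" unfolding err_def using K r by simp
  have step: "cmod (\<phi> s (Suc j) - exp (- x) * \<phi> s j) \<le> (if j < 2 * m then \<bar>s\<bar> + x else 0) + err" for j
  proof (cases "j < 2 * m")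
    case True
    have "\<phi> s (Suc j) - exp (- x) * \<phi> s j = (\<phi> s (Suc j) - \<phi> s j) + of_real (1 - exp (- x)) * \<phi> s j"
      by (simp add: algebra_simps)
    also have "cmod \<dots> \<le> cmod (\<phi> s (Suc j) - \<phi> s j) + cmod (of_real (1 - exp (- x)) * \<phi> s j)"
      by (rule norm_triangle_ineq)
    also have "\<dots> \<le> \<bar>s\<bar> + \<bar>1 - exp (- x)\<bar> * 1"
      using \<phi>_diff[of j "Suc j" s] \<phi>_le_1[of s j] unfolding norm_mult norm_of_real
      by (intro add_mono mult_left_mono) auto
    also have "\<bar>1 - exp (- x)\<bar> \<le> x" using x exp_ge_add_one_self[of "- x"] by simp
    finally show ?thesis using True err by simp
  next
    case False
    have "\<phi> s (Suc j) - exp (- x) * \<phi> s j = (\<phi> s (Suc j) - (1 - x) * \<phi> s j) + of_real ((1 - x) - exp (- x)) * \<phi> s j"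
      by (simp add: algebra_simps)
    also have "cmod \<dots> \<le> cmod (\<phi> s (Suc j) - (1 - x) * \<phi> s j) + cmod (of_real ((1 - x) - exp (- x)) * \<phi> s j)"
      by (rule norm_triangle_ineq)
    also have "\<dots> \<le> (6 * \<bar>s\<bar> ^ 3 * (real m)\<^sup>2 + K * r ^ m * (\<bar>s\<bar> + 2 * s\<^sup>2 * real m + s\<^sup>2 / (1 - r))) + x\<^sup>2 * 1"
      unfolding norm_mult norm_of_real
      using \<phi>_step[OF m, of j s] False exp_neg_approx[OF x] \<phi>_le_1[of s j]
      by (intro add_mono mult_mono) (auto simp: x_def)
    finally show ?thesis using False by (simp add: err_def)
  qed
  have "cmod (\<phi> s n - exp (- x * real n)) \<le> (\<Sum>j<n. (if j < 2 * m then \<bar>s\<bar> + x else 0) + err)"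
  proof (induction n)
    case 0 then show ?case by (simp add: \<phi>_def S_0 prob_space)
  next
    case (Suc n)
    have ex: "exp (- x * real (Suc n)) = exp (- x) * exp (- x * real n)"
      unfolding exp_add[symmetric] by (simp add: algebra_simps)
    have "\<phi> s (Suc n) - exp (- x * real (Suc n)) = (\<phi> s (Suc n) - exp (- x) * \<phi> s n) + of_real (exp (- x)) * (\<phi> s n - exp (- x * real n))"
      unfolding ex by (simp only: of_real_mult) (simp add: algebra_simps)
    also have "cmod \<dots> \<le> cmod (\<phi> s (Suc n) - exp (- x) * \<phi> s n) + cmod (of_real (exp (- x)) * (\<phi> s n - exp (- x * real n)))"
      by (rule norm_triangle_ineq)
    also have "cmod (of_real (exp (- x)) * (\<phi> s n - exp (- x * real n))) \<le> 1 * cmod (\<phi> s n - exp (- x * real n))"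
      unfolding norm_mult norm_of_real using x by (intro mult_right_mono) auto
    finally show ?case using Suc step[of n] by simp
  qed
  also have "\<dots> = (\<Sum>j<n. if j < 2 * m then \<bar>s\<bar> + x else 0) + real n * err" by (simp add: sum.distrib)
  also have "(\<Sum>j<n. if j < 2 * m then \<bar>s\<bar> + x else 0) = (\<Sum>j\<in>{..<n} \<inter> {..<2 * m}. \<bar>s\<bar> + x)"
    by (subst sum.inter_restrict) (auto intro: sum.cong)
  also have "\<dots> \<le> (\<Sum>j\<in>{..<2 * m}. \<bar>s\<bar> + x)" using x by (intro sum_mono2) auto
  finally show ?thesis by (simp add: err_def x_def)
qed

theorem central_limit: "(\<lambda>n. \<phi> (t / sqrt (real n)) n) \<longlonglongrightarrow> exp (- (v2 * t\<^sup>2) / 2)"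
proof (rule LIM_zero_cancel, rule Lim_null_comparison)
  define L where "L = - ln r"
  have L: "0 < L" using r by (simp add: L_def)
  \<comment> \<open>Bound on the gap for exponent 1: the geometric error enters \<open>n\<close>
    times with a factor of order \<open>1 / sqrt n\<close>, so \<open>r ^ m \<le> 1 / n\<close> is
    enough.\<close>
  define \<mu> where "\<mu> n = ln (real n) / L + 2" for n :: nat
  define T V C where "T = \<bar>t\<bar> + 1" and "V = v2 + 1" and "C = K + 1"
  have TVC: "0 < T" "0 < V" "0 < C" "\<bar>t\<bar> \<le> T" "v2 \<le> V" "K \<le> C"
    using v2_nonneg K by (auto simp: T_def V_def C_def)
  define B where "B n = 2 * \<mu> n * (T / sqrt n + T\<^sup>2 / n * V / 2)
    + real n * (6 * (T / sqrt n) ^ 3 * (\<mu> n)\<^sup>2 + C * (1 / n) * (T / sqrt n + 2 * (T\<^sup>2 / n) * \<mu> n + T\<^sup>2 / n / (1 - r)) + (T\<^sup>2 / n * V / 2)\<^sup>2)" for n :: nat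
  show "eventually (\<lambda>n. norm (\<phi> (t / sqrt (real n)) n - exp (- (v2 * t\<^sup>2) / 2)) \<le> B n) sequentially"
    using eventually_ge_at_top[of 1]
  proof eventually_elim
    case (elim n)
    obtain m where m: "1 \<le> m" "r ^ m \<le> 1 / real n" "real m \<le> \<mu> n"
      using gap_exists[OF elim, of 1] by (auto simp: \<mu>_def L_def)
    define s where "s = t / sqrt n"
    have s2: "s\<^sup>2 = t\<^sup>2 / n" by (simp add: s_def power_divide)
    have s2': "s\<^sup>2 \<le> T\<^sup>2 / n"
      using power_mono[OF TVC(4), of 2] unfolding s2 by (intro divide_right_mono) auto
    have sa: "\<bar>s\<bar> \<le> T / sqrt n" using TVC(4) by (simp add: s_def divide_right_mono)
    have \<mu>0: "0 \<le> \<mu> n" using elim L by (simp add: \<mu>_def)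
    have ex: "exp (- (s\<^sup>2 * v2 / 2) * real n) = exp (- (v2 * t\<^sup>2) / 2)" using elim by (simp add: s2)
    have "cmod (\<phi> s n - exp (- (s\<^sup>2 * v2 / 2) * real n)) \<le> 2 * real m * (\<bar>s\<bar> + s\<^sup>2 * v2 / 2)
      + real n * (6 * \<bar>s\<bar> ^ 3 * (real m)\<^sup>2 + K * r ^ m * (\<bar>s\<bar> + 2 * s\<^sup>2 * real m + s\<^sup>2 / (1 - r)) + (s\<^sup>2 * v2 / 2)\<^sup>2)"
      by (rule \<phi>_approx[OF m(1)])
    also have "\<dots> \<le> B n"
      unfolding B_def using m r K v2_nonneg TVC s2' sa \<mu>0
      by (intro add_mono mult_mono mult_left_mono divide_right_mono order_refl power_mono add_nonneg_nonneg mult_nonneg_nonneg divide_nonneg_nonneg) auto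
    finally show ?case unfolding ex[symmetric] s_def[symmetric] by simp
  qed
  show "B \<longlonglongrightarrow> 0"
  proof -
    \<comment> \<open>Splits \<open>B\<close> into constants times six explicit sequences; the
      slowest is \<open>n * (1 / sqrt n) ^ 3 * (\<mu> n)\<^sup>2\<close>, of order
      \<open>ln(n)^2 / sqrt n\<close>.\<close>
    have B_eq: "B n = 2 * T * (\<mu> n * (1 / sqrt n)) + T\<^sup>2 * V * (\<mu> n * (1 / n)) + 6 * T ^ 3 * (n * (1 / sqrt n) ^ 3 * (\<mu> n)\<^sup>2)
      + C * T * (n * (1 / n) * (1 / sqrt n)) + 2 * C * T\<^sup>2 * (n * (1 / n)\<^sup>2 * \<mu> n) + (C * T\<^sup>2 / (1 - r) + (T\<^sup>2 * V / 2)\<^sup>2) * (n * (1 / n)\<^sup>2)" for n :: nat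
    proof -
      define y w where "y = 1 / real n" and "w = 1 / sqrt (real n)"
      have e: "T / sqrt n = T * w" "T\<^sup>2 / n = T\<^sup>2 * y" by (auto simp: y_def w_def)
      show ?thesis unfolding B_def e unfolding y_def[symmetric] w_def[symmetric]
        by (simp add: algebra_simps power2_eq_square power3_eq_cube add_divide_distrib)
    qed
    have "(\<lambda>n. \<mu> n * (1 / sqrt n)) \<longlonglongrightarrow> 0" "(\<lambda>n. \<mu> n * (1 / n)) \<longlonglongrightarrow> 0"
      "(\<lambda>n. n * (1 / sqrt n) ^ 3 * (\<mu> n)\<^sup>2) \<longlonglongrightarrow> 0" "(\<lambda>n. n * (1 / n) * (1 / sqrt n)) \<longlonglongrightarrow> 0"
      "(\<lambda>n. n * (1 / n)\<^sup>2 * \<mu> n) \<longlonglongrightarrow> 0" "(\<lambda>n::nat. n * (1 / n)\<^sup>2) \<longlonglongrightarrow> (0 :: real)"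
      unfolding \<mu>_def using L by real_asymp+
    then show ?thesis unfolding B_eq
      by (intro tendsto_add_zero tendsto_mult_right_zero)
  qed
qed

end

section \<open>Gaussian orthant probabilities and Harris' inequality\<close>

lemma nn_integral_gaussian_first_moment:
  assumes "0 < c"
  shows "(\<integral>\<^sup>+x. ennreal (x * exp (- (c * x\<^sup>2) / 2)) * indicator {0..} x \<partial>lborel) = ennreal (1 / c)"
proof -
  have "(\<integral>\<^sup>+x. ennreal (x * exp (- (c * x\<^sup>2) / 2)) * indicator {0..} x \<partial>lborel)
    = ennreal (0 - - (exp (- (c * 0\<^sup>2) / 2) / c))"
  proof (rule nn_integral_FTC_atLeast)
    show "DERIV (\<lambda>x. - (exp (- (c * x\<^sup>2) / 2) / c)) x :> x * exp (- (c * x\<^sup>2) / 2)" for x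
      using assms by (auto intro!: derivative_eq_intros simp: field_simps power2_eq_square)
    show "((\<lambda>x. - (exp (- (c * x\<^sup>2) / 2) / c)) \<longlongrightarrow> 0) at_top"
      using assms by real_asymp
  qed auto
  then show ?thesis by simp
qed

lemma nn_integral_arctan_atLeast:
  assumes "0 < a" "0 < b"
  shows "(\<integral>\<^sup>+u. ennreal (a * b / (2 * pi * (b\<^sup>2 + (u * a)\<^sup>2))) * indicator {c..} u \<partial>lborel)
    = ennreal (1 / 4 - arctan (c * a / b) / (2 * pi))"
proof -
  have "(\<integral>\<^sup>+u. ennreal (a * b / (2 * pi * (b\<^sup>2 + (u * a)\<^sup>2))) * indicator {c..} u \<partial>lborel)
    = ennreal (pi / 2 / (2 * pi) - arctan (c * a / b) / (2 * pi))"
  proof (rule nn_integral_FTC_atLeast)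
    show "DERIV (\<lambda>u. arctan (u * a / b) / (2 * pi)) u :> a * b / (2 * pi * (b\<^sup>2 + (u * a)\<^sup>2))" for u
    proof -
      have "DERIV (\<lambda>u. arctan (u * a / b) / (2 * pi)) u :> inverse (1 + (u * a / b)\<^sup>2) * (a / b) / (2 * pi)"
        using assms by (auto intro!: derivative_eq_intros simp: mult_ac)
      moreover have "inverse (1 + (u * a / b)\<^sup>2) * (a / b) / (2 * pi) = a * b / (2 * pi * (b\<^sup>2 + (u * a)\<^sup>2))"
      proof -
        have "inverse (1 + (u * a / b)\<^sup>2) = b\<^sup>2 / (b\<^sup>2 + (u * a)\<^sup>2)"
          using assms by (simp add: power_divide field_simps)
        then show ?thesis using assms by (simp add: power2_eq_square mult_ac)
      qed
      ultimately show ?thesis by simp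
    qed
    have "filterlim (\<lambda>u. u * a / b) at_top at_top" using assms by real_asymp
    then have "((\<lambda>u. arctan (u * a / b)) \<longlongrightarrow> pi / 2) at_top"
      by (rule filterlim_compose[OF tendsto_arctan_at_top])
    then show "((\<lambda>u. arctan (u * a / b) / (2 * pi)) \<longlongrightarrow> pi / 2 / (2 * pi)) at_top"
      by (intro tendsto_divide) auto
    show "0 \<le> a * b / (2 * pi * (b\<^sup>2 + (u * a)\<^sup>2))" for u using assms by simp
  qed simp
  then show ?thesis by simp
qed

text \<open>Substituting \<open>y = u x\<close> in the joint density turns the inner integral into an elementary one.\<close>

lemma (in prob_space) gaussian_orthant_prob:
  assumes indep: "indep_var borel A borel U"
    and A: "distr M borel A = density lborel (normal_density 0 a)"
    and U: "distr M borel U = density lborel (normal_density 0 b)"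
    and pos: "0 < a" "0 < b"
  shows "prob {\<omega> \<in> space M. A \<omega> > 0 \<and> q * A \<omega> + U \<omega> > 0} = 1 / 4 + arctan (q * a / b) / (2 * pi)"
proof -
  let ?J = "\<lambda>x u. ennreal (normal_density 0 a x * normal_density 0 b (u * x) * x) * indicator {0<..} x * indicator {- q<..} u :: ennreal"
  let ?k = "\<lambda>u. a * b / (2 * pi * (b\<^sup>2 + (u * a)\<^sup>2))"
  have [measurable]: "A \<in> borel_measurable M" "U \<in> borel_measurable M"
    using indep by (auto dest: indep_var_rv1 indep_var_rv2)
  have dA: "distributed M lborel A (normal_density 0 a)" and dU: "distributed M lborel U (normal_density 0 b)"
    using A U by (auto simp: distributed_def cong: distr_cong)
  have "indep_var lborel A lborel U"
    using indep_var_compose[OF indep, of "\<lambda>x. x" lborel "\<lambda>x. x" lborel] by (simp add: comp_def)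
  then have dAU: "distributed M (lborel \<Otimes>\<^sub>M lborel) (\<lambda>x. (A x, U x)) (\<lambda>(x, y). ennreal (normal_density 0 a x) * ennreal (normal_density 0 b y))"
    by (intro distributed_joint_indep sigma_finite_lborel dA dU)
  define H where "H = {z :: real \<times> real. fst z > 0 \<and> q * fst z + snd z > 0}"
  have H[measurable]: "H \<in> sets (lborel \<Otimes>\<^sub>M lborel)"
  proof -
    have "{z \<in> space (borel \<Otimes>\<^sub>M borel). fst z > 0 \<and> q * fst z + snd z > 0} \<in> sets (borel \<Otimes>\<^sub>M (borel :: real measure))"
      by measurable
    then show ?thesis
      unfolding H_def by (subst sets_pair_measure_cong[OF sets_lborel sets_lborel]) (simp add: space_pair_measure)
  qed
  \<comment> \<open>After the substitution the exponent is \<open>- (w u * x\<^sup>2) / 2\<close>,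
    and the Jacobian contributes the factor \<open>x\<close> that makes the integrand in
    \<open>x\<close> a derivative.\<close>
  define w where "w u = 1 / a\<^sup>2 + u\<^sup>2 / b\<^sup>2" for u
  have w: "0 < w u" for u unfolding w_def using pos by (intro add_pos_nonneg) auto
  have "emeasure M ((\<lambda>x. (A x, U x)) -` H \<inter> space M)
    = (\<integral>\<^sup>+z. (case z of (x, y) \<Rightarrow> ennreal (normal_density 0 a x) * ennreal (normal_density 0 b y)) * indicator H z \<partial>(lborel \<Otimes>\<^sub>M lborel))"
    by (rule distributed_emeasure[OF dAU H])
  also have "\<dots> = (\<integral>\<^sup>+x. \<integral>\<^sup>+y. ennreal (normal_density 0 a x * normal_density 0 b y) * indicator H (x, y) \<partial>lborel \<partial>lborel)"
    by (subst lborel.nn_integral_fst[symmetric]) (auto simp: ennreal_mult')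
  also have "\<dots> = (\<integral>\<^sup>+x. \<integral>\<^sup>+u. ?J x u \<partial>lborel \<partial>lborel)"
  proof (rule nn_integral_cong)
    fix x :: real
    show "(\<integral>\<^sup>+y. ennreal (normal_density 0 a x * normal_density 0 b y) * indicator H (x, y) \<partial>lborel)
      = (\<integral>\<^sup>+u. ?J x u \<partial>lborel)"
    proof (cases "0 < x")
      case False then show ?thesis by (simp add: H_def)
    next
      case True
      have "(\<integral>\<^sup>+y. ennreal (normal_density 0 a x * normal_density 0 b y) * indicator H (x, y) \<partial>lborel)
        = ennreal \<bar>x\<bar> * (\<integral>\<^sup>+u. ennreal (normal_density 0 a x * normal_density 0 b (0 + x * u)) * indicator H (x, 0 + x * u) \<partial>lborel)"
        using True by (intro nn_integral_real_affine) auto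
      also have "\<dots> = (\<integral>\<^sup>+u. ennreal \<bar>x\<bar> * (ennreal (normal_density 0 a x * normal_density 0 b (0 + x * u)) * indicator H (x, 0 + x * u)) \<partial>lborel)"
        by (rule nn_integral_cmult[symmetric]) simp
      also have "\<dots> = (\<integral>\<^sup>+u. ?J x u \<partial>lborel)"
      proof (rule nn_integral_cong)
        fix u :: real
        have "q * x + x * u > 0 \<longleftrightarrow> u > - q"
        proof -
          have "q * x + x * u = x * (q + u)" by (simp add: algebra_simps)
          then show ?thesis using True by (auto simp: zero_less_mult_iff)
        qed
        then have "indicator H (x, 0 + x * u) = (indicator {- q<..} u :: ennreal)"
          using True by (auto simp: H_def indicator_def)
        then show "ennreal \<bar>x\<bar> * (ennreal (normal_density 0 a x * normal_density 0 b (0 + x * u)) * indicator H (x, 0 + x * u))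
          = ?J x u"
          using True by (simp add: ennreal_mult'' mult_ac)
      qed
      finally show ?thesis .
    qed
  qed
  also have "\<dots> = (\<integral>\<^sup>+u. \<integral>\<^sup>+x. ?J x u \<partial>lborel \<partial>lborel)"
    by (rule lborel_pair.Fubini') measurable
  also have "\<dots> = (\<integral>\<^sup>+u. ennreal (?k u) * indicator {- q<..} u \<partial>lborel)"
  proof (rule nn_integral_cong)
    fix u :: real
    have dens: "normal_density 0 a x * normal_density 0 b (u * x) = 1 / (2 * pi * a * b) * exp (- (w u * x\<^sup>2) / 2)" for x
    proof -
      have "sqrt (2 * pi * a\<^sup>2) * sqrt (2 * pi * b\<^sup>2) = 2 * pi * a * b"
      proof -
        have "sqrt (2 * pi * a\<^sup>2) * sqrt (2 * pi * b\<^sup>2) = sqrt ((2 * pi * a * b)\<^sup>2)"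
          unfolding real_sqrt_mult[symmetric] by (simp only: power2_eq_square mult_ac)
        then show ?thesis using pos by simp
      qed
      moreover have "exp (- (x\<^sup>2) / (2 * a\<^sup>2)) * exp (- ((u * x)\<^sup>2) / (2 * b\<^sup>2)) = exp (- (w u * x\<^sup>2) / 2)"
        unfolding exp_add[symmetric] w_def by (simp add: field_simps power_mult_distrib)
      ultimately show ?thesis unfolding normal_density_def by (simp add: field_simps)
    qed
    have "(\<integral>\<^sup>+x. ?J x u \<partial>lborel)
      = (\<integral>\<^sup>+x. (ennreal (1 / (2 * pi * a * b)) * indicator {- q<..} u) * (ennreal (x * exp (- (w u * x\<^sup>2) / 2)) * indicator {0..} x) \<partial>lborel)"
      unfolding dens using pos
      by (intro nn_integral_cong) (auto simp: indicator_def ennreal_mult[symmetric] mult_ac)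
    also have "\<dots> = (ennreal (1 / (2 * pi * a * b)) * indicator {- q<..} u) * ennreal (1 / w u)"
      by (subst nn_integral_cmult) (simp, simp only: nn_integral_gaussian_first_moment[OF w])
    also have "\<dots> = ennreal (1 / (2 * pi * a * b) * (1 / w u)) * indicator {- q<..} u"
      using pos w[of u] by (subst ennreal_mult) (simp, simp, simp only: mult_ac)
    also have "1 / (2 * pi * a * b) * (1 / w u) = ?k u"
    proof -
      have "w u = (b\<^sup>2 + (u * a)\<^sup>2) / (a\<^sup>2 * b\<^sup>2)" unfolding w_def using pos by (simp add: field_simps power_mult_distrib)
      then show ?thesis using pos by (simp add: power2_eq_square)
    qed
    finally show "(\<integral>\<^sup>+x. ?J x u \<partial>lborel)
      = ennreal (?k u) * indicator {- q<..} u" .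
  qed
  also have "\<dots> = (\<integral>\<^sup>+u. ennreal (?k u) * indicator {- q..} u \<partial>lborel)"
    by (intro nn_integral_cong_AE eventually_mono[OF AE_lborel_singleton[of "- q"]]) (auto simp: indicator_def)
  also have "\<dots> = ennreal (1 / 4 - arctan (- q * a / b) / (2 * pi))"
    by (rule nn_integral_arctan_atLeast[OF pos])
  also have "1 / 4 - arctan (- q * a / b) / (2 * pi) = 1 / 4 + arctan (q * a / b) / (2 * pi)"
    by (simp add: arctan_minus)
  finally have "emeasure M {\<omega> \<in> space M. A \<omega> > 0 \<and> q * A \<omega> + U \<omega> > 0} = ennreal (1 / 4 + arctan (q * a / b) / (2 * pi))"
    by (simp add: H_def vimage_def Int_def conj_commute conj_ac)
  moreover have "0 \<le> 1 / 4 + arctan (q * a / b) / (2 * pi)"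
    using arctan_lbound[of "q * a / b"] by (simp add: field_simps)
  ultimately show ?thesis by (simp add: measure_def)
qed

text \<open>Both functions increase, so some level \<open>a\<close> of \<open>f\<close> separates
  the points where \<open>g\<close> is below its mean from the rest, and
  \<open>(f x - a) * (g x - m)\<close> is nonnegative pointwise. Integrating removes
  \<open>a\<close>, because \<open>g - m\<close> has mean 0. This replaces the usual argument with
  an independent copy.\<close>

lemma chebyshev_association:
  fixes f g :: "real \<Rightarrow> real"
  assumes N: "prob_space N" and [measurable]: "f \<in> borel_measurable N" "g \<in> borel_measurable N"
    and bd: "\<And>x. 0 \<le> f x" "\<And>x. f x \<le> 1" "\<And>x. 0 \<le> g x" "\<And>x. g x \<le> 1"
    and mono: "mono f" "mono g"
  shows "(\<integral>x. f x \<partial>N) * (\<integral>x. g x \<partial>N) \<le> (\<integral>x. f x * g x \<partial>N)"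
proof -
  interpret prob_space N by fact
  define m where "m = (\<integral>x. g x \<partial>N)"
  \<comment> \<open>The default 0 serves the case that \<open>g\<close> is never below its mean;
    there \<open>f \<ge> 0\<close> suffices.\<close>
  define a where "a = (if \<exists>x. g x < m then Sup (f ` {x. g x < m}) else 0)"
  have sep: "0 \<le> (f x - a) * (g x - m)" for x
  proof (cases "\<exists>x. g x < m")
    case False
    then have "m \<le> g x" "a = 0" unfolding a_def by (simp add: not_less, rule if_not_P)
    then show ?thesis using bd by simp
  next
    case True
    then have a: "a = Sup (f ` {x. g x < m})" by (simp add: a_def)
    show ?thesis
    proof (cases "g x < m")
      case T: True
      have "f x \<le> a" unfolding a using T bd by (intro cSup_upper bdd_aboveI[where M=1]) auto
      then show ?thesis using T by (intro mult_nonpos_nonpos) auto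
    next
      case F: False
      have "a \<le> f x" unfolding a
      proof (rule cSup_least)
        fix v assume "v \<in> f ` {x. g x < m}"
        then obtain y where y: "v = f y" "g y < m" by auto
        have "y \<le> x" using y F monoD[OF mono(2), of x y] by linarith
        then show "v \<le> f x" using y monoD[OF mono(1)] by simp
      qed (use True in auto)
      then show ?thesis using F by (intro mult_nonneg_nonneg) auto
    qed
  qed
  have "f x * g x \<le> 1" for x by (intro mult_le_one bd)
  then have [simp]: "integrable N f" "integrable N g" "integrable N (\<lambda>x. f x * g x)"
    using bd by (auto intro!: integrable_const_bound[where B=1])
  have "0 \<le> (\<integral>x. (f x - a) * (g x - m) \<partial>N)" using sep by (intro integral_nonneg_AE) auto
  also have "\<dots> = (\<integral>x. f x * g x - m * f x - a * g x + a * m \<partial>N)"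
    by (intro Bochner_Integration.integral_cong refl) (simp add: algebra_simps)
  also have "\<dots> = (\<integral>x. f x * g x \<partial>N) - m * (\<integral>x. f x \<partial>N) - a * m + a * m"
    by (simp add: m_def prob_space)
  finally show ?thesis by (simp add: m_def mult.commute)
qed

text \<open>Induction on the index set: integrating out one coordinate preserves monotonicity.\<close>

lemma harris_inequality:
  fixes N :: "'i \<Rightarrow> real measure" and f g :: "('i \<Rightarrow> real) \<Rightarrow> real"
  assumes N: "\<And>i. prob_space (N i)" "\<And>i. sets (N i) = sets borel" and I: "finite I"
    and "f \<in> borel_measurable (PiM I N)" "g \<in> borel_measurable (PiM I N)"
    and "\<And>x. 0 \<le> f x \<and> f x \<le> 1" "\<And>x. 0 \<le> g x \<and> g x \<le> 1"
    and "\<And>x y. x \<in> extensional I \<Longrightarrow> y \<in> extensional I \<Longrightarrow> (\<And>i. i \<in> I \<Longrightarrow> x i \<le> y i) \<Longrightarrow> f x \<le> f y"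
    and "\<And>x y. x \<in> extensional I \<Longrightarrow> y \<in> extensional I \<Longrightarrow> (\<And>i. i \<in> I \<Longrightarrow> x i \<le> y i) \<Longrightarrow> g x \<le> g y"
  shows "(\<integral>x. f x \<partial>PiM I N) * (\<integral>x. g x \<partial>PiM I N) \<le> (\<integral>x. f x * g x \<partial>PiM I N)"
  using I assms(4-)
proof (induction I arbitrary: f g rule: finite_induct)
  case empty
  interpret product_prob_space N unfolding product_prob_space_def product_prob_space_axioms_def product_sigma_finite_def
    using N(1) by (auto intro: prob_space_imp_sigma_finite)
  show ?case by (simp add: PiM_empty lebesgue_integral_count_space_finite)
next
  case (insert i I)
  interpret product_prob_space N unfolding product_prob_space_def product_prob_space_axioms_def product_sigma_finite_def
    using N(1) by (auto intro: prob_space_imp_sigma_finite)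
  interpret I: prob_space "PiM I N" by (rule prob_space_PiM) (rule N)
  interpret iI: prob_space "PiM (insert i I) N" by (rule prob_space_PiM) (rule N)
  have spN: "space (N i) = UNIV" using sets_eq_imp_space_eq[OF N(2)[of i]] by simp
  note fg[measurable] = insert.prems(1,2)
  have upd[measurable]: "(\<lambda>(x, y). x(i := y)) \<in> measurable (PiM I N \<Otimes>\<^sub>M N i) (PiM (insert i I) N)"
    by (rule measurable_add_dim)
  have upd1: "(\<lambda>y. x(i := y)) \<in> measurable (N i) (PiM (insert i I) N)" if "x \<in> space (PiM I N)" for x
    using measurable_compose[OF measurable_Pair1' upd, OF that] by simp
  define f' where "f' x = (\<integral>y. f (x(i := y)) \<partial>N i)" for x
  define g' where "g' x = (\<integral>y. g (x(i := y)) \<partial>N i)" for x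
  have meas2: "(\<lambda>(x, y). h (x(i := y))) \<in> borel_measurable (PiM I N \<Otimes>\<^sub>M N i)"
    if "h \<in> borel_measurable (PiM (insert i I) N)" for h :: "_ \<Rightarrow> real"
    using measurable_compose[OF upd that] by (simp add: case_prod_unfold)
  have [measurable]: "f' \<in> borel_measurable (PiM I N)" "g' \<in> borel_measurable (PiM I N)"
    unfolding f'_def g'_def using meas2[OF fg(1)] meas2[OF fg(2)]
    by (auto intro!: M.borel_measurable_lebesgue_integral)
  have int1: "integrable (N i) (\<lambda>y. h (x(i := y)))" if "x \<in> space (PiM I N)"
    "h \<in> borel_measurable (PiM (insert i I) N)" "\<And>x. 0 \<le> h x \<and> h x \<le> 1" for h :: "_ \<Rightarrow> real" and x
    using that measurable_compose[OF upd1 that(2)] by (intro M.integrable_const_bound[where B=1]) auto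
  have spI: "space (PiM I N) = extensional I"
    using sets_eq_imp_space_eq[OF N(2)] by (simp add: space_PiM PiE_def)
  \<comment> \<open>Stated for all \<open>x\<close>: where the section of \<open>h\<close> is not
    integrable, its integral is 0 by convention and the bounds persist.\<close>
  have bd1: "0 \<le> (\<integral>y. h (x(i := y)) \<partial>N i) \<and> (\<integral>y. h (x(i := y)) \<partial>N i) \<le> 1" if "\<And>x. 0 \<le> h x \<and> h x \<le> 1"
    for h :: "_ \<Rightarrow> real" and x
  proof (cases "integrable (N i) (\<lambda>y. h (x(i := y)))")
    case True
    then show ?thesis using that by (auto intro!: integral_nonneg_AE M.integral_le_const)
  qed (simp add: not_integrable_integral_eq)
  have mono1: "(\<integral>y. h (x(i := y)) \<partial>N i) \<le> (\<integral>y. h (x'(i := y)) \<partial>N i)"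
    if "x \<in> extensional I" "x' \<in> extensional I" "\<And>j. j \<in> I \<Longrightarrow> x j \<le> x' j"
      "h \<in> borel_measurable (PiM (insert i I) N)" "\<And>x. 0 \<le> h x \<and> h x \<le> 1"
      "\<And>x y. x \<in> extensional (insert i I) \<Longrightarrow> y \<in> extensional (insert i I) \<Longrightarrow> (\<And>j. j \<in> insert i I \<Longrightarrow> x j \<le> y j) \<Longrightarrow> h x \<le> h y"
    for h :: "_ \<Rightarrow> real" and x x'
    using that insert.hyps(2) by (intro integral_mono int1 that(6)) (auto simp: spI extensional_def)
  have expand: "(\<integral>x. h x \<partial>PiM (insert i I) N) = (\<integral>x. (\<integral>y. h (x(i := y)) \<partial>N i) \<partial>PiM I N)"
    if "h \<in> borel_measurable (PiM (insert i I) N)" "\<And>x. 0 \<le> h x \<and> h x \<le> 1" for h :: "_ \<Rightarrow> real"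
    using insert.hyps that by (intro product_integral_insert iI.integrable_const_bound[where B=1]) auto
  have fg01: "0 \<le> f x * g x \<and> f x * g x \<le> 1" for x
    using insert.prems(3,4) by (auto intro: mult_le_one)
  have "(\<integral>x. f x \<partial>PiM (insert i I) N) * (\<integral>x. g x \<partial>PiM (insert i I) N) = (\<integral>x. f' x \<partial>PiM I N) * (\<integral>x. g' x \<partial>PiM I N)"
    using insert.prems(3,4) by (simp add: expand f'_def g'_def)
  also have "\<dots> \<le> (\<integral>x. f' x * g' x \<partial>PiM I N)"
  proof (rule insert.IH)
    show "0 \<le> f' x \<and> f' x \<le> 1" "0 \<le> g' x \<and> g' x \<le> 1" for x
      unfolding f'_def g'_def by (intro bd1 insert.prems)+
    show "f' x \<le> f' y" if "x \<in> extensional I" "y \<in> extensional I" "\<And>i. i \<in> I \<Longrightarrow> x i \<le> y i" for x y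
      unfolding f'_def by (rule mono1[OF that fg(1) insert.prems(3,5)])
    show "g' x \<le> g' y" if "x \<in> extensional I" "y \<in> extensional I" "\<And>i. i \<in> I \<Longrightarrow> x i \<le> y i" for x y
      unfolding g'_def by (rule mono1[OF that fg(2) insert.prems(4,6)])
  qed measurable
  \<comment> \<open>With the other coordinates fixed, both functions are monotone in coordinate
    \<open>i\<close>, so \<open>chebyshev_association\<close> applies under the outer
    integral.\<close>
  also have "\<dots> \<le> (\<integral>x. (\<integral>y. f (x(i := y)) * g (x(i := y)) \<partial>N i) \<partial>PiM I N)"
  proof (rule integral_mono)
    have "\<bar>f' x * g' x\<bar> \<le> 1" for x
      using bd1[of f x, OF insert.prems(3)] bd1[of g x, OF insert.prems(4)]
      unfolding f'_def[symmetric] g'_def[symmetric] by (auto simp: abs_mult intro!: mult_le_one)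
    then show "integrable (PiM I N) (\<lambda>x. f' x * g' x)"
      by (intro I.integrable_const_bound[where B=1]) auto
    have "(\<lambda>x. f x * g x) \<in> borel_measurable (PiM (insert i I) N)" by measurable
    from meas2[OF this] have "(\<lambda>x. \<integral>y. f (x(i := y)) * g (x(i := y)) \<partial>N i) \<in> borel_measurable (PiM I N)"
      by (auto intro!: M.borel_measurable_lebesgue_integral)
    then show "integrable (PiM I N) (\<lambda>x. \<integral>y. f (x(i := y)) * g (x(i := y)) \<partial>N i)"
      using bd1[of "\<lambda>x. f x * g x", OF fg01] by (intro I.integrable_const_bound[where B=1]) auto
    fix x assume x: "x \<in> space (PiM I N)"
    have m: "mono (\<lambda>y. h (x(i := y)))" if "\<And>x y. x \<in> extensional (insert i I) \<Longrightarrow> y \<in> extensional (insert i I) \<Longrightarrow> (\<And>j. j \<in> insert i I \<Longrightarrow> x j \<le> y j) \<Longrightarrow> h x \<le> h y"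
      for h :: "_ \<Rightarrow> real"
      using x by (intro monoI that) (auto simp: spI extensional_def)
    show "f' x * g' x \<le> (\<integral>y. f (x(i := y)) * g (x(i := y)) \<partial>N i)"
      unfolding f'_def g'_def
    proof (rule chebyshev_association[OF N(1) measurable_compose[OF upd1[OF x] fg(1)] measurable_compose[OF upd1[OF x] fg(2)]])
      show "mono (\<lambda>y. f (x(i := y)))" by (rule m[OF insert.prems(5)])
      show "mono (\<lambda>y. g (x(i := y)))" by (rule m[OF insert.prems(6)])
    qed (use insert.prems(3,4) in auto)
  qed
  also have "\<dots> = (\<integral>x. f x * g x \<partial>PiM (insert i I) N)"
    using fg01 by (subst expand) auto
  finally show ?case .
qed

section \<open>Gaussian AR(1) sequences\<close>

text \<open>Collects all that the limit theorems use of the Ornstein-Uhlenbeck process, in discrete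
  time: \<open>shift\<close> is its joint stationarity at integer times, and \<open>k\<close> is the
  lag of the estimator.\<close>

locale gaussian_AR1 = prob_space +
  fixes \<zeta> :: "nat \<Rightarrow> 'a \<Rightarrow> real" and X :: "nat \<Rightarrow> 'a \<Rightarrow> real" and \<rho> \<sigma> :: real and k :: nat
  assumes indep: "indep_vars (\<lambda>_. borel) \<zeta> UNIV"
    and X_0: "X 0 x = \<zeta> 0 x"
    and X_Suc: "X (Suc n) x = \<rho> * X n x + \<zeta> (Suc n) x"
    and \<rho>: "0 < \<rho>" "\<rho> < 1" and \<sigma>: "0 < \<sigma>"
    and X_normal: "distr M borel (X n) = density lborel (normal_density 0 \<sigma>)"
    and shift: "finite J \<Longrightarrow> distr M (PiM J (\<lambda>_. borel)) (\<lambda>x. \<lambda>j\<in>J. X (j + h) x) = distr M (PiM J (\<lambda>_. borel)) (\<lambda>x. \<lambda>j\<in>J. X j x)"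
    and k: "1 \<le> k"
begin

section \<open>The filtration of the noise and decoupling from the past\<close>

definition coords :: "nat set \<Rightarrow> 'a measure" where
  "coords I = vimage_algebra (space M) (\<lambda>x. \<lambda>j\<in>I. \<zeta> j x) (PiM I (\<lambda>_. borel))"

lemma \<zeta>_measurable[measurable]: "\<zeta> j \<in> borel_measurable M"
  using indep by (auto simp: indep_vars_def)

lemma space_coords[simp]: "space (coords I) = space M"
  by (simp add: coords_def)

lemma coords_sets: "sets (coords I) = {(\<lambda>x. \<lambda>j\<in>I. \<zeta> j x) -` A \<inter> space M |A. A \<in> sets (PiM I (\<lambda>_. borel))}"
  unfolding coords_def by (intro sets_vimage_algebra2) (auto simp: space_PiM)

lemma \<zeta>_coords: "j \<in> I \<Longrightarrow> \<zeta> j \<in> borel_measurable (coords I)"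
proof -
  assume j: "j \<in> I"
  have "(\<lambda>x. (\<lambda>j\<in>I. \<zeta> j x) j) \<in> borel_measurable (coords I)"
    unfolding coords_def
    by (rule measurable_compose[OF measurable_vimage_algebra1 measurable_component_singleton[OF j]]) (auto simp: space_PiM)
  then show ?thesis using j by simp
qed

lemma coords_mono:
  assumes "I \<subseteq> I'"
  shows "subalgebra (coords I') (coords I)"
proof -
  have "(\<lambda>x. \<lambda>j\<in>I. \<zeta> j x) \<in> measurable (coords I') (PiM I (\<lambda>_. borel))"
    using assms by (intro measurable_restrict \<zeta>_coords) auto
  from measurable_sets[OF this] show ?thesis
    unfolding subalgebra_def by (auto simp: coords_sets)
qed

lemma coords_M: "subalgebra M (coords I)"
proof -
  have "(\<lambda>x. \<lambda>j\<in>I. \<zeta> j x) \<in> measurable M (PiM I (\<lambda>_. borel))"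
    by (intro measurable_restrict) simp
  from measurable_sets[OF this] show ?thesis
    unfolding subalgebra_def by (auto simp: coords_sets)
qed

lemma X_coords: "n \<le> i \<Longrightarrow> X n \<in> borel_measurable (coords {..i})"
proof (induction n)
  case 0
  have "X 0 = \<zeta> 0" using X_0 by auto
  then show ?case using \<zeta>_coords[of 0 "{..i}"] by simp
next
  case (Suc n)
  have "X (Suc n) = (\<lambda>x. \<rho> * X n x + \<zeta> (Suc n) x)" using X_Suc by auto
  then show ?case using Suc \<zeta>_coords[of "Suc n" "{..i}"] by simp
qed

lemma X_measurable[measurable]: "X n \<in> borel_measurable M"
  using measurable_from_subalg[OF coords_M X_coords[OF order_refl]] .

text \<open>For \<open>i \<le> j\<close> this is the part of \<open>X j\<close> created after time
  \<open>i\<close>: the sum of \<open>\<rho> ^ (j - l) * \<zeta> l\<close> over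
  \<open>i < l \<le> j\<close>.\<close>

definition innov :: "nat \<Rightarrow> nat \<Rightarrow> 'a \<Rightarrow> real" where
  "innov i j x = X j x - \<rho> ^ (j - i) * X i x"

lemma innov_coords: "i \<le> j \<Longrightarrow> innov i j \<in> borel_measurable (coords {i<..})"
proof (induction j rule: dec_induct)
  case base
  then show ?case by (simp add: innov_def[abs_def])
next
  case (step j)
  have "innov i (Suc j) = (\<lambda>x. \<rho> * innov i j x + \<zeta> (Suc j) x)"
    using step(1) by (auto simp: innov_def X_Suc Suc_diff_le algebra_simps)
  then show ?case using step \<zeta>_coords[of "Suc j" "{i<..}"] by simp
qed

lemma indep_coords:
  assumes F: "F \<in> borel_measurable (coords I)" and G: "G \<in> borel_measurable (coords I')" and "I \<inter> I' = {}"
  shows "indep_var borel F borel (G :: _ \<Rightarrow> 'b :: topological_space)"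
proof -
  have "indep_var (PiM I (\<lambda>_. borel)) (\<lambda>x. restrict (\<lambda>i. \<zeta> i x) I) (PiM I' (\<lambda>_. borel)) (\<lambda>x. restrict (\<lambda>i. \<zeta> i x) I')"
    by (rule indep_var_restrict[OF indep]) (use assms in auto)
  then have "indep_set (sets (coords I)) (sets (coords I'))"
    unfolding indep_var_eq coords_def sets_vimage_algebra by simp
  then have ind: "\<And>a b. a \<in> sets (coords I) \<Longrightarrow> b \<in> sets (coords I') \<Longrightarrow> prob (a \<inter> b) = prob a * prob b"
    by (auto simp: indep_sets2_eq)
  have sub: "sigma_sets (space M) {H -` A \<inter> space M |A. A \<in> sets borel} \<subseteq> sets (coords I'')"
    if "H \<in> borel_measurable (coords I'')" for H :: "_ \<Rightarrow> 'b" and I''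
    using sets.sigma_sets_subset[of "{H -` A \<inter> space M |A. A \<in> sets borel}" "coords I''"] measurable_sets[OF that]
    by auto
  have "sets (coords I'') \<subseteq> events" for I'' using coords_M by (auto simp: subalgebra_def)
  then show ?thesis
    unfolding indep_var_eq indep_sets2_eq
    using sub[OF F] sub[OF G] ind measurable_from_subalg[OF coords_M F] measurable_from_subalg[OF coords_M G]
    by blast
qed

text \<open>\<open>F\<close> and \<open>G'\<close> live on disjoint coordinates, so the product rule
  is exact for \<open>G'\<close>; putting \<open>G\<close> back costs at most
  \<open>\<delta>\<close> in each of the two terms because \<open>F\<close> is bounded by 1.\<close>

lemma decouple:
  fixes F :: "'a \<Rightarrow> complex" and G G' :: "'a \<Rightarrow> real"
  assumes F: "F \<in> borel_measurable (coords {..i})" "\<And>x. cmod (F x) \<le> 1"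
    and G[measurable]: "G \<in> borel_measurable M" and G': "G' \<in> borel_measurable (coords {i<..})"
    and bd: "\<And>x. \<bar>G x\<bar> \<le> B" "\<And>x. \<bar>G' x\<bar> \<le> B"
    and le: "(\<integral>x. \<bar>G x - G' x\<bar> \<partial>M) \<le> \<delta>"
  shows "cmod ((\<integral>x. F x * G x \<partial>M) - (\<integral>x. F x \<partial>M) * (\<integral>x. G x \<partial>M)) \<le> 2 * \<delta>"
proof -
  have [measurable]: "F \<in> borel_measurable M" "G' \<in> borel_measurable M"
    using measurable_from_subalg[OF coords_M] F G' by blast+
  have iG: "integrable M G" "integrable M G'"
    by (rule integrable_const_bound[where B=B]; use bd in simp)+
  have iF: "integrable M F" by (rule integrable_const_bound[where B=1]) (use F in auto)
  have B: "0 \<le> B" using bd(1)[of undefined] by linarith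
  have iFG: "integrable M (\<lambda>x. F x * H x)" if [measurable]: "H \<in> borel_measurable M" and "\<And>x. \<bar>H x\<bar> \<le> b" for H :: "'a \<Rightarrow> real" and b
  proof (rule integrable_const_bound)
    have "cmod (F x) * \<bar>H x\<bar> \<le> 1 * b" for x by (intro mult_mono that F) auto
    then show "AE x in M. norm (F x * H x) \<le> b" by (simp add: norm_mult)
  qed simp
  have "indep_var borel F borel (\<lambda>x. complex_of_real (G' x))"
    by (rule indep_coords[OF F(1), where I'="{i<..}"]) (use G' in auto)
  then have prod: "(\<integral>x. F x * G' x \<partial>M) = (\<integral>x. F x \<partial>M) * (\<integral>x. G' x \<partial>M)"
    using iF iG by (subst indep_var_lebesgue_integral) auto
  have iD: "integrable M (\<lambda>x. \<bar>G x - G' x\<bar>)" using iG by auto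
  have "(\<integral>x. F x * G x \<partial>M) - (\<integral>x. F x \<partial>M) * (\<integral>x. G x \<partial>M)
    = (\<integral>x. F x * (G x - G' x) \<partial>M) - (\<integral>x. F x \<partial>M) * (\<integral>x. G x - G' x \<partial>M)"
    using iFG[OF _ bd(1)] iFG[OF _ bd(2)] iG prod by (simp add: algebra_simps)
  also have "cmod \<dots> \<le> cmod (\<integral>x. F x * (G x - G' x) \<partial>M) + cmod (\<integral>x. F x \<partial>M) * \<bar>\<integral>x. G x - G' x \<partial>M\<bar>"
    by (rule order.trans[OF norm_triangle_ineq4]) (simp only: norm_mult norm_of_real order_refl)
  also have "\<dots> \<le> \<delta> + 1 * \<delta>"
  proof (intro add_mono mult_mono)
    have "cmod (\<integral>x. F x * (G x - G' x) \<partial>M) \<le> (\<integral>x. \<bar>G x - G' x\<bar> \<partial>M)"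
    proof (rule norm_integral_le_integral[OF _ iD])
      have "\<bar>G x - G' x\<bar> \<le> 2 * B" for x using bd(1)[of x] bd(2)[of x] by linarith
      then show "integrable M (\<lambda>x. F x * complex_of_real (G x - G' x))" by (intro iFG) auto
      show "cmod (F x * complex_of_real (G x - G' x)) \<le> \<bar>G x - G' x\<bar>" for x
        unfolding norm_mult norm_of_real by (rule mult_left_le_one_le) (use F in auto)
    qed
    then show "cmod (\<integral>x. F x * (G x - G' x) \<partial>M) \<le> \<delta>" using le by linarith
    have "cmod (\<integral>x. F x \<partial>M) \<le> (\<integral>x. 1 \<partial>M)"
      by (rule norm_integral_le_integral) (use F iF in auto)
    then show "cmod (\<integral>x. F x \<partial>M) \<le> 1" by (simp add: prob_space)
    have "\<bar>\<integral>x. G x - G' x \<partial>M\<bar> \<le> (\<integral>x. \<bar>G x - G' x\<bar> \<partial>M)" by (rule integral_abs_bound)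
    then show "\<bar>\<integral>x. G x - G' x \<partial>M\<bar> \<le> \<delta>" using le by linarith
  qed auto
  finally show ?thesis by simp
qed

section \<open>The probability that removing the past changes a sign\<close>

definition r :: real where "r = sqrt \<rho>"

lemma r: "0 < r" "r < 1" "r\<^sup>2 = \<rho>"
  using \<rho> by (auto simp: r_def)

definition H :: real where "H = 1 / \<sigma> + \<sigma>\<^sup>2"

lemma H_pos: "0 < H" unfolding H_def using \<sigma> by (intro add_pos_pos) auto

lemma prob_small:
  assumes "0 < \<epsilon>"
  shows "prob {w \<in> space M. \<bar>X n w\<bar> \<le> \<epsilon>} \<le> \<epsilon> / \<sigma>"
proof -
  have prob_eq: "prob {w \<in> space M. \<bar>X n w\<bar> \<le> \<epsilon>} = measure (distr M borel (X n)) {-\<epsilon>..\<epsilon>}"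
    by (subst measure_distr) (auto intro!: arg_cong[where f=prob])
  have "emeasure (distr M borel (X n)) {-\<epsilon>..\<epsilon>} = (\<integral>\<^sup>+x. ennreal (normal_density 0 \<sigma> x) * indicator {-\<epsilon>..\<epsilon>} x \<partial>lborel)"
    unfolding X_normal by (subst emeasure_density) auto
  also have "\<dots> \<le> (\<integral>\<^sup>+x. ennreal (1 / (2 * \<sigma>)) * indicator {-\<epsilon>..\<epsilon>} x \<partial>lborel)"
  proof (intro nn_integral_mono mult_right_mono ennreal_leI)
    fix x
    have "2 = sqrt (2\<^sup>2)" by simp
    also have "\<dots> \<le> sqrt (2 * pi)" using pi_gt3 by (intro real_sqrt_le_mono) auto
    finally have s: "2 * \<sigma> \<le> sqrt (2 * pi * \<sigma>\<^sup>2)" using \<sigma> by (simp add: real_sqrt_mult)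
    have "normal_density 0 \<sigma> x \<le> 1 / sqrt (2 * pi * \<sigma>\<^sup>2) * 1"
      unfolding normal_density_def using \<sigma> by (intro mult_left_mono) auto
    also have "\<dots> \<le> 1 / (2 * \<sigma>)" using s \<sigma> by (simp add: frac_le)
    finally show "normal_density 0 \<sigma> x \<le> 1 / (2 * \<sigma>)" .
  qed simp
  also have "\<dots> = ennreal (1 / (2 * \<sigma>) * (2 * \<epsilon>))"
    using assms \<sigma> by (subst nn_integral_cmult_indicator) (auto simp: ennreal_mult[symmetric])
  finally have "emeasure (distr M borel (X n)) {-\<epsilon>..\<epsilon>} \<le> ennreal (\<epsilon> / \<sigma>)" by simp
  then have "measure (distr M borel (X n)) {-\<epsilon>..\<epsilon>} \<le> \<epsilon> / \<sigma>"
    using assms \<sigma> by (simp add: measure_def enn2real_leI)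
  with prob_eq show ?thesis by simp
qed

text \<open>Chebyshev's inequality yields \<open>\<epsilon>\<^sup>2 * \<sigma>\<^sup>2\<close>; one
  factor \<open>\<epsilon>\<close> is given away, since \<open>prob_small\<close> is only linear in
  \<open>\<epsilon>\<close>.\<close>

lemma prob_large:
  assumes "0 < \<epsilon>" "\<epsilon> \<le> 1"
  shows "prob {w \<in> space M. 1 / \<epsilon> \<le> \<bar>X n w\<bar>} \<le> \<epsilon> * \<sigma>\<^sup>2"
proof -
  have d: "distributed M lborel (X n) (normal_density 0 \<sigma>)"
    using X_normal by (auto simp: distributed_def cong: distr_cong)
  have E: "expectation (X n) = 0" by (rule normal_distributed_expectation[OF \<sigma> d])
  have V: "variance (X n) = \<sigma>\<^sup>2" by (rule normal_distributed_variance[OF \<sigma> d])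
  have "integrable lborel (\<lambda>x. normal_density 0 \<sigma> x * (x - 0) ^ 2)"
    by (rule integrable_normal_moment[OF \<sigma>])
  then have int: "integrable M (\<lambda>w. (X n w)\<^sup>2)"
    using distributed_integrable[OF d, of "\<lambda>x. x\<^sup>2"] by simp
  have "prob {w \<in> space M. 1 / \<epsilon> \<le> \<bar>X n w - expectation (X n)\<bar>} \<le> variance (X n) / (1 / \<epsilon>)\<^sup>2"
    by (rule Chebyshev_inequality) (use int assms in auto)
  then have "prob {w \<in> space M. 1 / \<epsilon> \<le> \<bar>X n w\<bar>} \<le> \<epsilon>\<^sup>2 * \<sigma>\<^sup>2"
    unfolding V unfolding E by (simp add: power_divide mult.commute)
  also have "\<dots> \<le> \<epsilon> * \<sigma>\<^sup>2" using assms by (intro mult_right_mono) (auto simp: power2_eq_square mult_left_le)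
  finally show ?thesis .
qed

text \<open>The decay \<open>\<rho> ^ (j - i) = \<epsilon> * \<epsilon>\<close> is shared equally:
  \<open>\<bar>X j\<bar> \<le> \<epsilon> * \<epsilon> * \<bar>X i\<bar>\<close> forces
  \<open>\<bar>X j\<bar> \<le> \<epsilon>\<close> or
  \<open>\<bar>X i\<bar> \<ge> 1 / \<epsilon>\<close>, and each event has probability of order
  \<open>\<epsilon>\<close>. This is the origin of the rate \<open>r = sqrt \<rho>\<close>.\<close>

lemma prob_sign_change:
  assumes "i \<le> j"
  shows "prob {x \<in> space M. \<bar>X j x\<bar> \<le> \<rho> ^ (j - i) * \<bar>X i x\<bar>} \<le> H * r ^ (j - i)"
proof -
  define \<epsilon> where "\<epsilon> = r ^ (j - i)"
  have \<epsilon>: "0 < \<epsilon>" "\<epsilon> \<le> 1" using r by (auto simp: \<epsilon>_def power_le_one)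
  have "r * r = \<rho>" using r(3) by (simp only: power2_eq_square)
  then have \<rho>\<epsilon>: "\<rho> ^ (j - i) = \<epsilon> * \<epsilon>" unfolding \<epsilon>_def power_mult_distrib[symmetric] by simp
  have "prob {x \<in> space M. \<bar>X j x\<bar> \<le> \<rho> ^ (j - i) * \<bar>X i x\<bar>}
    \<le> prob ({x \<in> space M. \<bar>X j x\<bar> \<le> \<epsilon>} \<union> {x \<in> space M. 1 / \<epsilon> \<le> \<bar>X i x\<bar>})"
  proof (rule finite_measure_mono)
    show "{x \<in> space M. \<bar>X j x\<bar> \<le> \<rho> ^ (j - i) * \<bar>X i x\<bar>}
      \<subseteq> {x \<in> space M. \<bar>X j x\<bar> \<le> \<epsilon>} \<union> {x \<in> space M. 1 / \<epsilon> \<le> \<bar>X i x\<bar>}"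
    proof safe
      fix x assume a: "\<bar>X j x\<bar> \<le> \<rho> ^ (j - i) * \<bar>X i x\<bar>" "\<not> 1 / \<epsilon> \<le> \<bar>X i x\<bar>"
      then have "\<epsilon> * \<bar>X i x\<bar> \<le> 1" using \<epsilon> by (simp add: field_simps)
      then have "\<epsilon> * (\<epsilon> * \<bar>X i x\<bar>) \<le> \<epsilon> * 1" using \<epsilon> by (intro mult_left_mono) auto
      then show "\<bar>X j x\<bar> \<le> \<epsilon>" using a(1) unfolding \<rho>\<epsilon> by simp
    qed
  qed measurable
  also have "\<dots> \<le> prob {x \<in> space M. \<bar>X j x\<bar> \<le> \<epsilon>} + prob {x \<in> space M. 1 / \<epsilon> \<le> \<bar>X i x\<bar>}"
    by (rule measure_Un_le) measurable
  also have "\<dots> \<le> \<epsilon> / \<sigma> + \<epsilon> * \<sigma>\<^sup>2" by (intro add_mono prob_small prob_large \<epsilon>)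
  finally show ?thesis by (simp add: H_def \<epsilon>_def algebra_simps)
qed

section \<open>Orthant indicators, their approximations and covariances\<close>

definition Y :: "nat \<Rightarrow> 'a \<Rightarrow> real" where "Y j x = of_bool (X j x > 0 \<and> X (j + k) x > 0)"

definition p :: real where "p = prob {x \<in> space M. X 0 x > 0 \<and> X k x > 0}"

definition Z :: "nat \<Rightarrow> 'a \<Rightarrow> real" where "Z j x = Y j x - p"

definition Z' :: "nat \<Rightarrow> nat \<Rightarrow> 'a \<Rightarrow> real" where
  "Z' i j x = of_bool (innov i j x > 0 \<and> innov i (j + k) x > 0) - p"

definition cc :: "nat \<Rightarrow> real" where
  "cc l = prob {x \<in> space M. X (k + l) x > 0 \<and> X l x > 0 \<and> X k x > 0 \<and> X 0 x > 0} - p\<^sup>2"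

lemma p01: "0 \<le> p" "p \<le> 1" by (auto simp: p_def)

lemma Z_le: "\<bar>Z j x\<bar> \<le> 1" using p01 by (auto simp: Z_def Y_def)

lemma Z'_le: "\<bar>Z' i j x\<bar> \<le> 1" using p01 by (auto simp: Z'_def)

lemma Y_coords: "j + k \<le> i \<Longrightarrow> Y j \<in> borel_measurable (coords {..i})"
proof -
  assume "j + k \<le> i"
  then have [measurable]: "X j \<in> borel_measurable (coords {..i})" "X (j + k) \<in> borel_measurable (coords {..i})"
    by (auto intro: X_coords)
  show ?thesis unfolding Y_def by measurable
qed

lemma Y_measurable[measurable]: "Y j \<in> borel_measurable M"
  unfolding Y_def by measurable

lemma Z_measurable[measurable]: "Z j \<in> borel_measurable M"
  unfolding Z_def by measurable

lemma Z'_coords: "i \<le> j \<Longrightarrow> Z' i j \<in> borel_measurable (coords {i<..})"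
proof -
  assume "i \<le> j"
  then have [measurable]: "innov i j \<in> borel_measurable (coords {i<..})" "innov i (j + k) \<in> borel_measurable (coords {i<..})"
    by (auto intro: innov_coords)
  show ?thesis unfolding Z'_def by measurable
qed

lemma Z'_measurable[measurable]: "Z' i j \<in> borel_measurable M"
  unfolding Z'_def innov_def by measurable

lemma sign_agree: "\<not> \<bar>x\<bar> \<le> \<bar>y\<bar> \<Longrightarrow> x - y > 0 \<longleftrightarrow> x > 0" for x y :: real
  by auto

text \<open>\<open>innov i j\<close> differs from \<open>X j\<close> by
  \<open>\<rho> ^ (j - i) * X i\<close> and so has the same sign off the event of
  \<open>prob_sign_change\<close>. One such event for \<open>j\<close> and one for
  \<open>j + k\<close> account for the factor 2.\<close>

lemma Z_approx:
  assumes "i \<le> j"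
  shows "(\<integral>x. \<bar>Z j x - Z' i j x\<bar> \<partial>M) \<le> 2 * H * r ^ (j - i)"
proof -
  define E where "E j = {x \<in> space M. \<bar>X j x\<bar> \<le> \<rho> ^ (j - i) * \<bar>X i x\<bar>}" for j
  have [measurable]: "E j \<in> events" for j unfolding E_def by measurable
  have [simp]: "integrable M (indicat_real (E j))" for j
    by (rule integrable_const_bound[where B=1]) (auto simp: indicator_def)
  have "(\<integral>x. \<bar>Z j x - Z' i j x\<bar> \<partial>M) \<le> (\<integral>x. indicator (E j) x + indicator (E (j + k)) x \<partial>M)"
  proof (rule integral_mono)
    have "\<bar>Z j x - Z' i j x\<bar> \<le> 1" for x by (auto simp: Z_def Z'_def Y_def)
    then show "integrable M (\<lambda>x. \<bar>Z j x - Z' i j x\<bar>)" by (intro integrable_const_bound[where B=1]) auto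
    fix x assume x: "x \<in> space M"
    show "\<bar>Z j x - Z' i j x\<bar> \<le> indicator (E j) x + indicator (E (j + k)) x"
    proof (cases "x \<in> E j \<or> x \<in> E (j + k)")
      case True
      then show ?thesis by (auto simp: Z_def Z'_def Y_def indicator_def)
    next
      case False
      then have "innov i j' x > 0 \<longleftrightarrow> X j' x > 0" if "j' \<in> {j, j + k}" for j'
        using that x \<rho> unfolding innov_def by (intro sign_agree) (auto simp: E_def abs_mult)
      then show ?thesis by (auto simp: Z_def Z'_def Y_def)
    qed
  qed auto
  also have "\<dots> = prob (E j) + prob (E (j + k))" by simp
  also have "\<dots> \<le> H * r ^ (j - i) + H * r ^ (j + k - i)"
    unfolding E_def using assms by (intro add_mono prob_sign_change) auto
  also have "\<dots> \<le> H * r ^ (j - i) + H * r ^ (j - i)"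
    using H_pos r by (intro add_mono mult_left_mono power_decreasing) auto
  finally show ?thesis by simp
qed

lemma shift_prob:
  assumes "finite J" and "\<And>j. j \<in> J \<Longrightarrow> f j \<in> sets borel"
  shows "prob {x \<in> space M. \<forall>j\<in>J. X (j + h) x \<in> f j} = prob {x \<in> space M. \<forall>j\<in>J. X j x \<in> f j}"
proof -
  have S: "Pi\<^sub>E J f \<in> sets (PiM J (\<lambda>_. borel))"
    using assms by (intro sets_PiM_I_finite) auto
  have "prob {x \<in> space M. \<forall>j\<in>J. X (j + h) x \<in> f j} = measure (distr M (PiM J (\<lambda>_. borel)) (\<lambda>x. \<lambda>j\<in>J. X (j + h) x)) (Pi\<^sub>E J f)" for h
    by (subst measure_distr[OF _ S]) (auto intro!: arg_cong[where f=prob] measurable_restrict)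
  from this[of h] this[of 0] show ?thesis using shift[OF assms(1), of h] by simp
qed

lemma integral_of_bool: "{x \<in> space M. P x} \<in> events \<Longrightarrow> (\<integral>x. of_bool (P x) \<partial>M) = prob {x \<in> space M. P x}"
proof -
  assume "{x \<in> space M. P x} \<in> events"
  then have "prob {x \<in> space M. P x} = (\<integral>x. indicator {x \<in> space M. P x} x \<partial>M)" by simp
  also have "\<dots> = (\<integral>x. of_bool (P x) \<partial>M)"
    by (intro Bochner_Integration.integral_cong) (auto simp: indicator_def)
  finally show ?thesis ..
qed

lemma integrable_YY[simp]: "integrable M (Y i)" "integrable M (\<lambda>x. Y i x * Y j x)"
  by (auto intro!: integrable_const_bound[where B=1] simp: Y_def)

lemma EY: "(\<integral>x. Y j x \<partial>M) = p"
proof -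
  have "(\<integral>x. Y j x \<partial>M) = prob {x \<in> space M. X j x > 0 \<and> X (j + k) x > 0}"
    unfolding Y_def by (rule integral_of_bool) measurable
  also have "\<dots> = p"
    using shift_prob[of "{0, k}" "\<lambda>_. {0<..}" j] by (simp add: p_def add.commute)
  finally show ?thesis .
qed

lemma EYY: "(\<integral>x. Y j x * Y (j + l) x \<partial>M) = cc l + p\<^sup>2"
proof -
  have "(\<integral>x. Y j x * Y (j + l) x \<partial>M) = (\<integral>x. of_bool (X j x > 0 \<and> X (j + k) x > 0 \<and> X (j + l) x > 0 \<and> X (j + l + k) x > 0) \<partial>M)"
    unfolding Y_def by (intro Bochner_Integration.integral_cong) auto
  also have "\<dots> = prob {x \<in> space M. X j x > 0 \<and> X (j + k) x > 0 \<and> X (j + l) x > 0 \<and> X (j + l + k) x > 0}"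
    by (rule integral_of_bool) measurable
  also have "\<dots> = cc l + p\<^sup>2"
    using shift_prob[of "{0, k, l, l + k}" "\<lambda>_. {0<..}" j]
    by (simp add: cc_def add.commute add.left_commute conj_ac)
  finally show ?thesis .
qed

lemma EZ: "(\<integral>x. Z j x \<partial>M) = 0"
  unfolding Z_def by (simp add: EY prob_space)

lemma EZZ: "(\<integral>x. Z j x * Z (j + l) x \<partial>M) = cc l"
proof -
  have "(\<integral>x. Z j x * Z (j + l) x \<partial>M) = (\<integral>x. Y j x * Y (j + l) x - p * Y j x - p * Y (j + l) x + p * p \<partial>M)"
    unfolding Z_def by (intro Bochner_Integration.integral_cong) (auto simp: algebra_simps)
  then show ?thesis by (simp add: EY EYY prob_space power2_eq_square)
qed

lemma cc_0: "cc 0 = p * (1 - p)"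
  by (simp add: cc_def p_def[symmetric] conj_ac power2_eq_square algebra_simps)

text \<open>\<open>8 * H\<close> is twice the approximation error \<open>4 * H\<close> of a pair,
  \<open>+ 2\<close> makes room for the trivial bound 2 when the gap is too short, and division by
  \<open>r ^ k\<close> converts a gap counted from \<open>i + k\<close> into one counted from
  \<open>i\<close>.\<close>

definition KK :: real where "KK = (8 * H + 2) / r ^ k"

lemma KK_le: "2 * (4 * H * r ^ (j - (i + k))) \<le> KK * r ^ (j - i)" if "i + k \<le> j"
proof -
  have "r ^ (j - i) = r ^ (j - (i + k)) * r ^ k" using that by (simp add: power_add[symmetric])
  then show ?thesis unfolding KK_def using r by (simp add: field_simps)
qed

lemma KK_trivial: "2 \<le> KK * r ^ (j - i)" if "j < i + k"
proof -
  have "r ^ k \<le> r ^ (j - i)" using r that by (intro power_decreasing) auto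
  then have "2 * r ^ k \<le> (8 * H + 2) * r ^ (j - i)" using H_pos r by (intro mult_mono) auto
  then show ?thesis unfolding KK_def using r by (simp add: field_simps)
qed

text \<open>\<open>Z i\<close> looks ahead to \<open>X (i + k)\<close>, so the past at index
  \<open>i\<close> has to be \<open>coords {..i + k}\<close>. Decoupling therefore starts at
  \<open>j = i + k\<close>, and the indices before that rely on \<open>KK_trivial\<close>.\<close>

lemma weakly_dependent: "weakly_dependent M (\<lambda>i. coords {..i + k}) Z KK r cc"
proof
  fix i j :: nat
  show "subalgebra M (coords {..i + k})" by (rule coords_M)
  show "subalgebra (coords {..j + k}) (coords {..i + k})" if "i \<le> j" using that by (intro coords_mono) auto
  show "Z j \<in> borel_measurable (coords {..j + k})"
    using Y_coords[of j "j + k"] unfolding Z_def by measurable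
  show "\<bar>Z j x\<bar> \<le> 1" for x by (rule Z_le)
  show "0 < r" "r < 1" by (rule r)+
  show "0 \<le> KK" unfolding KK_def using r H_pos by simp
  show "(\<integral>x. Z j x * Z (j + l) x \<partial>M) = cc l" for l by (rule EZZ)
  fix F :: "'a \<Rightarrow> complex"
  assume ij: "i \<le> j" and F: "F \<in> borel_measurable (coords {..i + k})" "\<And>x. cmod (F x) \<le> 1"
  have FM[measurable]: "F \<in> borel_measurable M" by (rule measurable_from_subalg[OF coords_M F(1)])
  have bd: "cmod (\<integral>x. F x * G x \<partial>M) \<le> 1" if "\<And>x. \<bar>G x\<bar> \<le> 1" and [measurable]: "G \<in> borel_measurable M" for G :: "'a \<Rightarrow> real"
  proof -
    have le: "cmod (F x * G x) \<le> 1" for x using F(2) that(1) by (auto simp: norm_mult intro: mult_le_one)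
    have "cmod (\<integral>x. F x * G x \<partial>M) \<le> (\<integral>x. 1 \<partial>M)"
      by (rule norm_integral_le_integral) (use le in \<open>auto intro!: integrable_const_bound[where B=1]\<close>)
    then show ?thesis by (simp add: prob_space)
  qed
  have ZZ_le: "\<bar>Z a x * Z b x\<bar> \<le> 1" for a b x by (auto simp: abs_mult intro!: mult_le_one Z_le)
  show "cmod (\<integral>x. F x * of_real (Z j x) \<partial>M) \<le> KK * r ^ (j - i)"
  proof (cases "i + k \<le> j")
    case False
    then show ?thesis using KK_trivial[of j i] bd[of "Z j"] Z_le by force
  next
    case True
    have "cmod ((\<integral>x. F x * Z j x \<partial>M) - (\<integral>x. F x \<partial>M) * (\<integral>x. Z j x \<partial>M)) \<le> 2 * (2 * H * r ^ (j - (i + k)))"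
      by (rule decouple[OF F _ Z'_coords[OF True] Z_le Z'_le Z_approx[OF True]]) simp
    also have "\<dots> \<le> 2 * (4 * H * r ^ (j - (i + k)))" using H_pos r by (intro mult_left_mono mult_right_mono) auto
    also have "\<dots> \<le> KK * r ^ (j - i)" by (rule KK_le[OF True])
    finally show ?thesis by (simp add: EZ)
  qed
  fix l
  show "cmod ((\<integral>x. F x * of_real (Z j x * Z (j + l) x) \<partial>M) - (\<integral>x. F x \<partial>M) * of_real (cc l)) \<le> KK * r ^ (j - i)"
  proof (cases "i + k \<le> j")
    case False
    have "cmod (\<integral>x. F x * of_real (Z j x * Z (j + l) x) \<partial>M) \<le> 1" by (rule bd[OF ZZ_le]) simp
    moreover have "cmod ((\<integral>x. F x \<partial>M) * of_real (cc l)) \<le> 1"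
    proof -
      have "\<bar>cc l\<bar> \<le> 1"
      proof -
        have "\<bar>cc l\<bar> \<le> (\<integral>x. \<bar>Z 0 x * Z (0 + l) x\<bar> \<partial>M)" unfolding EZZ[symmetric, of l 0] by (rule integral_abs_bound)
        also have "\<dots> \<le> (\<integral>x. 1 \<partial>M)"
          by (rule integral_mono) (use ZZ_le in \<open>auto intro!: integrable_const_bound[where B=1]\<close>)
        finally show ?thesis by (simp add: prob_space)
      qed
      moreover have "cmod (\<integral>x. F x \<partial>M) \<le> 1" using bd[of "\<lambda>_. 1"] by simp
      ultimately show ?thesis by (auto simp: norm_mult intro: mult_le_one)
    qed
    ultimately have "cmod ((\<integral>x. F x * of_real (Z j x * Z (j + l) x) \<partial>M) - (\<integral>x. F x \<partial>M) * of_real (cc l)) \<le> 1 + 1"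
      by (intro order.trans[OF norm_triangle_ineq4] add_mono)
    then show ?thesis using KK_trivial[of j i] False by linarith
  next
    case True
    let ?d = "\<lambda>m x. \<bar>Z m x - Z' (i + k) m x\<bar>"
    let ?D = "\<lambda>x. \<bar>Z j x * Z (j + l) x - Z' (i + k) j x * Z' (i + k) (j + l) x\<bar>"
    let ?r = "r ^ (j - (i + k))"
    have jl: "i + k \<le> j + l" using True by simp
    have iZ: "integrable M (\<lambda>x. ?d m x)" for m
    proof -
      have "?d m x \<le> 1" for x by (auto simp: Z_def Z'_def Y_def)
      then show ?thesis by (intro integrable_const_bound[where B=1]) auto
    qed
    \<comment> \<open>For products of variables bounded by 1 the approximation errors add:
      \<open>a * b - a' * b' = (a - a') * b + a' * (b - b')\<close>.\<close>
    have "(\<integral>x. ?D x \<partial>M)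
      \<le> (\<integral>x. ?d j x + ?d (j + l) x \<partial>M)"
    proof (rule integral_mono)
      have "?D x \<le> 2" for x
      proof -
        have "\<bar>Z' (i + k) j x * Z' (i + k) (j + l) x\<bar> \<le> 1" by (auto simp: abs_mult intro!: mult_le_one Z'_le)
        then show ?thesis using ZZ_le[of j x "j + l"] by linarith
      qed
      then show "integrable M (\<lambda>x. ?D x)"
        by (intro integrable_const_bound[where B=2]) auto
      show "integrable M (\<lambda>x. ?d j x + ?d (j + l) x)"
        by (intro Bochner_Integration.integrable_add iZ)
      fix x
      have "Z j x * Z (j + l) x - Z' (i + k) j x * Z' (i + k) (j + l) x
        = (Z j x - Z' (i + k) j x) * Z (j + l) x + Z' (i + k) j x * (Z (j + l) x - Z' (i + k) (j + l) x)"
        by (simp add: algebra_simps)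
      also have "\<bar>\<dots>\<bar> \<le> ?d j x * \<bar>Z (j + l) x\<bar> + \<bar>Z' (i + k) j x\<bar> * ?d (j + l) x"
        unfolding abs_mult[symmetric] by (rule abs_triangle_ineq)
      also have "\<dots> \<le> ?d j x + ?d (j + l) x"
        by (intro add_mono mult_right_le_one_le mult_left_le_one_le Z_le Z'_le) auto
      finally show "?D x
        \<le> ?d j x + ?d (j + l) x" .
    qed
    also have "\<dots> = (\<integral>x. ?d j x \<partial>M) + (\<integral>x. ?d (j + l) x \<partial>M)"
      by (intro Bochner_Integration.integral_add iZ)
    also have "\<dots> \<le> 2 * H * ?r + 2 * H * r ^ (j + l - (i + k))"
      by (intro add_mono Z_approx True jl)
    also have "\<dots> \<le> 2 * H * ?r + 2 * H * ?r"
      using H_pos r by (intro add_mono mult_left_mono power_decreasing) auto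
    finally have le: "(\<integral>x. ?D x \<partial>M) \<le> 4 * H * ?r"
      by simp
    have "cmod ((\<integral>x. F x * complex_of_real (Z j x * Z (j + l) x) \<partial>M) - (\<integral>x. F x \<partial>M) * (\<integral>x. Z j x * Z (j + l) x \<partial>M)) \<le> 2 * (4 * H * ?r)"
    proof (rule decouple[OF F])
      show "(\<lambda>x. Z' (i + k) j x * Z' (i + k) (j + l) x) \<in> borel_measurable (coords {i + k<..})"
        by (intro borel_measurable_times Z'_coords True jl)
      show "\<bar>Z j x * Z (j + l) x\<bar> \<le> 1" for x by (rule ZZ_le)
      show "\<bar>Z' (i + k) j x * Z' (i + k) (j + l) x\<bar> \<le> 1" for x by (auto simp: abs_mult intro!: mult_le_one Z'_le)
    qed (use le in auto)
    also have "\<dots> \<le> KK * r ^ (j - i)" by (rule KK_le[OF True])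
    finally show ?thesis by (simp add: EZZ)
  qed
qed

lemma X_expand: "X n x = (\<Sum>i\<le>n. \<rho> ^ (n - i) * \<zeta> i x)"
proof (induction n)
  case 0 then show ?case by (simp add: X_0)
next
  case (Suc n)
  have "(\<Sum>i\<le>n. \<rho> ^ (Suc n - i) * \<zeta> i x) = \<rho> * (\<Sum>i\<le>n. \<rho> ^ (n - i) * \<zeta> i x)"
    unfolding sum_distrib_left by (intro sum.cong) (auto simp: Suc_diff_le mult.assoc)
  then show ?case by (simp add: X_Suc Suc)
qed

text \<open>In \<open>X_expand\<close> all coefficients \<open>\<rho> ^ (n - i)\<close> are
  positive, so every orthant indicator is a nondecreasing function of the independent noise
  terms.\<close>

lemma cc_nonneg: "0 \<le> cc l"
proof -
  define I where "I = {..k + l}"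
  define N where "N i = distr M borel (\<zeta> i)" for i
  define x where "x n g = (\<Sum>i\<le>n. \<rho> ^ (n - i) * (g i :: real))" for n g
  define f where "f g = (of_bool (x 0 g > 0 \<and> x k g > 0) :: real)" for g
  define h where "h g = (of_bool (x l g > 0 \<and> x (k + l) g > 0) :: real)" for g
  have N: "prob_space (N i)" "sets (N i) = sets borel" for i
    by (auto simp: N_def intro: prob_space_distr)
  have PN: "distr M (PiM I (\<lambda>_. borel)) (\<lambda>w. \<lambda>i\<in>I. \<zeta> i w) = PiM I N"
    unfolding N_def using indep_vars_subset[OF indep, of I]
    by (subst indep_vars_iff_distr_eq_PiM'[symmetric]) (auto simp: I_def)
  have sPN: "sets (PiM I N) = sets (PiM I (\<lambda>_. borel))" by (intro sets_PiM_cong) (auto simp: N)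
  have xm: "x n \<in> borel_measurable (PiM I (\<lambda>_. borel))" if "n \<le> k + l" for n
  proof -
    have [measurable]: "i \<le> n \<Longrightarrow> (\<lambda>g. g i) \<in> borel_measurable (PiM I (\<lambda>_. borel))" for i
      using that by (intro measurable_component_singleton) (auto simp: I_def)
    show ?thesis unfolding x_def by (auto intro!: borel_measurable_sum)
  qed
  have x_mono: "x n g \<le> x n g'" if "n \<le> k + l" "\<And>i. i \<in> I \<Longrightarrow> g i \<le> g' i" for n g g'
    unfolding x_def using that \<rho> by (intro sum_mono mult_left_mono) (auto simp: I_def)
  note [measurable] = xm[of 0, simplified] xm[of k, simplified] xm[of l, simplified] xm[of "k + l", simplified]
  have fm[measurable]: "f \<in> borel_measurable (PiM I (\<lambda>_. borel))" "h \<in> borel_measurable (PiM I (\<lambda>_. borel))"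
    unfolding f_def h_def by measurable
  have tr: "(\<integral>g. q g \<partial>PiM I N) = (\<integral>w. q (\<lambda>i\<in>I. \<zeta> i w) \<partial>M)" if "q \<in> borel_measurable (PiM I (\<lambda>_. borel))" for q :: "_ \<Rightarrow> real"
    unfolding PN[symmetric] by (rule integral_distr[OF _ that]) (auto intro!: measurable_restrict)
  have xX: "x n (\<lambda>i\<in>I. \<zeta> i w) = X n w" if "n \<le> k + l" for n w
    unfolding x_def X_expand using that by (intro sum.cong) (auto simp: I_def)
  have fh: "f (\<lambda>i\<in>I. \<zeta> i w) = Y 0 w" "h (\<lambda>i\<in>I. \<zeta> i w) = Y l w" for w
    unfolding f_def h_def Y_def by (simp_all add: xX add.commute)
  have "(\<integral>g. f g \<partial>PiM I N) * (\<integral>g. h g \<partial>PiM I N) \<le> (\<integral>g. f g * h g \<partial>PiM I N)"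
  proof (rule harris_inequality[OF N])
    show "finite I" by (simp add: I_def)
    show "f \<in> borel_measurable (PiM I N)" "h \<in> borel_measurable (PiM I N)"
      using fm by (auto simp: measurable_cong_sets[OF sPN refl])
    show "f g \<le> f g'" if "\<And>i. i \<in> I \<Longrightarrow> g i \<le> g' i" for g g'
    proof -
      have "x 0 g \<le> x 0 g'" "x k g \<le> x k g'" by (rule x_mono; simp add: that)+
      then show ?thesis by (auto simp: f_def)
    qed
    show "h g \<le> h g'" if "\<And>i. i \<in> I \<Longrightarrow> g i \<le> g' i" for g g'
    proof -
      have "x l g \<le> x l g'" "x (k + l) g \<le> x (k + l) g'" by (rule x_mono; simp add: that)+
      then show ?thesis by (auto simp: h_def)
    qed
  qed (auto simp: f_def h_def)
  then have "(\<integral>w. Y 0 w \<partial>M) * (\<integral>w. Y l w \<partial>M) \<le> (\<integral>w. Y 0 w * Y (0 + l) w \<partial>M)"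
    by (simp add: tr fh)
  then show ?thesis unfolding EY EYY by (simp add: power2_eq_square)
qed

text \<open>The law of \<open>innov 0 k\<close> is found by division:
  \<open>X k = \<rho> ^ k * X 0 + innov 0 k\<close> with independent summands, and the
  characteristic function of a normal law never vanishes. In the orthant formula
  \<open>\<sigma>\<close> cancels and the argument of the arctangent becomes
  \<open>q / sqrt (1 - q\<^sup>2)\<close>, the tangent of the angle with sine
  \<open>q = \<rho> ^ k\<close>.\<close>

lemma orthant: "1 / 4 < p" "p < 1 / 2" "sin (2 * pi * (p - 1 / 4)) = \<rho> ^ k"
proof -
  define q where "q = \<rho> ^ k"
  have q: "0 < q" "q < 1" using \<rho> k by (auto simp: q_def power_less_one_iff)
  define b where "b = \<sigma> * sqrt (1 - q\<^sup>2)"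
  have q2: "0 < 1 - q\<^sup>2" using q by (simp add: power_less_one_iff abs_square_less_1)
  then have b: "0 < b" using \<sigma> by (simp add: b_def)
  have b2: "b\<^sup>2 = \<sigma>\<^sup>2 * (1 - q\<^sup>2)" using q2 by (simp add: b_def power_mult_distrib)
  have U: "innov 0 k = (\<lambda>w. X k w - q * X 0 w)" by (auto simp: innov_def q_def)
  have [measurable]: "innov 0 k \<in> borel_measurable M" unfolding U by measurable
  have ind: "indep_var borel (X 0) borel (innov 0 k)"
    by (rule indep_coords[OF X_coords[OF order_refl] innov_coords[of 0]]) auto
  have ind': "indep_var borel (\<lambda>w. q * X 0 w) borel (innov 0 k)"
  proof -
    have "indep_var borel ((\<lambda>x. q * x) \<circ> X 0) borel ((\<lambda>x. x) \<circ> innov 0 k)"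
      by (rule indep_var_compose[OF ind]) auto
    then show ?thesis unfolding comp_def .
  qed
  have char_X: "char (distr M borel (X n)) t = exp (- (\<sigma>\<^sup>2 * t\<^sup>2) / 2)" for n t
    unfolding X_normal by (rule char_normal[OF \<sigma>])
  have "char (distr M borel (innov 0 k)) t = exp (- (b\<^sup>2 * t\<^sup>2) / 2)" for t
  proof -
    have "char (distr M borel (\<lambda>w. q * X 0 w)) t = char (distr M borel (X 0)) (q * t)"
      unfolding char_def by (simp add: integral_distr mult_ac)
    then have "complex_of_real (exp (- (\<sigma>\<^sup>2 * t\<^sup>2) / 2)) = exp (- (\<sigma>\<^sup>2 * (q * t)\<^sup>2) / 2) * char (distr M borel (innov 0 k)) t"
      using char_distr_add[OF ind', of t] by (simp add: U char_X)
    moreover have "exp (- (\<sigma>\<^sup>2 * t\<^sup>2) / 2) = exp (- (\<sigma>\<^sup>2 * (q * t)\<^sup>2) / 2) * exp (- (b\<^sup>2 * t\<^sup>2) / 2)"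
      unfolding exp_add[symmetric] b2 by (simp add: field_simps power_mult_distrib)
    ultimately show ?thesis by simp
  qed
  then have dU: "distr M borel (innov 0 k) = density lborel (normal_density 0 b)"
    by (intro Levy_uniqueness real_distribution_normal b) (auto simp: fun_eq_iff char_normal[OF b])
  define c where "c = q * \<sigma> / b"
  have c: "0 < c" using q \<sigma> b by (simp add: c_def)
  have "p = prob {w \<in> space M. X 0 w > 0 \<and> q * X 0 w + innov 0 k w > 0}"
    by (simp add: p_def U)
  also have "\<dots> = 1 / 4 + arctan c / (2 * pi)"
    unfolding c_def by (rule gaussian_orthant_prob[OF ind X_normal dU \<sigma> b])
  finally have p: "p = 1 / 4 + arctan c / (2 * pi)" .
  show "1 / 4 < p" using c by (simp add: p)
  show "p < 1 / 2" using arctan_ubound[of c] by (simp add: p field_simps)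
  have c_eq: "c = q / sqrt (1 - q\<^sup>2)" using \<sigma> by (simp add: c_def b_def)
  have "c\<^sup>2 = q\<^sup>2 / (1 - q\<^sup>2)" unfolding c_eq using q2 by (simp add: power_divide)
  then have "1 + c\<^sup>2 = 1 / (1 - q\<^sup>2)" using q2 by (simp add: field_simps)
  then have "sqrt (1 + c\<^sup>2) = 1 / sqrt (1 - q\<^sup>2)" by (simp add: real_sqrt_divide)
  then have "sin (arctan c) = q" using q2 unfolding sin_arctan by (simp add: c_eq)
  then show "sin (2 * pi * (p - 1 / 4)) = \<rho> ^ k" by (simp add: p q_def)
qed

end

section \<open>The delta method\<close>

text \<open>Outside \<open>{\<bar>P n - p\<bar> < \<delta>}\<close> only the crude bound \<open>L n\<close> on \<open>G\<close> is available; it may grow,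
  as long as the probability of that event compensates for it.\<close>

locale delta_method = prob_space +
  fixes P :: "nat \<Rightarrow> 'a \<Rightarrow> real" and G :: "real \<Rightarrow> real" and p D v :: real and L :: "nat \<Rightarrow> real"
  assumes P_measurable[measurable]: "P n \<in> borel_measurable M"
    and GP_measurable[measurable]: "(\<lambda>x. G (P n x)) \<in> borel_measurable M"
    and P_bound: "\<bar>P n x - p\<bar> \<le> 2"
    and G_bound: "\<bar>G (P n x)\<bar> \<le> L n"
    and G_deriv: "(G has_real_derivative D) (at p)"
    and second: "(\<lambda>n. real n * (\<integral>x. (P n x - p)\<^sup>2 \<partial>M)) \<longlonglongrightarrow> v"
    and first: "(\<lambda>n. sqrt (real n) * (\<integral>x. P n x - p \<partial>M)) \<longlonglongrightarrow> 0"
    and tail: "0 < \<delta> \<Longrightarrow> (\<lambda>n. real n * (L n + C)\<^sup>2 * prob {x \<in> space M. \<bar>P n x - p\<bar> \<ge> \<delta>}) \<longlonglongrightarrow> 0"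
begin

definition Q :: "nat \<Rightarrow> 'a \<Rightarrow> real" where "Q n x = G (P n x) - G p - D * (P n x - p)"

lemma Q_measurable[measurable]: "Q n \<in> borel_measurable M"
  unfolding Q_def by measurable

definition C0 :: real where "C0 = \<bar>G p\<bar> + 2 * \<bar>D\<bar>"

lemma Q_bound: "\<bar>Q n x\<bar> \<le> L n + C0"
proof -
  have "\<bar>D * (P n x - p)\<bar> \<le> \<bar>D\<bar> * 2" unfolding abs_mult by (intro mult_left_mono P_bound) auto
  then show ?thesis unfolding Q_def C0_def using G_bound[of n x] by linarith
qed

lemma integrable_bdd:
  "f \<in> borel_measurable M \<Longrightarrow> (\<And>x. \<bar>f x\<bar> \<le> B) \<Longrightarrow> integrable M (f :: 'a \<Rightarrow> real)"
  by (rule integrable_const_bound[where B=B]) auto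

lemma integrables[simp]: "integrable M (Q n)" "integrable M (\<lambda>x. (Q n x)\<^sup>2)" "integrable M (\<lambda>x. \<bar>Q n x\<bar>)"
  "integrable M (P n)" "integrable M (\<lambda>x. (P n x - p)\<^sup>2)" "integrable M (\<lambda>x. (P n x - p) * Q n x)"
  "integrable M (\<lambda>x. G (P n x))" "integrable M (\<lambda>x. (G (P n x))\<^sup>2)"
proof -
  show "integrable M (Q n)" by (rule integrable_bdd[OF _ Q_bound]) simp
  then show "integrable M (\<lambda>x. \<bar>Q n x\<bar>)" by simp
  show "integrable M (\<lambda>x. (Q n x)\<^sup>2)"
    by (rule integrable_bdd[where B="(L n + C0)\<^sup>2"]) (use power_mono[OF Q_bound, of _ _ 2] in auto)
  have "integrable M (\<lambda>x. (P n x - p) + p)"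
    by (intro Bochner_Integration.integrable_add integrable_bdd[OF _ P_bound[of n]]) auto
  then show "integrable M (P n)" by simp
  show "integrable M (\<lambda>x. (P n x - p)\<^sup>2)"
    by (rule integrable_bdd[where B="2\<^sup>2"]) (use power_mono[OF P_bound, of _ _ 2] in auto)
  show "integrable M (\<lambda>x. (P n x - p) * Q n x)"
  proof (rule integrable_bdd)
    show "\<bar>(P n x - p) * Q n x\<bar> \<le> 2 * (L n + C0)" for x
      unfolding abs_mult by (intro mult_mono P_bound Q_bound) auto
  qed simp
  show "integrable M (\<lambda>x. G (P n x))" by (rule integrable_bdd[OF _ G_bound]) simp
  show "integrable M (\<lambda>x. (G (P n x))\<^sup>2)"
    by (rule integrable_bdd[where B="(L n)\<^sup>2"]) (use power_mono[OF G_bound, of _ _ 2] in auto)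
qed

lemma v_nonneg: "0 \<le> v"
  by (rule LIMSEQ_le_const[OF second]) (auto intro!: mult_nonneg_nonneg integral_nonneg_AE)

text \<open>Near \<open>p\<close> differentiability gives
  \<open>\<bar>Q n x\<bar> \<le> \<epsilon> * \<bar>P n x - p\<bar>\<close>, which contributes at
  most \<open>\<epsilon>\<^sup>2 * v\<close> in the limit; away from \<open>p\<close> the crude
  bound on \<open>Q\<close> is paid for by \<open>tail\<close>.\<close>

lemma remainder: "(\<lambda>n. real n * (\<integral>w. (Q n w)\<^sup>2 \<partial>M)) \<longlonglongrightarrow> 0"
proof (rule LIMSEQ_I)
  fix e :: real assume e: "0 < e"
  \<comment> \<open>Chosen so that \<open>\<epsilon>\<^sup>2 * v \<le> e / 2\<close>;
    \<open>v + 1\<close> avoids division by zero, as \<open>v\<close> is only known to be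
    nonnegative here.\<close>
  define \<epsilon> where "\<epsilon> = sqrt (e / (2 * (v + 1)))"
  have \<epsilon>: "0 < \<epsilon>" "\<epsilon>\<^sup>2 = e / (2 * (v + 1))" using e v_nonneg by (auto simp: \<epsilon>_def)
  obtain \<delta> where \<delta>: "0 < \<delta>" "\<And>x. \<bar>x - p\<bar> < \<delta> \<Longrightarrow> \<bar>G x - G p - D * (x - p)\<bar> \<le> \<epsilon> * \<bar>x - p\<bar>"
  proof -
    have "(G has_derivative (*) D) (at p)" using G_deriv by (simp add: has_field_derivative_def)
    then obtain d where "0 < d" "\<And>x. norm (x - p) < d \<Longrightarrow> norm (G x - G p - D * (x - p)) \<le> \<epsilon> * norm (x - p)"
      unfolding has_derivative_at_alt using \<epsilon>(1) by blast
    then show ?thesis using that by auto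
  qed
  define E where "E n = {w \<in> space M. \<bar>P n w - p\<bar> \<ge> \<delta>}" for n
  have [measurable]: "E n \<in> events" for n unfolding E_def by measurable
  have [simp]: "integrable M (indicat_real (E n))" for n
    by (rule integrable_const_bound[where B=1]) (auto simp: indicator_def)
  have bound: "real n * (\<integral>w. (Q n w)\<^sup>2 \<partial>M) \<le> \<epsilon>\<^sup>2 * (real n * (\<integral>w. (P n w - p)\<^sup>2 \<partial>M)) + real n * (L n + C0)\<^sup>2 * prob (E n)" for n
  proof -
    have "(\<integral>w. (Q n w)\<^sup>2 \<partial>M) \<le> (\<integral>w. \<epsilon>\<^sup>2 * (P n w - p)\<^sup>2 + (L n + C0)\<^sup>2 * indicator (E n) w \<partial>M)"
    proof (rule integral_mono)
      fix w assume w: "w \<in> space M"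
      show "(Q n w)\<^sup>2 \<le> \<epsilon>\<^sup>2 * (P n w - p)\<^sup>2 + (L n + C0)\<^sup>2 * indicator (E n) w"
      proof (cases "w \<in> E n")
        case True
        then show ?thesis using power_mono[OF Q_bound[of n w], of 2] by (auto intro: add_increasing)
      next
        case False
        then have "\<bar>Q n w\<bar> \<le> \<epsilon> * \<bar>P n w - p\<bar>" unfolding Q_def using w by (intro \<delta>(2)) (auto simp: E_def)
        then have "\<bar>Q n w\<bar>\<^sup>2 \<le> (\<epsilon> * \<bar>P n w - p\<bar>)\<^sup>2" by (intro power_mono) auto
        then show ?thesis using False by (simp add: power_mult_distrib)
      qed
    qed auto
    also have "\<dots> = \<epsilon>\<^sup>2 * (\<integral>w. (P n w - p)\<^sup>2 \<partial>M) + (L n + C0)\<^sup>2 * prob (E n)"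
      by (subst Bochner_Integration.integral_add) auto
    finally show ?thesis using mult_left_mono[of _ _ "real n"] by (fastforce simp: algebra_simps)
  qed
  have lim: "(\<lambda>n. \<epsilon>\<^sup>2 * (real n * (\<integral>w. (P n w - p)\<^sup>2 \<partial>M)) + real n * (L n + C0)\<^sup>2 * prob (E n)) \<longlonglongrightarrow> \<epsilon>\<^sup>2 * v + 0"
    unfolding E_def by (intro tendsto_add tendsto_mult_left second tail \<delta>)
  have "\<epsilon>\<^sup>2 * v + 0 < e"
  proof -
    have "\<epsilon>\<^sup>2 * v \<le> \<epsilon>\<^sup>2 * (v + 1)" by (intro mult_left_mono) auto
    also have "\<dots> = e / 2" unfolding \<epsilon>(2) using v_nonneg by (simp add: field_simps)
    finally show ?thesis using e by simp
  qed
  then have "eventually (\<lambda>n. \<epsilon>\<^sup>2 * (real n * (\<integral>w. (P n w - p)\<^sup>2 \<partial>M)) + real n * (L n + C0)\<^sup>2 * prob (E n) < e) sequentially"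
    by (rule order_tendstoD(2)[OF lim])
  then have "eventually (\<lambda>n. norm (real n * (\<integral>w. (Q n w)\<^sup>2 \<partial>M) - 0) < e) sequentially"
  proof eventually_elim
    case (elim n)
    have "0 \<le> real n * (\<integral>w. (Q n w)\<^sup>2 \<partial>M)" by (intro mult_nonneg_nonneg integral_nonneg_AE) auto
    then show ?case using elim bound[of n] by simp
  qed
  then show "\<exists>no. \<forall>n\<ge>no. norm (real n * (\<integral>w. (Q n w)\<^sup>2 \<partial>M) - 0) < e"
    unfolding eventually_sequentially .
qed

lemma remainder_abs: "(\<lambda>n. sqrt (real n) * (\<integral>x. \<bar>Q n x\<bar> \<partial>M)) \<longlonglongrightarrow> 0"
proof (rule Lim_null_comparison)
  show "eventually (\<lambda>n. norm (sqrt (real n) * (\<integral>x. \<bar>Q n x\<bar> \<partial>M)) \<le> sqrt (real n * (\<integral>x. (Q n x)\<^sup>2 \<partial>M))) sequentially"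
  proof (rule always_eventually, rule allI)
    fix n
    \<comment> \<open>Nonnegativity of this variance plays the role of the Cauchy-Schwarz
      inequality.\<close>
    have "0 \<le> variance (\<lambda>x. \<bar>Q n x\<bar>)" by (rule variance_positive)
    also have "\<dots> = (\<integral>x. (Q n x)\<^sup>2 \<partial>M) - (\<integral>x. \<bar>Q n x\<bar> \<partial>M)\<^sup>2" by (subst variance_eq) auto
    finally have "\<bar>\<integral>x. \<bar>Q n x\<bar> \<partial>M\<bar> \<le> sqrt (\<integral>x. (Q n x)\<^sup>2 \<partial>M)" by (intro real_le_rsqrt) auto
    then show "norm (sqrt (real n) * (\<integral>x. \<bar>Q n x\<bar> \<partial>M)) \<le> sqrt (real n * (\<integral>x. (Q n x)\<^sup>2 \<partial>M))"
      by (simp add: abs_mult real_sqrt_mult mult_left_mono)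
  qed
  show "(\<lambda>n. sqrt (real n * (\<integral>x. (Q n x)\<^sup>2 \<partial>M))) \<longlonglongrightarrow> 0"
    using tendsto_real_sqrt[OF remainder] by simp
qed

text \<open>A weighted arithmetic-geometric inequality: the scaled second moment \<open>a n\<close>
  of \<open>P n - p\<close> converges and that of \<open>Q n\<close>, called \<open>q n\<close>,
  vanishes, so a weight of size \<open>sqrt (q n)\<close> makes both resulting terms vanish.\<close>

lemma remainder_cross: "(\<lambda>n. real n * (\<integral>w. (P n w - p) * Q n w \<partial>M)) \<longlonglongrightarrow> 0"
proof (rule Lim_null_comparison)
  define a where "a n = real n * (\<integral>w. (P n w - p)\<^sup>2 \<partial>M)" for n
  define q where "q n = real n * (\<integral>w. (Q n w)\<^sup>2 \<partial>M)" for n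
  \<comment> \<open>The summand \<open>1 / Suc n\<close> keeps the weight positive where
    \<open>q n = 0\<close>.\<close>
  define \<eta> where "\<eta> n = sqrt (q n) + 1 / real (Suc n)" for n
  have q: "0 \<le> q n" for n unfolding q_def by (intro mult_nonneg_nonneg integral_nonneg_AE) auto
  have \<eta>: "0 < \<eta> n" for n unfolding \<eta>_def using q by (intro add_nonneg_pos) auto
  show "eventually (\<lambda>n. norm (real n * (\<integral>w. (P n w - p) * Q n w \<partial>M)) \<le> \<eta> n * a n + sqrt (q n)) sequentially"
  proof (rule always_eventually, rule allI)
    fix n
    have am: "\<bar>x * y\<bar> \<le> \<eta> n * x\<^sup>2 + y\<^sup>2 / \<eta> n" for x y
    proof -
      have "2 * (sqrt (\<eta> n) * \<bar>x\<bar>) * (\<bar>y\<bar> / sqrt (\<eta> n)) \<le> (sqrt (\<eta> n) * \<bar>x\<bar>)\<^sup>2 + (\<bar>y\<bar> / sqrt (\<eta> n))\<^sup>2"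
        by (rule sum_squares_bound)
      also have "2 * (sqrt (\<eta> n) * \<bar>x\<bar>) * (\<bar>y\<bar> / sqrt (\<eta> n)) = 2 * \<bar>x * y\<bar>" using \<eta>[of n] by (simp add: abs_mult)
      finally show ?thesis using \<eta>[of n] by (simp add: power_mult_distrib power_divide)
    qed
    have "\<bar>\<integral>w. (P n w - p) * Q n w \<partial>M\<bar> \<le> (\<integral>w. \<bar>(P n w - p) * Q n w\<bar> \<partial>M)" by (rule integral_abs_bound)
    also have "\<dots> \<le> (\<integral>w. \<eta> n * (P n w - p)\<^sup>2 + (Q n w)\<^sup>2 / \<eta> n \<partial>M)"
      by (rule integral_mono) (auto intro!: am)
    also have "\<dots> = \<eta> n * (\<integral>w. (P n w - p)\<^sup>2 \<partial>M) + (\<integral>w. (Q n w)\<^sup>2 \<partial>M) / \<eta> n"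
      by (subst Bochner_Integration.integral_add) auto
    finally have "real n * \<bar>\<integral>w. (P n w - p) * Q n w \<partial>M\<bar> \<le> real n * (\<eta> n * (\<integral>w. (P n w - p)\<^sup>2 \<partial>M) + (\<integral>w. (Q n w)\<^sup>2 \<partial>M) / \<eta> n)"
      by (rule mult_left_mono) simp
    also have "\<dots> = \<eta> n * a n + q n / \<eta> n" by (simp add: a_def q_def algebra_simps)
    also have "q n / \<eta> n \<le> sqrt (q n)"
    proof -
      have "q n = sqrt (q n) * sqrt (q n)" using q[of n] by simp
      also have "\<dots> \<le> sqrt (q n) * \<eta> n" using q[of n] by (intro mult_left_mono) (auto simp: \<eta>_def)
      finally show ?thesis using \<eta>[of n] by (simp add: divide_le_eq)
    qed
    finally show "norm (real n * (\<integral>w. (P n w - p) * Q n w \<partial>M)) \<le> \<eta> n * a n + sqrt (q n)"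
      by (simp add: abs_mult)
  qed
  have sq: "(\<lambda>n. sqrt (q n)) \<longlonglongrightarrow> 0" using tendsto_real_sqrt[OF remainder] by (simp add: q_def)
  have "(\<lambda>n. \<eta> n * a n + sqrt (q n)) \<longlonglongrightarrow> (0 + 0) * v + 0"
    unfolding \<eta>_def a_def by (intro tendsto_add tendsto_mult sq second LIMSEQ_Suc[OF lim_1_over_n])
  then show "(\<lambda>n. \<eta> n * a n + sqrt (q n)) \<longlonglongrightarrow> 0" by simp
qed

text \<open>The expansion is around \<open>G p\<close> instead of the mean. The price is the squared
  bias, and \<open>n\<close> times it is the square of \<open>sqrt n\<close> times the bias, which
  vanishes by \<open>first\<close> and \<open>remainder_abs\<close>.\<close>

lemma scaled_variance: "(\<lambda>n. real n * variance (\<lambda>x. G (P n x))) \<longlonglongrightarrow> D\<^sup>2 * v"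
proof -
  define A where "A n x = P n x - p" for n x
  have [simp]: "integrable M (A n)" for n unfolding A_def by simp
  have [simp]: "integrable M (\<lambda>x. (A n x)\<^sup>2)" "integrable M (\<lambda>x. A n x * Q n x)" for n unfolding A_def by simp_all
  have GA: "G (P n x) - G p = D * A n x + Q n x" for n x by (simp add: A_def Q_def)
  have var: "variance (\<lambda>x. G (P n x)) = (\<integral>x. (G (P n x) - G p)\<^sup>2 \<partial>M) - (\<integral>x. G (P n x) - G p \<partial>M)\<^sup>2" for n
  proof -
    have "(\<lambda>x. (G (P n x) - G p)\<^sup>2) = (\<lambda>x. (G (P n x))\<^sup>2 - 2 * G p * G (P n x) + (G p)\<^sup>2)"
      by (auto simp: power2_diff algebra_simps)
    then have "integrable M (\<lambda>x. (G (P n x) - G p)\<^sup>2)" by simp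
    then have "variance (\<lambda>x. G (P n x) - G p) = (\<integral>x. (G (P n x) - G p)\<^sup>2 \<partial>M) - (\<integral>x. G (P n x) - G p \<partial>M)\<^sup>2"
      by (intro variance_eq) auto
    then show ?thesis by (simp add: prob_space)
  qed
  have "(\<integral>x. (G (P n x) - G p)\<^sup>2 \<partial>M) = (\<integral>x. D\<^sup>2 * (A n x)\<^sup>2 + 2 * D * (A n x * Q n x) + (Q n x)\<^sup>2 \<partial>M)" for n
    unfolding GA by (intro Bochner_Integration.integral_cong) (auto simp: power2_sum power_mult_distrib)
  then have E2: "(\<integral>x. (G (P n x) - G p)\<^sup>2 \<partial>M) = D\<^sup>2 * (\<integral>x. (A n x)\<^sup>2 \<partial>M) + 2 * D * (\<integral>x. A n x * Q n x \<partial>M) + (\<integral>x. (Q n x)\<^sup>2 \<partial>M)" for n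
    by simp
  have E1: "(\<integral>x. G (P n x) - G p \<partial>M) = D * (\<integral>x. A n x \<partial>M) + (\<integral>x. Q n x \<partial>M)" for n
    unfolding GA by simp
  have EQ: "(\<lambda>n. sqrt (real n) * (\<integral>x. Q n x \<partial>M)) \<longlonglongrightarrow> 0"
  proof (rule Lim_null_comparison[OF always_eventually remainder_abs], rule allI)
    fix n
    show "norm (sqrt (real n) * (\<integral>x. Q n x \<partial>M)) \<le> sqrt (real n) * (\<integral>x. \<bar>Q n x\<bar> \<partial>M)"
      unfolding real_norm_def abs_mult by (simp add: mult_left_mono integral_abs_bound)
  qed
  have eq: "real n * variance (\<lambda>x. G (P n x)) = D\<^sup>2 * (real n * (\<integral>x. (A n x)\<^sup>2 \<partial>M)) + 2 * D * (real n * (\<integral>x. A n x * Q n x \<partial>M))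
      + real n * (\<integral>x. (Q n x)\<^sup>2 \<partial>M) - (D * (sqrt (real n) * (\<integral>x. A n x \<partial>M)) + sqrt (real n) * (\<integral>x. Q n x \<partial>M))\<^sup>2" for n
  proof -
    have "(D * (sqrt (real n) * a) + sqrt (real n) * b)\<^sup>2 = (sqrt (real n))\<^sup>2 * (D * a + b)\<^sup>2" for a b
      unfolding power_mult_distrib[symmetric] by (simp add: algebra_simps)
    then have "(D * (sqrt (real n) * a) + sqrt (real n) * b)\<^sup>2 = real n * (D * a + b)\<^sup>2" for a b by simp
    then show ?thesis unfolding var E1 E2 by (simp only:) (simp add: algebra_simps)
  qed
  have "(\<lambda>n. real n * variance (\<lambda>x. G (P n x))) \<longlonglongrightarrow> D\<^sup>2 * v + 2 * D * 0 + 0 - (D * 0 + 0)\<^sup>2"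
    unfolding eq using second first remainder remainder_cross EQ unfolding A_def
    by (intro tendsto_intros)
  then show ?thesis by simp
qed

text \<open>Slutsky's lemma for characteristic functions: linearising \<open>G\<close> changes the
  value at \<open>t\<close> by at most \<open>\<bar>t\<bar> * sqrt n\<close> times the expectation
  of \<open>\<bar>Q n\<bar>\<close>.\<close>

lemma char_limit:
  assumes "(\<lambda>n. char (distr M borel (\<lambda>x. sqrt (real n) * (P n x - p))) (D * t)) \<longlonglongrightarrow> c"
  shows "(\<lambda>n. char (distr M borel (\<lambda>x. sqrt (real n) * (G (P n x) - G p))) t) \<longlonglongrightarrow> c"
proof -
  let ?a = "\<lambda>n. char (distr M borel (\<lambda>x. sqrt (real n) * (P n x - p))) (D * t)"
  let ?b = "\<lambda>n. char (distr M borel (\<lambda>x. sqrt (real n) * (G (P n x) - G p))) t"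
  have "(\<lambda>n. ?b n - ?a n) \<longlonglongrightarrow> 0"
  proof (rule Lim_null_comparison[OF always_eventually tendsto_mult_right_zero[OF remainder_abs]], rule allI)
    fix n
    have "cmod (?b n - ?a n) \<le> (\<integral>x. \<bar>t\<bar> * (sqrt (real n) * \<bar>Q n x\<bar>) \<partial>M)"
    proof (subst (1 2) char_distr)
      have "t * (sqrt (real n) * (G (P n x) - G p)) - D * t * (sqrt (real n) * (P n x - p)) = t * (sqrt (real n) * Q n x)" for x
        by (simp add: Q_def algebra_simps)
      then show "cmod ((\<integral>x. iexp (t * (sqrt (real n) * (G (P n x) - G p))) \<partial>M) - (\<integral>x. iexp (D * t * (sqrt (real n) * (P n x - p))) \<partial>M))
          \<le> (\<integral>x. \<bar>t\<bar> * (sqrt (real n) * \<bar>Q n x\<bar>) \<partial>M)"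
        by (intro cmod_integral_iexp_diff_le) (simp_all add: abs_mult)
    qed simp_all
    then show "norm (?b n - ?a n) \<le> \<bar>t\<bar> * (sqrt (real n) * (\<integral>x. \<bar>Q n x\<bar> \<partial>M))" by simp
  qed
  from tendsto_add[OF this assms] show ?thesis by simp
qed

end

section \<open>The estimators\<close>

text \<open>A weak form of Jordan's inequality by half angles: with \<open>z = y / 2\<close>,
  \<open>sin y = tan z * (1 + cos y)\<close>, where \<open>z \<le> tan z\<close> and
  \<open>1 + cos y \<ge> 1\<close>.\<close>

lemma sin_ge_half:
  assumes "0 \<le> y" "y < pi / 2"
  shows "y / 2 \<le> sin y"
proof -
  define z where "z = y / 2"
  have z: "0 \<le> z" "z < pi / 2" "y = 2 * z" using assms pi_gt_zero unfolding z_def by linarith+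
  have c: "0 < cos z" using z by (intro cos_gt_zero_pi) auto
  have "z \<le> tan z" using abs_tan_ge[of z] z tan_pos_pi2_le[of z] by auto
  moreover have "1 \<le> 1 + cos y" using assms by (auto intro!: cos_ge_zero)
  ultimately have "z * 1 \<le> tan z * (1 + cos y)" using z by (intro mult_mono) auto
  also have "1 + cos y = 2 * (cos z)\<^sup>2" unfolding z(3) cos_double_cos by simp
  also have "tan z * (2 * (cos z)\<^sup>2) = sin y"
    unfolding z(3) sin_double tan_def using c by (simp add: power2_eq_square)
  finally show ?thesis by (simp add: z_def)
qed

lemma angle_range:
  assumes "1 / 4 < x" "x < 1 / 2"
  shows "0 < 2 * pi * (x - 1 / 4)" "2 * pi * (x - 1 / 4) < pi / 2"
proof -
  show "0 < 2 * pi * (x - 1 / 4)" using assms(1) by (intro mult_pos_pos) auto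
  have "2 * pi * (x - 1 / 4) < 2 * pi * (1 / 2 - 1 / 4)"
    by (rule mult_strict_left_mono[OF diff_strict_right_mono[OF assms(2)]]) simp
  then show "2 * pi * (x - 1 / 4) < pi / 2" by simp
qed

text \<open>A fraction \<open>m / N\<close> above 1/4 exceeds it by at least
  \<open>1 / (4 * N)\<close>, because \<open>4 * m - N\<close> is a positive integer. So the angle
  is at least \<open>1 / N\<close> and its sine at least \<open>1 / (2 * N)\<close>.\<close>

lemma ln_sin_bound:
  fixes m N :: nat
  assumes N: "1 \<le> N" and x: "1 / 4 < real m / real N" "real m / real N < 1 / 2"
  shows "\<bar>ln (sin (2 * pi * (real m / real N - 1 / 4)))\<bar> \<le> ln (real N + 1) + ln 2"
proof -
  define y where "y = 2 * pi * (real m / real N - 1 / 4)"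
  have y: "0 < y" "y < pi / 2" unfolding y_def by (rule angle_range[OF x])+
  have "real N < 4 * real m" using x(1) N by (simp add: field_simps)
  then have "N + 1 \<le> 4 * m" by linarith
  then have "real N + 1 \<le> 4 * real m" by linarith
  then have "1 / (4 * real N) \<le> real m / real N - 1 / 4" using N by (simp add: field_simps)
  then have "2 * pi * (1 / (4 * real N)) \<le> y" unfolding y_def by (intro mult_left_mono) auto
  moreover have "1 / real N \<le> 2 * pi * (1 / (4 * real N))" using N pi_gt3 by (simp add: field_simps)
  ultimately have "1 / real N \<le> y" by linarith
  then have "1 / (2 * real N) \<le> y / 2" by (simp add: field_simps)
  also have "y / 2 \<le> sin y" using y by (intro sin_ge_half) auto
  finally have s: "1 / (2 * real N) \<le> sin y" .
  have s0: "0 < sin y" using y by (intro sin_gt_zero2) auto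
  have "- ln (sin y) \<le> - ln (1 / (2 * real N))" using s s0 N by simp
  also have "\<dots> = ln (real N) + ln 2" using N by (simp add: ln_div ln_mult)
  also have "\<dots> \<le> ln (real N + 1) + ln 2" using N by simp
  finally have "- ln (sin y) \<le> ln (real N + 1) + ln 2" .
  moreover have "ln (sin y) \<le> 0" using s0 by simp
  ultimately show ?thesis unfolding y_def[symmetric] by linarith
qed

section \<open>Moment and tail bounds for the partial sums, as used by the estimators\<close>

context weakly_dependent
begin

lemma expectation_abs_S: "(\<integral>x. \<bar>S n x\<bar> \<partial>M) \<le> sqrt (C2 * real n)"
proof -
  have "0 \<le> variance (\<lambda>x. \<bar>S n x\<bar>)" by (rule variance_positive)
  also have "\<dots> = (\<integral>x. (S n x)\<^sup>2 \<partial>M) - (\<integral>x. \<bar>S n x\<bar> \<partial>M)\<^sup>2" by (subst variance_eq) auto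
  finally have "(\<integral>x. \<bar>S n x\<bar> \<partial>M)\<^sup>2 \<le> C2 * real n" using second_moment_le[of n] by linarith
  then show ?thesis by (rule real_le_rsqrt)
qed

lemma tail_bound:
  assumes "0 < \<epsilon>"
  shows "prob {x \<in> space M. \<bar>S n x\<bar> \<ge> \<epsilon>} \<le> (\<integral>x. S n x ^ 4 \<partial>M) / \<epsilon> ^ 4"
proof -
  have "prob {x \<in> space M. \<bar>S n x\<bar> \<ge> \<epsilon>} \<le> prob {x \<in> space M. S n x ^ 4 \<ge> \<epsilon> ^ 4}"
  proof (rule finite_measure_mono)
    show "{x \<in> space M. \<bar>S n x\<bar> \<ge> \<epsilon>} \<subseteq> {x \<in> space M. S n x ^ 4 \<ge> \<epsilon> ^ 4}"
    proof safe
      fix x assume "\<epsilon> \<le> \<bar>S n x\<bar>"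
      then have "\<epsilon> ^ 4 \<le> \<bar>S n x\<bar> ^ 4" using assms by (intro power_mono) auto
      then show "\<epsilon> ^ 4 \<le> S n x ^ 4" by simp
    qed
  qed measurable
  also have "\<dots> \<le> (\<integral>x. S n x ^ 4 \<partial>M) / \<epsilon> ^ 4"
    by (rule integral_Markov_inequality_measure[where A="{}"]) (use assms in auto)
  finally show ?thesis .
qed

end

context gaussian_AR1
begin

sublocale weakly_dependent M "\<lambda>i. coords {..i + k}" Z KK r cc
  by (rule weakly_dependent)

lemma v2_pos: "0 < v2"
proof -
  have "0 < p * (1 - p)" using orthant by (intro mult_pos_pos) auto
  moreover have "0 \<le> (\<Sum>l. cc (Suc l))" by (intro suminf_nonneg summable_c cc_nonneg)
  ultimately show ?thesis unfolding v2_def cc_0 by linarith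
qed

text \<open>For \<open>n < k\<close> the truncated subtraction gives one summand, and for \<open>n = k\<close> the quotient is \<open>0\<close>.\<close>

definition P :: "nat \<Rightarrow> 'a \<Rightarrow> real" where
  "P n x = 1 / (real n - real k) * (\<Sum>j=0..n-k. Y j x)"

lemma P_shift: "P (N + k) x = (S (Suc N) x + real (Suc N) * p) / real N"
proof -
  have "(\<Sum>j=0..N. Y j x) = (\<Sum>j<Suc N. Z j x + p)"
    unfolding Z_def by (simp add: atLeast0AtMost lessThan_Suc_atMost)
  then show ?thesis unfolding P_def S_def by (simp add: sum.distrib)
qed

text \<open>The sum has one term more than the divisor, which leaves the bias \<open>p / N\<close>.
  It is of smaller order than \<open>1 / sqrt N\<close> and so disappears in every limit.\<close>

lemma P_diff: "1 \<le> N \<Longrightarrow> P (N + k) x - p = S (Suc N) x / real N + p / real N"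
  unfolding P_shift by (simp add: field_simps)

lemma P_measurable[measurable]: "P n \<in> borel_measurable M"
  unfolding P_def by measurable

text \<open>Integrality of the count serves two purposes: finitely many values make any function of
  \<open>P n\<close> measurable, and the denominator yields the logarithmic bound on
  \<open>g\<close>.\<close>

lemma P_count: "\<exists>m\<le>Suc (n - k). P n x = real m / (real n - real k)"
proof -
  have "(\<Sum>j=0..n-k. Y j x) = real (card {j \<in> {0..n-k}. X j x > 0 \<and> X (j + k) x > 0})"
    unfolding Y_def by (simp add: sum_of_bool_eq Int_def)
  moreover have "card {j \<in> {0..n-k}. X j x > 0 \<and> X (j + k) x > 0} \<le> card {0..n-k}"
    by (intro card_mono) auto
  ultimately show ?thesis unfolding P_def by (intro exI[of _ "card {j \<in> {0..n-k}. X j x > 0 \<and> X (j + k) x > 0}"]) auto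
qed

text \<open>The bound is 2 and not 1 because of the surplus summand:
  \<open>N + 1 \<le> 2 * N\<close> with \<open>N = n - k\<close>. Negative values arise only for
  \<open>n < k\<close>, where the divisor is negative. \<open>P_early\<close> keeps
  \<open>n \<le> k\<close> out of the interval where the formula for \<open>g\<close>
  applies.\<close>

lemma P_range: "- 1 \<le> P n x" "P n x \<le> 2" and P_early: "n \<le> k \<Longrightarrow> P n x \<le> 0"
proof -
  obtain m where m: "m \<le> Suc (n - k)" "P n x = real m / (real n - real k)" using P_count by blast
  consider "n < k" | "n = k" | "k < n" by linarith
  then have "- 1 \<le> P n x \<and> P n x \<le> 2 \<and> (n \<le> k \<longrightarrow> P n x \<le> 0)"
  proof cases
    case 1
    then have "m \<le> 1" "1 \<le> real k - real n" using m(1) by auto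
    then have "0 \<le> real m / (real k - real n)" "real m / (real k - real n) \<le> 1" by auto
    moreover have "P n x = - (real m / (real k - real n))" unfolding m(2) by (simp add: minus_divide_right)
    ultimately show ?thesis by linarith
  next
    case 2 then show ?thesis using m by simp
  next
    case 3
    then have "real m \<le> 2 * (real n - real k)" "0 < real n - real k" using m(1) by auto
    then show ?thesis unfolding m(2) using 3 by (auto simp: divide_le_eq intro: order.trans[of _ 0])
  qed
  then show "- 1 \<le> P n x" "P n x \<le> 2" "n \<le> k \<Longrightarrow> P n x \<le> 0" by auto
qed

lemma P_finite_range: "finite (P n ` space M)"
proof (rule finite_subset)
  show "P n ` space M \<subseteq> (\<lambda>m. real m / (real n - real k)) ` {..Suc (n - k)}"
    using P_count by fastforce
qed simp

text \<open>\<open>f\<close> stands for \<open>g_ext h\<close> with an \<open>h\<close> that is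
  merely bounded; since \<open>P n\<close> takes finitely many values, the composition is a simple
  function.\<close>

lemma comp_P_measurable: "(\<lambda>x. f (P n x)) \<in> borel_measurable M" for f :: "real \<Rightarrow> real"
proof -
  have "simple_function M (P n)"
    by (rule simple_function_borel_measurable) (auto intro: P_finite_range)
  then have "simple_function M (f \<circ> P n)" by (rule simple_function_compose)
  then show ?thesis by (auto dest: borel_measurable_simple_function simp: comp_def)
qed

lemma ES: "(\<integral>x. S n x \<partial>M) = 0"
  unfolding S_def by (subst Bochner_Integration.integral_sum) (auto simp: EZ)

lemma P_consistent: "AE x in M. (\<lambda>n. P n x) \<longlonglongrightarrow> p"
  using strong_law
proof eventually_elim
  case (elim x)
  have "(\<lambda>N. S (Suc N) x / real (Suc N) * (real (Suc N) / real N) + p * (real (Suc N) / real N)) \<longlonglongrightarrow> 0 * 1 + p * 1"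
  proof -
    have "(\<lambda>N. real (Suc N) / real N) \<longlonglongrightarrow> 1" by real_asymp
    then show ?thesis by (intro tendsto_add tendsto_mult tendsto_const LIMSEQ_Suc[OF elim])
  qed
  moreover have "S (Suc N) x / real (Suc N) * (real (Suc N) / real N) + p * (real (Suc N) / real N) = P (N + k) x" for N
  proof -
    define s where "s = real (Suc N)"
    have "s \<noteq> 0" by (simp add: s_def)
    then show ?thesis unfolding P_shift s_def[symmetric] by (simp add: add_divide_distrib mult.commute)
  qed
  ultimately have "(\<lambda>N. P (N + k) x) \<longlonglongrightarrow> p" by simp
  then show ?case by (rule LIMSEQ_offset)
qed

text \<open>Passing to \<open>n = N + k\<close> makes the divisor \<open>N\<close>. The partial sum
  is centred, so the cross term with the bias drops out and the bias contributes only
  \<open>p\<^sup>2 / N\<^sup>2\<close>.\<close>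

lemma P_second: "(\<lambda>n. real n * (\<integral>x. (P n x - p)\<^sup>2 \<partial>M)) \<longlonglongrightarrow> v2"
proof (rule LIMSEQ_offset[of _ k])
  have "eventually (\<lambda>N. (\<integral>x. (S (Suc N) x)\<^sup>2 \<partial>M) / real (Suc N) * (real (Suc N) * real (N + k) / (real N)\<^sup>2) + p\<^sup>2 * (real (N + k) / (real N)\<^sup>2)
     = real (N + k) * (\<integral>x. (P (N + k) x - p)\<^sup>2 \<partial>M)) sequentially"
    using eventually_ge_at_top[of 1]
  proof eventually_elim
    case (elim N)
    have "(\<integral>x. (P (N + k) x - p)\<^sup>2 \<partial>M) = (\<integral>x. ((S (Suc N) x)\<^sup>2 + 2 * p * S (Suc N) x + p\<^sup>2) / (real N)\<^sup>2 \<partial>M)"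
    proof (rule Bochner_Integration.integral_cong)
      fix x
      have "P (N + k) x - p = (S (Suc N) x + p) / real N" using P_diff[OF elim, of x] by (simp add: add_divide_distrib)
      then show "(P (N + k) x - p)\<^sup>2 = ((S (Suc N) x)\<^sup>2 + 2 * p * S (Suc N) x + p\<^sup>2) / (real N)\<^sup>2"
        by (simp add: power_divide power2_sum mult_ac)
    qed simp
    also have "\<dots> = ((\<integral>x. (S (Suc N) x)\<^sup>2 \<partial>M) + p\<^sup>2) / (real N)\<^sup>2"
      by (simp add: ES prob_space)
    finally have E: "(\<integral>x. (P (N + k) x - p)\<^sup>2 \<partial>M) = ((\<integral>x. (S (Suc N) x)\<^sup>2 \<partial>M) + p\<^sup>2) / (real N)\<^sup>2" .
    define s where "s = real (Suc N)"
    have "s \<noteq> 0" by (simp add: s_def)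
    then show ?case unfolding E s_def[symmetric] by (simp add: algebra_simps add_divide_distrib)
  qed
  moreover have "(\<lambda>N. (\<integral>x. (S (Suc N) x)\<^sup>2 \<partial>M) / real (Suc N) * (real (Suc N) * real (N + k) / (real N)\<^sup>2) + p\<^sup>2 * (real (N + k) / (real N)\<^sup>2)) \<longlonglongrightarrow> v2 * 1 + p\<^sup>2 * 0"
  proof (intro tendsto_add tendsto_mult tendsto_const LIMSEQ_Suc[OF second_moment_limit])
    show "(\<lambda>N. real (Suc N) * real (N + k) / (real N)\<^sup>2) \<longlonglongrightarrow> 1" by real_asymp
    show "(\<lambda>N. real (N + k) / (real N)\<^sup>2) \<longlonglongrightarrow> 0" by real_asymp
  qed
  ultimately show "(\<lambda>N. real (N + k) * (\<integral>x. (P (N + k) x - p)\<^sup>2 \<partial>M)) \<longlonglongrightarrow> v2"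
    using Lim_transform_eventually by fastforce
qed

lemma P_first: "(\<lambda>n. sqrt (real n) * (\<integral>x. P n x - p \<partial>M)) \<longlonglongrightarrow> 0"
proof (rule LIMSEQ_offset[of _ k])
  have "eventually (\<lambda>N. p * (sqrt (real (N + k)) / real N) = sqrt (real (N + k)) * (\<integral>x. P (N + k) x - p \<partial>M)) sequentially"
    using eventually_ge_at_top[of 1]
    by eventually_elim (simp add: P_diff ES prob_space)
  moreover have "(\<lambda>N. p * (sqrt (real (N + k)) / real N)) \<longlonglongrightarrow> p * 0"
    by (intro tendsto_mult_left) real_asymp
  ultimately show "(\<lambda>N. sqrt (real (N + k)) * (\<integral>x. P (N + k) x - p \<partial>M)) \<longlonglongrightarrow> 0"
    using Lim_transform_eventually by fastforce
qed

lemma P_tail: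
  assumes \<delta>: "0 < \<delta>"
  shows "(\<lambda>n. real n * (B + ln (real n + 1) + C)\<^sup>2 * prob {x \<in> space M. \<bar>P n x - p\<bar> \<ge> \<delta>}) \<longlonglongrightarrow> 0"
proof (rule LIMSEQ_offset[of _ k])
  let ?pr = "\<lambda>N. prob {x \<in> space M. \<bar>P (N + k) x - p\<bar> \<ge> \<delta>}"
  let ?f = "\<lambda>N. real (N + k) * (B + ln (real (N + k) + 1) + C)\<^sup>2"
  let ?s = "\<lambda>N. real (Suc N) ^ 2 * sqrt (real (Suc N))"
  obtain K4 where K4: "0 \<le> K4" "\<And>N. (\<integral>x. S N x ^ 4 \<partial>M) \<le> K4 * (real N ^ 2 * sqrt (real N))"
    using fourth_moment by blast
  \<comment> \<open>For large \<open>N\<close> the bias is below \<open>\<delta> / 2\<close>, so the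
    partial sum has to account for the other half; \<open>16 = 2 ^ 4\<close> is the price of that
    split.\<close>
  define R where "R N = (?f N * (?s N / real N ^ 4)) * (16 * K4 / \<delta> ^ 4)" for N
  have "eventually (\<lambda>N. p / real N < \<delta> / 2) sequentially"
    by (rule order_tendstoD(2)[OF lim_const_over_n]) (use \<delta> in simp)
  then have "eventually (\<lambda>N. norm (?f N * ?pr N) \<le> R N) sequentially"
    using eventually_ge_at_top[of 1]
  proof eventually_elim
    case (elim N)
    have "?pr N \<le> prob {x \<in> space M. \<bar>S (Suc N) x\<bar> \<ge> \<delta> / 2 * real N}"
    proof (rule finite_measure_mono)
      show "{x \<in> space M. \<bar>P (N + k) x - p\<bar> \<ge> \<delta>} \<subseteq> {x \<in> space M. \<bar>S (Suc N) x\<bar> \<ge> \<delta> / 2 * real N}"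
      proof safe
        fix x assume "\<delta> \<le> \<bar>P (N + k) x - p\<bar>"
        then have "\<delta> \<le> \<bar>S (Suc N) x / real N\<bar> + \<bar>p / real N\<bar>" unfolding P_diff[OF elim(2)] by linarith
        moreover have "\<bar>p / real N\<bar> < \<delta> / 2" using elim(1) p01 by simp
        ultimately have "\<delta> / 2 \<le> \<bar>S (Suc N) x / real N\<bar>" by (simp add: field_simps)
        then show "\<bar>S (Suc N) x\<bar> \<ge> \<delta> / 2 * real N" using elim(2) by (simp add: abs_divide field_simps)
      qed
    qed measurable
    also have "\<dots> \<le> (\<integral>x. S (Suc N) x ^ 4 \<partial>M) / (\<delta> / 2 * real N) ^ 4"
      by (rule tail_bound) (use \<delta> elim in simp)
    also have "\<dots> \<le> (K4 * ?s N) / (\<delta> / 2 * real N) ^ 4"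
      by (intro divide_right_mono K4) simp
    finally have pr: "?pr N \<le> (K4 * ?s N) / (\<delta> / 2 * real N) ^ 4" .
    have "norm (?f N * ?pr N)
      = ?f N * ?pr N"
      by (simp add: abs_mult)
    also have "\<dots> \<le> ?f N * ((K4 * ?s N) / (\<delta> / 2 * real N) ^ 4)"
      by (rule mult_left_mono[OF pr]) simp
    also have "\<dots> = R N" unfolding R_def by (simp add: power_mult_distrib power_divide mult_ac del: of_nat_Suc)
    finally show ?case .
  qed
  moreover have "R \<longlonglongrightarrow> 0"
    unfolding R_def by (rule tendsto_mult_left_zero) real_asymp
  ultimately show "(\<lambda>N. ?f N * ?pr N) \<longlonglongrightarrow> 0"
    by (rule Lim_null_comparison)
qed

lemma P_char: "(\<lambda>n. char (distr M borel (\<lambda>x. sqrt (real n) * (P n x - p))) t) \<longlonglongrightarrow> exp (- (v2 * t\<^sup>2) / 2)"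
proof (rule LIMSEQ_offset[of _ k])
  \<comment> \<open>\<open>P\<close> scales the partial sum by \<open>w N\<close>, the limit theorem
    by \<open>1 / sqrt (N + 1)\<close>. The difference is multiplied by a first absolute moment of
    order \<open>sqrt N\<close>, so what counts is that the ratio of the two scalings tends to
    1.\<close>
  define w where "w N = sqrt (real (N + k)) / real N" for N
  let ?a = "\<lambda>N. char (distr M borel (\<lambda>x. sqrt (real (N + k)) * (P (N + k) x - p))) t"
  let ?b = "\<lambda>N. \<phi> (t / sqrt (real (Suc N))) (Suc N)"
  define R where "R N = \<bar>t\<bar> * (\<bar>w N - 1 / sqrt (real (Suc N))\<bar> * sqrt (real (Suc N)) * sqrt C2 + \<bar>w N\<bar> * p)" for N
  have "(\<lambda>N. ?a N - ?b N) \<longlonglongrightarrow> 0"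
  proof (rule Lim_null_comparison)
    show "eventually (\<lambda>N. norm (?a N - ?b N) \<le> R N) sequentially"
      using eventually_ge_at_top[of 1]
    proof eventually_elim
      case (elim N)
      define f where "f x = t * (sqrt (real (N + k)) * (P (N + k) x - p))" for x
      define g where "g x = t / sqrt (real (Suc N)) * S (Suc N) x" for x
      have [measurable]: "f \<in> borel_measurable M" "g \<in> borel_measurable M" unfolding f_def g_def by measurable
      have ab: "?a N - ?b N = (\<integral>x. iexp (f x) \<partial>M) - (\<integral>x. iexp (g x) \<partial>M)"
        unfolding f_def g_def by (simp add: char_distr \<phi>_def)
      have fg: "\<bar>f x - g x\<bar> \<le> \<bar>t\<bar> * (\<bar>w N - 1 / sqrt (real (Suc N))\<bar> * \<bar>S (Suc N) x\<bar> + \<bar>w N\<bar> * p)" for x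
      proof -
        have "f x - g x = t * ((w N - 1 / sqrt (real (Suc N))) * S (Suc N) x + w N * p)"
          unfolding f_def g_def P_diff[OF elim] w_def by (simp add: algebra_simps)
        then have "\<bar>f x - g x\<bar> = \<bar>t\<bar> * \<bar>(w N - 1 / sqrt (real (Suc N))) * S (Suc N) x + w N * p\<bar>"
          by (simp only: abs_mult)
        also have "\<dots> \<le> \<bar>t\<bar> * (\<bar>(w N - 1 / sqrt (real (Suc N))) * S (Suc N) x\<bar> + \<bar>w N * p\<bar>)"
          by (intro mult_left_mono abs_triangle_ineq) simp
        finally show ?thesis using p01 by (simp add: abs_mult)
      qed
      have "cmod (?a N - ?b N) \<le> (\<integral>x. \<bar>t\<bar> * (\<bar>w N - 1 / sqrt (real (Suc N))\<bar> * \<bar>S (Suc N) x\<bar> + \<bar>w N\<bar> * p) \<partial>M)"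
        unfolding ab by (rule cmod_integral_iexp_diff_le[OF _ _ _ fg]) simp_all
      also have "\<dots> = \<bar>t\<bar> * (\<bar>w N - 1 / sqrt (real (Suc N))\<bar> * (\<integral>x. \<bar>S (Suc N) x\<bar> \<partial>M) + \<bar>w N\<bar> * p)"
        by (simp add: prob_space)
      also have "\<dots> \<le> \<bar>t\<bar> * (\<bar>w N - 1 / sqrt (real (Suc N))\<bar> * sqrt (C2 * real (Suc N)) + \<bar>w N\<bar> * p)"
        by (intro mult_left_mono add_right_mono expectation_abs_S) auto
      also have "\<dots> = R N" unfolding R_def real_sqrt_mult by (simp only: mult_ac)
      finally show "norm (?a N - ?b N) \<le> R N" .
    qed
    have "(\<lambda>N. \<bar>t\<bar> * (\<bar>w N - 1 / sqrt (real (Suc N))\<bar> * sqrt (real (Suc N)) * sqrt C2 + \<bar>w N\<bar> * p)) \<longlonglongrightarrow> \<bar>t\<bar> * (0 * sqrt C2 + \<bar>0\<bar> * p)"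
    proof (intro tendsto_mult tendsto_add tendsto_const tendsto_rabs)
      show "w \<longlonglongrightarrow> 0" unfolding w_def by real_asymp
      show "(\<lambda>N. \<bar>w N - 1 / sqrt (real (Suc N))\<bar> * sqrt (real (Suc N))) \<longlonglongrightarrow> 0"
      proof -
        have "(\<lambda>N. (w N - 1 / sqrt (real (Suc N))) * sqrt (real (Suc N))) \<longlonglongrightarrow> 0"
          unfolding w_def by real_asymp
        then show ?thesis using tendsto_rabs_zero by (fastforce simp: abs_mult)
      qed
    qed
    then show "R \<longlonglongrightarrow> 0" unfolding R_def by simp
  qed
  moreover have "?b \<longlonglongrightarrow> exp (- (v2 * t\<^sup>2) / 2)"
    by (rule LIMSEQ_Suc[OF central_limit])
  ultimately show "?a \<longlonglongrightarrow> exp (- (v2 * t\<^sup>2) / 2)"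
    using tendsto_add by fastforce
qed

end

text \<open>The interval is open, so near \<open>x\<close> the extension is the explicit formula
  whatever \<open>h\<close> is. The derivative is a negative multiple of the cotangent of an angle
  strictly between 0 and \<open>pi / 2\<close>, hence nonzero, and this makes the limiting variance
  positive.\<close>

lemma g_ext_derivative:
  assumes "1 / 4 < x" "x < 1 / 2"
  obtains D where "D \<noteq> 0" "(g_ext h has_real_derivative D) (at x)"
proof
  define y where "y = 2 * pi * (x - 1 / 4)"
  have y: "0 < y" "y < pi / 2" unfolding y_def by (rule angle_range[OF assms])+
  have s: "0 < sin y" "0 < cos y" using y by (auto intro!: sin_gt_zero2 cos_gt_zero_pi)
  show "- (2 * pi * cos y / sin y) \<noteq> 0" using s by simp
  have "((\<lambda>x. - ln (sin (2 * pi * (x - 1 / 4)))) has_real_derivative - (2 * pi * cos y / sin y)) (at x)"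
    using s by (auto intro!: derivative_eq_intros simp: y_def)
  then show "(g_ext h has_real_derivative - (2 * pi * cos y / sin y)) (at x)"
    by (rule has_field_derivative_transform_within_open[of _ _ _ "{1 / 4<..<1 / 2}"])
       (use assms in \<open>auto simp: g_ext_def\<close>)
qed

section \<open>The delta method applied to \<open>g\<close>\<close>

context gaussian_AR1
begin

lemma g_ext_p: "g_ext h p = real k * - ln \<rho>"
  using orthant \<rho> by (simp add: g_ext_def ln_realpow)

text \<open>Inside (1/4, 1/2) the estimate is positive, so \<open>P_early\<close> forces
  \<open>n > k\<close> and the divisor is the positive integer \<open>n - k\<close> required by
  \<open>ln_sin_bound\<close>; elsewhere the values are those of the bounded
  \<open>h\<close>.\<close>

lemma g_ext_P_bound:
  assumes B: "\<And>x. \<bar>h x\<bar> \<le> B"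
  shows "\<bar>g_ext h (P n w)\<bar> \<le> (B + ln 2) + ln (real n + 1)"
proof -
  have B0: "0 \<le> B" using B[of 0] by linarith
  have ln0: "0 \<le> ln 2 + ln (real n + 1)" by (intro add_nonneg_nonneg) auto
  show ?thesis
  proof (cases "1 / 4 < P n w \<and> P n w < 1 / 2")
    case True
    then have "k < n" using P_early[of n w] by (cases "k < n") auto
    obtain m where m: "P n w = real m / (real n - real k)" using P_count by blast
    have N: "real n - real k = real (n - k)" "1 \<le> n - k" using \<open>k < n\<close> by (auto simp: of_nat_diff)
    have "\<bar>g_ext h (P n w)\<bar> = \<bar>ln (sin (2 * pi * (real m / real (n - k) - 1 / 4)))\<bar>"
      using True unfolding g_ext_def m N(1) by simp
    also have "\<dots> \<le> ln (real (n - k) + 1) + ln 2"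
      by (rule ln_sin_bound[OF N(2)]) (use True in \<open>auto simp: m N(1)\<close>)
    also have "ln (real (n - k) + 1) \<le> ln (real n + 1)" by simp
    finally show ?thesis using B0 by linarith
  next
    case False
    then have "g_ext h (P n w) = h (P n w)" by (simp only: g_ext_def if_False)
    then show ?thesis using B[of "P n w"] ln0 by linarith
  qed
qed

lemma g_ext_P_delta_method:
  assumes B: "\<And>x. \<bar>h x\<bar> \<le> B" and D: "(g_ext h has_real_derivative D) (at p)"
  shows "delta_method M P (g_ext h) p D v2 (\<lambda>n. (B + ln 2) + ln (real n + 1))"
proof
  show "\<bar>P n w - p\<bar> \<le> 2" for n w
    using P_range[of n w] orthant by (simp add: abs_le_iff)
qed (use P_measurable comp_P_measurable g_ext_P_bound[OF B] D P_second P_first P_tail in auto)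

lemma estimator:
  assumes B: "\<And>x. \<bar>h x\<bar> \<le> B"
  defines "T \<equiv> \<lambda>n w. g_ext h (P n w) / real k"
    and "s2 \<equiv> v2 * (deriv (g_ext h) p)\<^sup>2 / (real k)\<^sup>2"
  shows "strongly_consistent M T (- ln \<rho>)"
    and "asymptotically_normal M T (- ln \<rho>) s2"
    and "(\<lambda>n. variance (T n)) \<sim>[sequentially] (\<lambda>n. v2 * (deriv (g_ext h) p)\<^sup>2 / (real n * (real k)\<^sup>2))"
proof -
  obtain D where D: "D \<noteq> 0" "(g_ext h has_real_derivative D) (at p)"
    using g_ext_derivative orthant by blast
  have derivD: "deriv (g_ext h) p = D" by (rule DERIV_imp_deriv[OF D(2)])
  interpret DM: delta_method M P "g_ext h" p D v2 "\<lambda>n. (B + ln 2) + ln (real n + 1)"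
    by (rule g_ext_P_delta_method[OF B D(2)])
  have k0: "0 < real k" using k by simp
  have s2: "s2 = v2 * D\<^sup>2 / (real k)\<^sup>2" unfolding s2_def derivD ..
  have s2_pos: "0 < s2" unfolding s2 using v2_pos D k0 by simp
  have \<theta>: "- ln \<rho> = g_ext h p / real k" using k0 by (simp add: g_ext_p)
  have T_measurable: "T n \<in> borel_measurable M" for n
    unfolding T_def by (intro borel_measurable_divide comp_P_measurable borel_measurable_const)
  show "strongly_consistent M T (- ln \<rho>)"
    unfolding strongly_consistent_def using P_consistent
  proof eventually_elim
    case (elim w)
    have "isCont (g_ext h) p" using D(2) by (rule DERIV_isCont)
    then have "(\<lambda>n. g_ext h (P n w)) \<longlonglongrightarrow> g_ext h p" using elim by (rule isCont_tendsto_compose)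
    then show ?case unfolding T_def \<theta> using k0 by (intro tendsto_divide) auto
  qed
  show "asymptotically_normal M T (- ln \<rho>) s2"
    unfolding asymptotically_normal_def
  proof (intro conjI allI s2_pos T_measurable levy_continuity)
    fix n
    show "real_distribution (distr M borel (\<lambda>w. sqrt (real n) * (T n w - - ln \<rho>)))"
      by (rule real_distribution_distr) (intro borel_measurable_times borel_measurable_diff T_measurable borel_measurable_const)
  next
    show "real_distribution (density lborel (normal_density 0 (sqrt s2)))"
      by (rule real_distribution_normal) (use s2_pos in simp)
  next
    fix t
    have ch: "char (distr M borel (\<lambda>w. sqrt (real n) * (T n w - - ln \<rho>))) t
      = char (distr M borel (\<lambda>w. sqrt (real n) * (g_ext h (P n w) - g_ext h p))) (t / real k)" for n
    proof -
      have e: "t * (sqrt (real n) * (T n w - - ln \<rho>)) = t / real k * (sqrt (real n) * (g_ext h (P n w) - g_ext h p))" for w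
        unfolding T_def \<theta> using k0 by (simp add: field_simps)
      have [measurable]: "(\<lambda>w. g_ext h (P n w)) \<in> borel_measurable M" by (rule comp_P_measurable)
      have [measurable]: "T n \<in> borel_measurable M" by (rule T_measurable)
      have "char (distr M borel (\<lambda>w. sqrt (real n) * (T n w - - ln \<rho>))) t
        = (\<integral>w. iexp (t * (sqrt (real n) * (T n w - - ln \<rho>))) \<partial>M)"
        by (rule char_distr) measurable
      also have "\<dots> = (\<integral>w. iexp (t / real k * (sqrt (real n) * (g_ext h (P n w) - g_ext h p))) \<partial>M)"
        by (simp only: e)
      also have "\<dots> = char (distr M borel (\<lambda>w. sqrt (real n) * (g_ext h (P n w) - g_ext h p))) (t / real k)"
        by (rule char_distr[symmetric]) measurable
      finally show ?thesis .
    qed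
    have "(\<lambda>n. char (distr M borel (\<lambda>w. sqrt (real n) * (T n w - - ln \<rho>))) t) \<longlonglongrightarrow> exp (- (v2 * (D * (t / real k))\<^sup>2) / 2)"
      unfolding ch by (rule DM.char_limit[OF P_char])
    also have "complex_of_real (exp (- (v2 * (D * (t / real k))\<^sup>2) / 2)) = char (density lborel (normal_density 0 (sqrt s2))) t"
      using s2_pos by (subst char_normal) (simp_all add: s2 power_mult_distrib power_divide)
    finally show "(\<lambda>n. char (distr M borel (\<lambda>w. sqrt (real n) * (T n w - - ln \<rho>))) t)
      \<longlonglongrightarrow> char (density lborel (normal_density 0 (sqrt s2))) t" .
  qed
  show "(\<lambda>n. variance (T n)) \<sim>[sequentially] (\<lambda>n. v2 * (deriv (g_ext h) p)\<^sup>2 / (real n * (real k)\<^sup>2))"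
  proof (rule asymp_equivI')
    have varT: "variance (T n) = variance (\<lambda>w. g_ext h (P n w)) / (real k)\<^sup>2" for n
    proof -
      have "(T n w - expectation (T n))\<^sup>2 = (g_ext h (P n w) - expectation (\<lambda>w. g_ext h (P n w)))\<^sup>2 / (real k)\<^sup>2" for w
        unfolding T_def by (simp add: diff_divide_distrib[symmetric] power_divide)
      then show ?thesis by simp
    qed
    have "(\<lambda>n. real n * variance (\<lambda>w. g_ext h (P n w)) / (v2 * D\<^sup>2)) \<longlonglongrightarrow> D\<^sup>2 * v2 / (v2 * D\<^sup>2)"
      using v2_pos D(1) by (intro tendsto_divide DM.scaled_variance tendsto_const) auto
    moreover have "D\<^sup>2 * v2 / (v2 * D\<^sup>2) = 1" using v2_pos D(1) by simp
    moreover have "real n * variance (\<lambda>w. g_ext h (P n w)) / (v2 * D\<^sup>2)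
      = variance (T n) / (v2 * (deriv (g_ext h) p)\<^sup>2 / (real n * (real k)\<^sup>2))" for n
      unfolding varT derivD using k0 by (simp add: field_simps)
    ultimately show "(\<lambda>n. variance (T n) / (v2 * (deriv (g_ext h) p)\<^sup>2 / (real n * (real k)\<^sup>2))) \<longlonglongrightarrow> 1"
      by (simp only:)
  qed
qed

end

text \<open>The passage from continuous to discrete time: stationarity at the finitely many real
  times in the image of \<open>J\<close> gives \<open>shift\<close>.\<close>

lemma stationary_OU_gaussian_AR1:
  assumes "0 < \<alpha>" and "0 < \<tau>" and OU: "stationary_OU M \<alpha> \<tau> X" and "1 \<le> k"
  shows "gaussian_AR1 M (case_nat (X 0) (\<lambda>i x. X (real i + 1) x - exp (- \<alpha>) * X (real i) x))
    (\<lambda>n. X (real n)) (exp (- \<alpha>)) (\<tau> / sqrt (2 * \<alpha>)) k"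
proof -
  interpret prob_space M using OU by (simp add: stationary_OU_def)
  have stat: "stationary_process M X" using OU by (simp add: stationary_OU_def)
  show ?thesis
  proof
    show "indep_vars (\<lambda>_. borel) (case_nat (X 0) (\<lambda>i x. X (real i + 1) x - exp (- \<alpha>) * X (real i) x)) UNIV"
      by (rule OU_AR1(1)[OF assms(1-3)])
    show "distr M borel (X (real n)) = density lborel (normal_density 0 (\<tau> / sqrt (2 * \<alpha>)))" for n
      by (rule OU_AR1(2)[OF assms(1-3)])
    fix J :: "nat set" and h :: nat
    assume J: "finite J"
    have f: "(\<lambda>g. \<lambda>j\<in>J. g (real j)) \<in> measurable (PiM (real ` J) (\<lambda>_. borel)) (PiM J (\<lambda>_. borel :: real measure))"
      by (intro measurable_restrict measurable_component_singleton) auto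
    have "distr M (PiM J (\<lambda>_. borel)) (\<lambda>x. \<lambda>j\<in>J. (\<lambda>t\<in>real ` J. X (t + real h) x) (real j))
      = distr M (PiM J (\<lambda>_. borel)) (\<lambda>x. \<lambda>j\<in>J. (\<lambda>t\<in>real ` J. X t x) (real j))"
      by (rule stationary_process_distr[OF stat _ _ _ f]) (use J in auto)
    then show "distr M (PiM J (\<lambda>_. borel)) (\<lambda>x. \<lambda>j\<in>J. X (real (j + h)) x)
      = distr M (PiM J (\<lambda>_. borel)) (\<lambda>x. \<lambda>j\<in>J. X (real j) x)"
      by (simp cong: restrict_cong)
  qed (use assms in \<open>auto simp: add.commute\<close>)
qed

theorem theorem3:
  fixes M :: "'a measure" and X :: "real \<Rightarrow> 'a \<Rightarrow> real"
    and \<alpha> \<tau> :: real and k :: nat and h :: "real \<Rightarrow> real"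
  assumes "0 < \<alpha>" and "0 < \<tau>"
    and "stationary_OU M \<alpha> \<tau> X"
    and "1 \<le> k"
    and "bounded (range h)"
  shows "strongly_consistent M (alpha_hat h X k) \<alpha>
    \<and> summable (\<lambda>l. orthant_cov M X k (Suc l))
    \<and> asymptotically_normal M (alpha_hat h X k) \<alpha>
        (v_sq M X k * (deriv (g_ext h) (p_prob M X k))\<^sup>2 / (real k)\<^sup>2)
    \<and> (\<lambda>n. prob_space.variance M (alpha_hat h X k n)) \<sim>[sequentially]
        (\<lambda>n. v_sq M X k * (deriv (g_ext h) (p_prob M X k))\<^sup>2 / (real n * (real k)\<^sup>2))"
proof -
  obtain B where B: "\<And>x. \<bar>h x\<bar> \<le> B"
    using assms(5) unfolding bounded_iff by auto
  interpret gaussian_AR1 M "case_nat (X 0) (\<lambda>i w. X (real i + 1) w - exp (- \<alpha>) * X (real i) w)"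
    "\<lambda>n. X (real n)" "exp (- \<alpha>)" "\<tau> / sqrt (2 * \<alpha>)" k
    by (rule stationary_OU_gaussian_AR1[OF assms(1-4)])
  have p: "p_prob M X k = p" by (simp add: p_prob_def p_def)
  have cc: "orthant_cov M X k l = cc l" for l by (simp add: orthant_cov_def cc_def p)
  have v: "v_sq M X k = v2" unfolding v_sq_def v2_def p cc cc_0 ..
  have a: "alpha_hat h X k = (\<lambda>n w. g_ext h (P n w) / real k)"
    by (simp add: alpha_hat_def p_hat_def P_def Y_def fun_eq_iff)
  have \<alpha>: "\<alpha> = - ln (exp (- \<alpha>))" by simp
  show ?thesis
    unfolding p cc v a
    using estimator[of h B, OF B, folded \<alpha>] summable_c by blast
qed

end
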